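(* In the two-tier cache-enabled network model described in the context, the successful content delivery probability in the interference-limited scenario (noise power $\sigma^2\to0$) is given by $$\tilde C=Q_{Mp}\tilde C_{Mp}+Q_{Lp}\tilde C_{Lp,2}+Q_{Lp}\tilde C^w_{Lp,1}C^b_{Lp,1},$$ where $$\tilde C_{Mp}=\sum_{l_1=0}^\infty\Big(G(\delta_1,\alpha)+p_a\hat\lambda_{2,1}\hat P_{2,1}^{2/\alpha}H(\delta_1,\alpha)+1\Big)^{-1}P_{L_1}(l_1+1),$$ $$\tilde C_{Lp,2}=\sum_{l_2=0}^\infty\big(\xi_2G(\delta_2,\alpha)+\varsigma_2H(\delta_2,\alpha)+\zeta_2\big)^{-1}P_{L_2}(l_2+1),$$ $$\tilde C^w_{Lp,1}=\sum_{l_1=0}^\infty\big(\xi_1G(\delta_1,\alpha)+\varsigma_1H(\delta_1,\alpha)+\zeta_1\big)^{-1}P_{L_1}(l_1+1)$$ are the values of $C_{Mp}$, $C_{Lp,2}$, $C^w_{Lp,1}$ when $\sigma^2\to0$, and the backhaul probability $C^b_{Lp,1}$ is unchanged. Here $\delta_k=2^{(l_k+1)R_0/W}-1$, $\hat\lambda_{2,1}=\lambda_2/\lambda_1$, $\hat P_{2,1}=P_2/P_1$, and, for $k=1,2$ with $\lambda_1'=\lambda_1$, $\lambda_2'=p_{Lp}\lambda_2$, $$\xi_k=\frac{\lambda_1P_1+p_ap_{Lp}\lambda_2P_2}{\lambda_k'P_k},\quad \varsigma_k=\frac{p_a(1-p_{Lp})\lambda_2P_2}{\lambda_k'P_k},\quad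 \zeta_k=\frac{\lambda_1P_1+p_{Lp}\lambda_2P_2}{\lambda_k'P_k}.$$
   Context: Parameters: path loss exponent $\alpha\in(2,4]$; $\lambda_1,\lambda_2,\lambda_u,P_1,P_2,W,R_0>0$; noise power $\sigma^2\ge 0$; backhaul capacity $C_b>0$; integers $N,N_1,N_2\ge1$ with $N_1<N$ and $N_2\le N-N_1$; $\gamma\ge0$. Contents: content $n\in\{1,\dots,N\}$ is requested with probability $q_n=n^{-\gamma}/\sum_{k=1}^N k^{-\gamma}$. The first group is $\{1,\dots,N_1\}$, stored by every macro base station (MBS); the second group is $\{N_1+1,\dots,N\}$, each content of which is stored by each helper independently with probability $p_{Lp}=N_2/(N-N_1)$. Put $Q_{Mp}=\sum_{n\le N_1}q_n$, $Q_{Lp}=1-Q_{Mp}$. Network: MBSs (tier 1) and helpers (tier 2) form independent homogeneous Poisson point processes $\Phi_1,\Phi_2$ in $\mathbb R^2$ of intensities $\lambda_1,\lambda_2$, with transmit powers $P_1,P_2$; users have density $\lambda_u$. A tagged user is at the origin; the base station $x_{i,j}$ at distance $z_{i,j}$ from the origin has received power $P_ih_{i,j}z_{i,j}^{-\alpha}$, with $h_{i,j}$ i.i.d. exponential of mean 1, independent of the locations. Association constants: $A_{Lp,1}=\frac{\lambda_1P_1^{2/\alpha}}{\lambda_1P_1^{2/\alpha}+p_{Lp}\lambda_2P_2^{2/\alpha}}$, $A_{Lp,2}=1-A_{Lp,1}$, $A_1=Q_{Mp}+Q_{Lp}A_{Lp,1}$, $A_2=Q_{Lp}A_{Lp,2}$.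 Load: the number $L_k$ of users served by the serving base station of tier $k$ (tagged user included) is taken to be independent of locations and fading, with law, for $l\ge 0$, $$P_{L_k}(l+1)=\mathbb P(L_k=l+1)=\frac{3.5^{3.5}}{l!}\frac{\Gamma(l+4.5)}{\Gamma(3.5)}\Big(\frac{A_k\lambda_u}{\lambda_k}\Big)^{l}\Big(3.5+\frac{A_k\lambda_u}{\lambda_k}\Big)^{-(l+4.5)}.$$ Active helpers: only active helpers transmit; a serving helper is active and non-serving helpers are active independently with probability $p_a=1-\big(1+\frac{A_2\lambda_u}{3.5\lambda_2}\big)^{-3.5}$. First-group request: the user is served by the nearest MBS $x_0$, at distance $z$ with fading $h$; $\mathrm{SINR}=\frac{P_1hz^{-\alpha}}{I+\sigma^2}$, where $I$ is the sum of received powers from all MBSs other than $x_0$ and all active helpers. $C_{Mp}=\mathbb P\big(\frac{W}{L_1}\log_2(1+\mathrm{SINR})\ge R_0\big)$. Second-group request for content $f_n$: the user is served by the base station $x_0$ maximizing $P_iz_{i,j}^{-\alpha}$ over $\Phi_1\cup\Phi_{n^+,2}$, where $\Phi_{n^+,2}$ is the set of helpers storing $f_n$. If $x_0$ is in tier $k$, at distance $z$ with fading $h$, then $\mathrm{SINR}=\frac{P_khz^{-\alpha}}{I+\sigma^2}$, with $I$ the sum of received powers from all MBSs and all active helpers (storing or not storing $f_n$) other than $x_0$. $C_{Lp,2}$ is the probability that $x_0$ is in tier 2 and $\frac{W}{L_2}\log_2(1+\mathrm{SINR})\ge R_0$; $C^w_{Lp,1}$ is the probability that $x_0$ is in tier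 1 and $\frac{W}{L_1}\log_2(1+\mathrm{SINR})\ge R_0$. Backhaul: $C^b_{Lp,1}$ denotes the successful backhaul delivery probability, i.e. the probability that the backhaul delivery rate $R^b_{Lp,1}$ of the MBS is at least $R_0$ when the user requests a second-group content and connects to the MBS tier. The backhaul supports $N_b=C_b/R_0$ users at rate $R_0$; if more users of the MBS need it, $N_b$ of them are picked at random. With $p_b=Q_{Lp}A_{Lp,1}/A_1$ the probability that a user of an MBS needs the backhaul, this probability given the load $L_1=l_1+1$ is $$C^b_{Lp,1}(l_1+1)=\sum_{m=0}^{l_1}\binom{l_1}{m}(1-p_b)^{l_1-m}p_b^m\min\Big\{1,\frac{N_b}{m+1}\Big\}.$$ Successful content delivery probability: the probability that the requested content is accessed with delivery rate exceeding $R_0$, which, treating access link and backhaul link as independent, is $C=Q_{Mp}C_{Mp}+Q_{Lp}C_{Lp,2}+Q_{Lp}C^w_{Lp,1}C^b_{Lp,1}$. Functions: $G(x,\alpha)=\frac{2x}{\alpha-2}\,{}_2F_1\big(1,1-\tfrac2\alpha;2-\tfrac2\alpha;-x\big)$ and $H(x,\alpha)=\frac2\alpha x^{2/\alpha}B\big(\tfrac2\alpha,1-\tfrac2\alpha\big)$, with ${}_2F_1$ the Gauss hypergeometric function and $B$ the Beta function.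
   Formalization: In ξ_k, ς_k and ζ_k the transmit powers P_1, P_2, P_k are raised to the power 2/α, as in the association constants; as printed, without this exponent, the formulas fail for P_1≠P_2 (for P_1=P_2 both agree). *)

theory Defs
  imports "HOL-Probability.Probability" "HOL-Complex_Analysis.Complex_Analysis"
begin

datatype tier = MBS | Helper

text \<open>The noise power is not a field: it is the argument of the probabilities below,
  because it is sent to 0.\<close>

record parameters =
  pathloss :: real
  intensity :: "tier \<Rightarrow> real"
  user_density :: real
  power :: "tier \<Rightarrow> real"
  bandwidth :: real
  target_rate :: real
  backhaul_capacity :: real
  skew :: real
  num_contents :: nat
  num_first :: nat
  cache_size :: nat

definition valid_parameters :: "parameters \<Rightarrow> bool" where
  "valid_parameters par \<longleftrightarrow>
     2 < pathloss par \<and> pathloss par \<le> 4 \<and>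
     (\<forall>k. 0 < intensity par k) \<and> 0 < user_density par \<and> (\<forall>k. 0 < power par k) \<and>
     0 < bandwidth par \<and> 0 < target_rate par \<and> 0 < backhaul_capacity par \<and> 0 \<le> skew par \<and>
     1 \<le> num_contents par \<and> 1 \<le> num_first par \<and> 1 \<le> cache_size par \<and>
     num_first par < num_contents par \<and>
     cache_size par \<le> num_contents par - num_first par"

definition request_prob :: "parameters \<Rightarrow> nat \<Rightarrow> real" where
  "request_prob par n =
     real n powr (- skew par) / (\<Sum>k=1..num_contents par. real k powr (- skew par))"

definition second_group :: "parameters \<Rightarrow> nat set" where
  "second_group par = {num_first par + 1..num_contents par}"

definition p_Lp :: "parameters \<Rightarrow> real" where
  "p_Lp par = real (cache_size par) / (real (num_contents par) - real (num_first par))"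

definition Q_Mp :: "parameters \<Rightarrow> real" where
  "Q_Mp par = (\<Sum>n=1..num_first par. request_prob par n)"

definition Q_Lp :: "parameters \<Rightarrow> real" where
  "Q_Lp par = 1 - Q_Mp par"

definition A_Lp_1 :: "parameters \<Rightarrow> real" where
  "A_Lp_1 par =
     (let w = (\<lambda>k. intensity par k * power par k powr (2 / pathloss par))
      in w MBS / (w MBS + p_Lp par * w Helper))"

fun A_Lp :: "parameters \<Rightarrow> tier \<Rightarrow> real" where
  "A_Lp par MBS = A_Lp_1 par"
| "A_Lp par Helper = 1 - A_Lp_1 par"

fun A_assoc :: "parameters \<Rightarrow> tier \<Rightarrow> real" where
  "A_assoc par MBS = Q_Mp par + Q_Lp par * A_Lp par MBS"
| "A_assoc par Helper = Q_Lp par * A_Lp par Helper"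

text \<open>\<open>load_law par k l\<close> is the probability of the load \<open>l + 1\<close>: the index \<open>l\<close> counts the
  users of the serving base station other than the tagged one.\<close>

definition load_law :: "parameters \<Rightarrow> tier \<Rightarrow> nat \<Rightarrow> real" where
  "load_law par k l =
     (let \<rho> = A_assoc par k * user_density par / intensity par k
      in 3.5 powr 3.5 / fact l * (Gamma (real l + 4.5) / Gamma 3.5) * \<rho> ^ l
           * (3.5 + \<rho>) powr (- (real l + 4.5)))"

definition p_active :: "parameters \<Rightarrow> real" where
  "p_active par =
     1 - (1 + A_assoc par Helper * user_density par / (3.5 * intensity par Helper)) powr (- 3.5)"


subsection \<open>Random elements of the network\<close>

text \<open>A point process is given by an enumeration \<open>X 0, X 1, ...\<close> of its points; the whole
  plane contains infinitely many of them almost surely. Since \<open>card\<close> is 0 on infinite sets,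
  local finiteness is required separately.\<close>

definition point_count :: "(nat \<Rightarrow> 'w \<Rightarrow> real^2) \<Rightarrow> (real^2) set \<Rightarrow> 'w \<Rightarrow> nat" where
  "point_count X B \<omega> = card {j. X j \<omega> \<in> B}"

definition poisson_point_process ::
    "'w measure \<Rightarrow> real \<Rightarrow> (nat \<Rightarrow> 'w \<Rightarrow> real^2) \<Rightarrow> bool" where
  "poisson_point_process M lam X \<longleftrightarrow>
     (\<forall>j. X j \<in> borel_measurable M) \<and>
     (\<forall>B\<in>sets borel. bounded B \<longrightarrow>
        (AE \<omega> in M. finite {j. X j \<omega> \<in> B}) \<and>
        (\<forall>m. measure M {\<omega>\<in>space M. point_count X B \<omega> = m} =
               (lam * measure lborel B) ^ m / fact m * exp (- (lam * measure lborel B)))) \<and>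
     (\<forall>B :: nat \<Rightarrow> (real^2) set.
        disjoint_family B \<and> (\<forall>i. B i \<in> sets borel \<and> bounded (B i)) \<longrightarrow>
        prob_space.indep_vars M (\<lambda>_. count_space UNIV) (\<lambda>i. point_count X (B i)) UNIV)"

text \<open>\<open>stores net n j\<close>: helper \<open>j\<close> stores content \<open>n\<close>. \<open>active net j\<close>: helper \<open>j\<close> would
  be active as a non-serving helper; this mark is ignored for the serving helper.\<close>

record 'w network =
  location :: "tier \<Rightarrow> nat \<Rightarrow> 'w \<Rightarrow> real^2"
  fading :: "tier \<Rightarrow> nat \<Rightarrow> 'w \<Rightarrow> real"
  stores :: "nat \<Rightarrow> nat \<Rightarrow> 'w \<Rightarrow> bool"
  active :: "nat \<Rightarrow> 'w \<Rightarrow> bool"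
  load :: "tier \<Rightarrow> 'w \<Rightarrow> nat"

datatype source = Locations tier | Fading tier nat | Storage nat | Activity nat | Load

text \<open>Sigma-algebras generated by the random elements relevant for content \<open>n\<close> and the load
  of tier \<open>k\<close>. Independence is only asked for one content and one load at a time: nothing
  is assumed on the joint law of the contents of one helper, nor on that of the two loads.\<close>

fun source_algebra ::
    "'w measure \<Rightarrow> 'w network \<Rightarrow> nat \<Rightarrow> tier \<Rightarrow> source \<Rightarrow> 'w set set" where
  "source_algebra M net n k (Locations i) =
     sets (vimage_algebra (space M) (\<lambda>\<omega> j. location net i j \<omega>) (\<Pi>\<^sub>M j\<in>UNIV. borel))"
| "source_algebra M net n k (Fading i j) =
     sets (vimage_algebra (space M) (fading net i j) borel)"
| "source_algebra M net n k (Storage j) =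
     sets (vimage_algebra (space M) (stores net n j) (count_space UNIV))"
| "source_algebra M net n k (Activity j) =
     sets (vimage_algebra (space M) (active net j) (count_space UNIV))"
| "source_algebra M net n k Load =
     sets (vimage_algebra (space M) (load net k) (count_space UNIV))"

text \<open>Measurability of the marks is part of \<open>indep_sets\<close>, which requires every
  \<open>source_algebra M net n k s\<close> to consist of events.\<close>

definition network_model :: "'w measure \<Rightarrow> parameters \<Rightarrow> 'w network \<Rightarrow> bool" where
  "network_model M par net \<longleftrightarrow>
     prob_space M \<and>
     (\<forall>k. poisson_point_process M (intensity par k) (location net k)) \<and>
     (\<forall>k j. distributed M lborel (fading net k j) (exponential_density 1)) \<and>
     (\<forall>n\<in>second_group par. \<forall>j. measure M {\<omega>\<in>space M. stores net n j \<omega>} = p_Lp par) \<and>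
     (\<forall>j. measure M {\<omega>\<in>space M. active net j \<omega>} = p_active par) \<and>
     (\<forall>k l. measure M {\<omega>\<in>space M. load net k \<omega> = l + 1} = load_law par k l) \<and>
     (\<forall>n\<in>second_group par. \<forall>k. prob_space.indep_sets M (source_algebra M net n k) UNIV)"


subsection \<open>Delivery probabilities\<close>

definition distance :: "'w network \<Rightarrow> tier \<Rightarrow> nat \<Rightarrow> 'w \<Rightarrow> real" where
  "distance net k j \<omega> = norm (location net k j \<omega>)"

definition mean_power :: "parameters \<Rightarrow> 'w network \<Rightarrow> tier \<Rightarrow> nat \<Rightarrow> 'w \<Rightarrow> real" where
  "mean_power par net k j \<omega> = power par k * distance net k j \<omega> powr (- pathloss par)"

definition received_power :: "parameters \<Rightarrow> 'w network \<Rightarrow> tier \<Rightarrow> nat \<Rightarrow> 'w \<Rightarrow> real" where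
  "received_power par net k j \<omega> =
     power par k * fading net k j \<omega> * distance net k j \<omega> powr (- pathloss par)"

text \<open>In the following, base station \<open>j\<close> of tier \<open>k\<close> is the serving one.\<close>

definition interference :: "parameters \<Rightarrow> 'w network \<Rightarrow> tier \<Rightarrow> nat \<Rightarrow> 'w \<Rightarrow> real" where
  "interference par net k j \<omega> =
     (\<Sum>i. if (MBS, i) \<noteq> (k, j) then received_power par net MBS i \<omega> else 0) +
     (\<Sum>i. if (Helper, i) \<noteq> (k, j) \<and> active net i \<omega>
           then received_power par net Helper i \<omega> else 0)"

definition SINR :: "parameters \<Rightarrow> 'w network \<Rightarrow> real \<Rightarrow> tier \<Rightarrow> nat \<Rightarrow> 'w \<Rightarrow> real" where
  "SINR par net noise k j \<omega> =
     received_power par net k j \<omega> / (interference par net k j \<omega> + noise)"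

definition rate :: "parameters \<Rightarrow> 'w network \<Rightarrow> real \<Rightarrow> tier \<Rightarrow> nat \<Rightarrow> 'w \<Rightarrow> real" where
  "rate par net noise k j \<omega> =
     bandwidth par / real (load net k \<omega>) * log 2 (1 + SINR par net noise k j \<omega>)"

definition nearest_MBS :: "'w network \<Rightarrow> nat \<Rightarrow> 'w \<Rightarrow> bool" where
  "nearest_MBS net j \<omega> \<longleftrightarrow> (\<forall>i. distance net MBS j \<omega> \<le> distance net MBS i \<omega>)"

fun candidate :: "'w network \<Rightarrow> nat \<Rightarrow> tier \<Rightarrow> nat \<Rightarrow> 'w \<Rightarrow> bool" where
  "candidate net n MBS j \<omega> \<longleftrightarrow> True"
| "candidate net n Helper j \<omega> \<longleftrightarrow> stores net n j \<omega>"

definition strongest_candidate ::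
    "parameters \<Rightarrow> 'w network \<Rightarrow> nat \<Rightarrow> tier \<Rightarrow> nat \<Rightarrow> 'w \<Rightarrow> bool" where
  "strongest_candidate par net n k j \<omega> \<longleftrightarrow>
     candidate net n k j \<omega> \<and>
     (\<forall>k' i. candidate net n k' i \<omega> \<longrightarrow> mean_power par net k' i \<omega> \<le> mean_power par net k j \<omega>)"

text \<open>The serving base station exists and is unique almost surely, so quantifying it
  existentially does not affect the following probabilities.\<close>

definition C_Mp :: "'w measure \<Rightarrow> parameters \<Rightarrow> 'w network \<Rightarrow> real \<Rightarrow> real" where
  "C_Mp M par net noise =
     measure M {\<omega>\<in>space M. \<exists>j. nearest_MBS net j \<omega> \<and>
       target_rate par \<le> rate par net noise MBS j \<omega>}"

text \<open>\<open>C_Lp M par net noise n k\<close>: content \<open>n\<close> is requested, the serving base station is in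
  tier \<open>k\<close> and the access link supports the target rate.\<close>

definition C_Lp :: "'w measure \<Rightarrow> parameters \<Rightarrow> 'w network \<Rightarrow> real \<Rightarrow> nat \<Rightarrow> tier \<Rightarrow> real" where
  "C_Lp M par net noise n k =
     measure M {\<omega>\<in>space M. \<exists>j. strongest_candidate par net n k j \<omega> \<and>
       target_rate par \<le> rate par net noise k j \<omega>}"

definition p_backhaul :: "parameters \<Rightarrow> real" where
  "p_backhaul par = Q_Lp par * A_Lp par MBS / A_assoc par MBS"

text \<open>Conditional on the load \<open>l + 1\<close>.\<close>

definition C_backhaul_given :: "parameters \<Rightarrow> nat \<Rightarrow> real" where
  "C_backhaul_given par l =
     (\<Sum>m=0..l. real (l choose m) * (1 - p_backhaul par) ^ (l - m) * p_backhaul par ^ m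
        * min 1 (backhaul_capacity par / target_rate par / real (m + 1)))"

definition C_backhaul :: "parameters \<Rightarrow> real" where
  "C_backhaul par = (\<Sum>l. C_backhaul_given par l * load_law par MBS l)"

definition C_delivery ::
    "'w measure \<Rightarrow> parameters \<Rightarrow> 'w network \<Rightarrow> real \<Rightarrow> nat \<Rightarrow> real" where
  "C_delivery M par net noise n =
     Q_Mp par * C_Mp M par net noise + Q_Lp par * C_Lp M par net noise n Helper
     + Q_Lp par * C_Lp M par net noise n MBS * C_backhaul par"


subsection \<open>Closed forms\<close>

text \<open>Principal branch of the Gauss hypergeometric function: the analytic continuation of
  the hypergeometric series to the complex plane cut along \<open>[1, \<infinity>)\<close>. The
  continuation is needed because the argument \<open>- x\<close> below is not confined to the unit disc.\<close>

definition hypergeometric_2F1 :: "complex \<Rightarrow> complex \<Rightarrow> complex \<Rightarrow> complex \<Rightarrow> complex" where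
  "hypergeometric_2F1 a b c z =
     (THE w. \<exists>f. f holomorphic_on (- complex_of_real ` {1..}) \<and>
        (\<forall>u. norm u < 1 \<longrightarrow>
           (\<lambda>n. pochhammer a n * pochhammer b n / pochhammer c n * u ^ n / fact n) sums f u) \<and>
        w = f z)"

definition G_fun :: "real \<Rightarrow> real \<Rightarrow> real" where
  "G_fun x \<alpha> = 2 * x / (\<alpha> - 2) *
     Re (hypergeometric_2F1 1 (of_real (1 - 2 / \<alpha>)) (of_real (2 - 2 / \<alpha>)) (of_real (- x)))"

definition H_fun :: "real \<Rightarrow> real \<Rightarrow> real" where
  "H_fun x \<alpha> = 2 / \<alpha> * x powr (2 / \<alpha>) * Beta (2 / \<alpha>) (1 - 2 / \<alpha>)"

definition threshold :: "parameters \<Rightarrow> nat \<Rightarrow> real" where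
  "threshold par l = 2 powr (real (l + 1) * target_rate par / bandwidth par) - 1"

text \<open>Transmit powers enter the weights \<open>\<xi>\<close>, \<open>\<varsigma>\<close>, \<open>\<zeta>\<close> raised to \<open>2 / \<alpha>\<close>,
  as in the association constants: a process of intensity \<open>\<lambda>\<close> and power \<open>P\<close>
  is equivalent, for received powers, to one of intensity \<open>\<lambda> P\<^sup>2\<^sup>/\<^sup>\<alpha>\<close> and unit power.\<close>

definition weight :: "parameters \<Rightarrow> tier \<Rightarrow> real" where
  "weight par k = intensity par k * power par k powr (2 / pathloss par)"

fun serving_weight :: "parameters \<Rightarrow> tier \<Rightarrow> real" where
  "serving_weight par MBS = weight par MBS"
| "serving_weight par Helper = p_Lp par * weight par Helper"

definition xi :: "parameters \<Rightarrow> tier \<Rightarrow> real" where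
  "xi par k =
     (weight par MBS + p_active par * p_Lp par * weight par Helper) / serving_weight par k"

definition varsig :: "parameters \<Rightarrow> tier \<Rightarrow> real" where
  "varsig par k = p_active par * (1 - p_Lp par) * weight par Helper / serving_weight par k"

definition zet :: "parameters \<Rightarrow> tier \<Rightarrow> real" where
  "zet par k = (weight par MBS + p_Lp par * weight par Helper) / serving_weight par k"

definition C_Mp_lim :: "parameters \<Rightarrow> real" where
  "C_Mp_lim par =
     (\<Sum>l. inverse (G_fun (threshold par l) (pathloss par)
            + p_active par * (intensity par Helper / intensity par MBS)
                * (power par Helper / power par MBS) powr (2 / pathloss par)
                * H_fun (threshold par l) (pathloss par) + 1)
          * load_law par MBS l)"

definition C_Lp_lim :: "parameters \<Rightarrow> tier \<Rightarrow> real" where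
  "C_Lp_lim par k =
     (\<Sum>l. inverse (xi par k * G_fun (threshold par l) (pathloss par)
            + varsig par k * H_fun (threshold par l) (pathloss par) + zet par k)
          * load_law par k l)"

end

theory Submission
  imports Defs
begin

text \<open>Given the locations and the cached contents, the exponential fadings turn a coverage event
  into an infinite product over the non-serving base stations. If the serving distance were a
  constant \<open>t\<close>, the mean of this product would be \<open>exp (- \<kappa> t)\<close> by the probability generating
  functional of the Poisson processes, where \<open>t\<close> is rescaled so that a ball has measure
  proportional to \<open>t\<close>.

  The distance \<open>T\<close> of the serving base station is random, and Palm calculus is avoided as
  follows. Subtracting the mean on the event \<open>r t \<le> T\<close> from the mean on the event \<open>t \<le> T\<close>
  leaves the mean of the product at \<open>t\<close> on the event \<open>t \<le> T < r t\<close>. Integrated against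
  \<open>dt / t\<close>, it is about \<open>ln r\<close> times the mean of the product at \<open>T\<close>, so that \<open>r \<rightarrow> 1\<close> yields the
  latter. The constant \<open>\<kappa>\<close> collects integrals of \<open>1 - 1 / (1 + \<delta> (t / s)\<^sup>a)\<close> over \<open>s \<ge> t\<close> and over
  \<open>s \<ge> 0\<close>, which are \<open>G\<close> and \<open>H\<close>. The noise only contributes a factor tending to 1, and dominated
  convergence handles the sum over the load.\<close>

section \<open>Decoupling of independent families of events\<close>

text \<open>The Poisson hypothesis gives only the joint law of counts on disjoint bounded sets, for
  an arbitrary enumeration, and all locations of a tier form one source. Conditioning on the
  position of a point with a given index is therefore out of reach; what can be averaged are
  products over all points with a deterministic parameter \<open>t\<close>. Subtracting two such
  means is the way to bring in a random distance. The measure \<open>dt / t\<close> is chosen for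
  its scale invariance: the set of \<open>t\<close> with \<open>t \<le> T < r t\<close> has mass
  \<open>ln r\<close> whatever \<open>T\<close> is. The same invariance settles a second difficulty.
  A product over all points also contains the factor of the serving base station, as if it
  interfered with itself at its own distance; this factor does not depend on \<open>T\<close>, so it
  can be kept in the product and divided out at the end. For fixed \<open>r\<close> nothing is
  evaluated exactly: all quantities are squeezed between bounds that agree to first order in
  \<open>r - 1\<close>. As \<open>t \<le> T\<close> on the shell, only continuity from the left is
  needed to replace \<open>t\<close> by \<open>T\<close>.\<close>

definition generated :: "'a measure \<Rightarrow> ('i \<Rightarrow> 'a set set) \<Rightarrow> 'i set \<Rightarrow> 'a measure" where
  "generated M F J = sigma (space M) (\<Union>i\<in>J. F i)"

text \<open>Stability under intersection lets independence pass from the sources to the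
  sigma-algebras that they generate.\<close>

locale independent_sources = prob_space M for M :: "'a measure" +
  fixes F :: "'i \<Rightarrow> 'a set set"
  assumes indep: "indep_sets F UNIV"
    and Int_stable_source: "\<And>i. Int_stable (F i)"
begin

abbreviation gen :: "'i set \<Rightarrow> 'a measure" where
  "gen \<equiv> generated M F"

lemma source_events: "F i \<subseteq> events"
  using indep by (auto simp: indep_sets_def)

lemma space_gen [simp]: "space (gen J) = space M"
  using source_events sets.space_closed by (force simp: generated_def intro!: space_measure_of)

lemma sets_gen: "sets (gen J) = sigma_sets (space M) (\<Union>i\<in>J. F i)"
  unfolding generated_def using source_events sets.space_closed
  by (intro sets_measure_of) blast

lemma sets_gen_mono: "J \<subseteq> K \<Longrightarrow> sets (gen J) \<subseteq> sets (gen K)"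
  unfolding sets_gen by (intro sigma_sets_mono') auto

lemma sets_gen_events: "sets (gen J) \<subseteq> events"
  unfolding sets_gen using source_events by (intro sets.sigma_sets_subset) auto

lemma measurable_gen_mono: "J \<subseteq> K \<Longrightarrow> f \<in> measurable (gen J) N \<Longrightarrow> f \<in> measurable (gen K) N"
  using measurable_mono[of N N "gen J" "gen K"] sets_gen_mono[of J K] by auto

lemma measurable_gen: "f \<in> measurable (gen J) N \<Longrightarrow> f \<in> measurable M N"
  using measurable_mono[of N N "gen J" M] sets_gen_events[of J] by auto

lemma id_measurable_gen: "(\<lambda>x. x) \<in> measurable M (gen J)"
  using sets_gen_events[of J] sets.sets_into_space by (fastforce simp: measurable_def Int_absorb2)

text \<open>The identity map into the coarser space \<open>gen J\<close> makes a random variable out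
  of a sub-sigma-algebra, so that independence becomes a statement about a joint law.\<close>

lemma indep_gen:
  assumes "J \<inter> K = {}"
  shows "indep_var (gen J) (\<lambda>x. x) (gen K) (\<lambda>x. x)"
proof -
  have "indep_sets (\<lambda>b. sigma_sets (space M) (\<Union>i\<in>case_bool J K b. F i)) UNIV"
    using assms indep Int_stable_source
    by (intro indep_sets_collect_sigma)
       (auto simp: disjoint_family_on_def UNIV_bool intro: indep_sets_mono_index)
  then have "indep_sets (case_bool (sets (gen J)) (sets (gen K))) UNIV"
    by (rule indep_sets_mono_sets) (auto simp: sets_gen split: bool.split)
  then have ind: "indep_set (sets (gen J)) (sets (gen K))"
    by (simp add: indep_set_def)
  have im: "{(\<lambda>x. x) -` A \<inter> space M |A. A \<in> sets (gen L)} = sets (gen L)" for L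
    using sets.sets_into_space[of _ "gen L"] by (auto simp: Int_absorb2)
  show ?thesis
    unfolding indep_var_eq im
    using ind id_measurable_gen by (simp add: im sets.sigma_sets_eq[of "gen _", simplified])
qed

text \<open>By independence the diagonal map \<open>x \<mapsto> (x, x)\<close> sends
  \<open>M\<close> to the product of its restrictions to \<open>gen J\<close> and
  \<open>gen K\<close>; Fubini does the rest. This replaces conditional expectations throughout: the
  sample \<open>x\<close> is frozen while an independent copy \<open>y\<close> is averaged
  out.\<close>

lemma decouple:
  assumes JK: "J \<inter> K = {}"
    and f: "(\<lambda>(x, y). f x y) \<in> borel_measurable (gen J \<Otimes>\<^sub>M gen K)"
  shows "(\<integral>\<^sup>+x. f x x \<partial>M) = (\<integral>\<^sup>+x. \<integral>\<^sup>+y. f x y \<partial>M \<partial>M)"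
proof -
  note [measurable] = id_measurable_gen f
  interpret K: prob_space "distr M (gen K) (\<lambda>x. x)"
    by (rule prob_space_distr) measurable
  have eq: "distr M (gen J) (\<lambda>x. x) \<Otimes>\<^sub>M distr M (gen K) (\<lambda>x. x) =
      distr M (gen J \<Otimes>\<^sub>M gen K) (\<lambda>x. (x, x))"
    using indep_gen[OF JK] by (simp add: indep_var_distribution_eq)
  have "(\<integral>\<^sup>+x. f x x \<partial>M) = (\<integral>\<^sup>+z. (case z of (x, y) \<Rightarrow> f x y) \<partial>distr M (gen J \<Otimes>\<^sub>M gen K) (\<lambda>x. (x, x)))"
    by (subst nn_integral_distr) auto
  also have "\<dots> = (\<integral>\<^sup>+x. \<integral>\<^sup>+y. f x y \<partial>distr M (gen K) (\<lambda>x. x) \<partial>distr M (gen J) (\<lambda>x. x))"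
    unfolding eq[symmetric] by (subst K.nn_integral_fst[symmetric]) auto
  also have "\<dots> = (\<integral>\<^sup>+x. \<integral>\<^sup>+y. f x y \<partial>distr M (gen K) (\<lambda>x. x) \<partial>M)"
    by (subst nn_integral_distr) auto
  also have "\<dots> = (\<integral>\<^sup>+x. \<integral>\<^sup>+y. f x y \<partial>M \<partial>M)"
    by (intro nn_integral_cong, subst nn_integral_distr) auto
  finally show ?thesis .
qed

lemma measurable_pair_gen_mono:
  assumes "J \<subseteq> J'" "K \<subseteq> K'" "f \<in> measurable (gen J \<Otimes>\<^sub>M gen K) N"
  shows "f \<in> measurable (gen J' \<Otimes>\<^sub>M gen K') N"
proof -
  have "id \<in> measurable (gen J') (gen J)" "id \<in> measurable (gen K') (gen K)"
    by (rule measurable_gen_mono[OF assms(1)], rule measurable_ident)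
      (rule measurable_gen_mono[OF assms(2)], rule measurable_ident)
  then have "(\<lambda>z. (id (fst z), id (snd z))) \<in> measurable (gen J' \<Otimes>\<^sub>M gen K') (gen J \<Otimes>\<^sub>M gen K)"
    by measurable
  from measurable_compose[OF this assms(3)] show ?thesis by simp
qed

lemma decouple_measurable:
  assumes f: "(\<lambda>(x, y). f x y) \<in> borel_measurable (gen J \<Otimes>\<^sub>M gen K)"
  shows "(\<lambda>x. \<integral>\<^sup>+y. f x y \<partial>M) \<in> borel_measurable (gen J)"
proof -
  have "(\<lambda>z. (fst z, snd z)) \<in> measurable (gen J \<Otimes>\<^sub>M M) (gen J \<Otimes>\<^sub>M gen K)"
    using measurable_compose[OF measurable_snd id_measurable_gen[of K], of "gen J"] by measurable
  from measurable_compose[OF this f]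
  show ?thesis by (intro borel_measurable_nn_integral) (simp add: split_beta)
qed

text \<open>Each induction step averages one factor, given everything else, and absorbs the
  resulting \<open>gen J\<close>-measurable mean into \<open>f\<close>; hence \<open>f\<close> is
  arbitrary in the induction.\<close>

lemma decouple_prod:
  assumes "finite I"
    and "\<And>i. i \<in> I \<Longrightarrow> J \<inter> K i = {}" "disjoint_family_on K I"
    and "f \<in> borel_measurable (gen J)"
    and "\<And>i. i \<in> I \<Longrightarrow> (\<lambda>(x, y). g i x y) \<in> borel_measurable (gen J \<Otimes>\<^sub>M gen (K i))"
  shows "(\<integral>\<^sup>+x. f x * (\<Prod>i\<in>I. g i x x) \<partial>M) = (\<integral>\<^sup>+x. f x * (\<Prod>i\<in>I. \<integral>\<^sup>+y. g i x y \<partial>M) \<partial>M)"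
  using assms
proof (induction I arbitrary: f rule: finite_induct)
  case (insert i I)
  \<comment> \<open>All sources on which the remaining factors depend; they are frozen together
    while factor \<open>i\<close> is averaged.\<close>
  define L where "L = J \<union> (\<Union>j\<in>I. K j)"
  have disj: "L \<inter> K i = {}"
  proof -
    have "K j \<inter> K i = {}" if "j \<in> I" for j
      using disjoint_family_onD[OF insert.prems(2), of j i] insert.hyps(2) that by auto
    then show ?thesis
      using insert.prems(1)[of i] by (auto simp: L_def)
  qed
  have diag: "(\<lambda>x. g j x x) \<in> borel_measurable (gen L)" if "j \<in> I" for j
  proof -
    have "(\<lambda>(x, y). g j x y) \<in> borel_measurable (gen L \<Otimes>\<^sub>M gen L)"
      using that by (intro measurable_pair_gen_mono[OF _ _ insert.prems(4)]) (auto simp: L_def)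
    from measurable_compose[OF _ this, of "\<lambda>x. (x, x)" "gen L"] show ?thesis by simp
  qed
  have gi: "(\<lambda>(x, y). g i x y) \<in> borel_measurable (gen L \<Otimes>\<^sub>M gen (K i))"
    by (intro measurable_pair_gen_mono[OF _ _ insert.prems(4)]) (auto simp: L_def)
  have f: "f \<in> borel_measurable (gen L)"
    by (rule measurable_gen_mono[OF _ insert.prems(3)]) (auto simp: L_def)
  have "(\<integral>\<^sup>+x. f x * (\<Prod>j\<in>insert i I. g j x x) \<partial>M)
      = (\<integral>\<^sup>+x. (f x * (\<Prod>j\<in>I. g j x x)) * g i x x \<partial>M)"
    using insert.hyps by (simp add: mult_ac)
  also have "\<dots> = (\<integral>\<^sup>+x. \<integral>\<^sup>+y. (f x * (\<Prod>j\<in>I. g j x x)) * g i x y \<partial>M \<partial>M)"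
    using disj
  proof (rule decouple)
    show "(\<lambda>(x, y). f x * (\<Prod>j\<in>I. g j x x) * g i x y) \<in> borel_measurable (gen L \<Otimes>\<^sub>M gen (K i))"
      using gi f diag by measurable
  qed
  also have "\<dots> = (\<integral>\<^sup>+x. (f x * (\<Prod>j\<in>I. g j x x)) * (\<integral>\<^sup>+y. g i x y \<partial>M) \<partial>M)"
  proof (intro nn_integral_cong nn_integral_cmult)
    fix x assume "x \<in> space M"
    then show "g i x \<in> borel_measurable M"
      using measurable_gen[OF measurable_Pair2[OF gi]] by simp
  qed
  also have "\<dots> = (\<integral>\<^sup>+x. (f x * (\<integral>\<^sup>+y. g i x y \<partial>M)) * (\<Prod>j\<in>I. g j x x) \<partial>M)"
    by (simp add: mult_ac)
  also have "\<dots> = (\<integral>\<^sup>+x. (f x * (\<integral>\<^sup>+y. g i x y \<partial>M)) * (\<Prod>j\<in>I. \<integral>\<^sup>+y. g j x y \<partial>M) \<partial>M)"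
  proof (rule insert.IH)
    show "(\<lambda>x. f x * (\<integral>\<^sup>+ y. g i x y \<partial>M)) \<in> borel_measurable (gen J)"
      using insert.prems(3) decouple_measurable[OF insert.prems(4)[of i]] by measurable
  qed (use insert.prems in \<open>auto simp: disjoint_family_on_def\<close>)
  also have "\<dots> = (\<integral>\<^sup>+x. f x * (\<Prod>j\<in>insert i I. \<integral>\<^sup>+y. g j x y \<partial>M) \<partial>M)"
    using insert.hyps by (simp add: mult_ac)
  finally show ?case .
qed simp

lemma prob_decouple:
  assumes "J \<inter> K = {}" "A \<in> sets (gen J)" "B \<in> sets (gen K)"
  shows "prob (A \<inter> B) = prob A * prob B"
proof -
  have [measurable]: "A \<in> sets M" "B \<in> sets M"
    using assms sets_gen_events by blast+
  have [measurable]: "A \<in> sets (gen J)" "B \<in> sets (gen K)" by fact+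
  have "(\<integral>\<^sup>+x. indicator A x * indicator B x \<partial>M) = (\<integral>\<^sup>+x. \<integral>\<^sup>+y. indicator A x * indicator B y \<partial>M \<partial>M)"
    by (rule decouple[OF assms(1)]) measurable
  also have "\<dots> = emeasure M A * emeasure M B"
    by (simp add: nn_integral_cmult nn_integral_multc)
  finally have "emeasure M (A \<inter> B) = emeasure M A * emeasure M B"
    by (simp add: indicator_inter_arith[symmetric])
  then show ?thesis
    by (simp add: emeasure_eq_measure ennreal_mult'[symmetric])
qed

end

section \<open>The probability generating functional of a Poisson process on the half-line\<close>

text \<open>For factors at most 1 this is the limit of the partial products. The infimum always
  exists, is measurable, and commutes with a second infimum over an approximating sequence.\<close>

definition inf_prod :: "(nat \<Rightarrow> ennreal) \<Rightarrow> ennreal" where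
  "inf_prod f = (INF N. \<Prod>i<N. f i)"

lemma decseq_partial_prod:
  fixes f :: "nat \<Rightarrow> ennreal"
  assumes "\<And>i. f i \<le> 1"
  shows "decseq (\<lambda>N. \<Prod>i<N. f i)"
proof (rule decseq_SucI)
  fix N show "(\<Prod>i<Suc N. f i) \<le> (\<Prod>i<N. f i)"
    using mult_mono[OF order_refl assms[of N], of "\<Prod>i<N. f i"] by (simp add: mult_ac)
qed

lemma partial_prod_tendsto_inf_prod:
  "(\<And>i. f i \<le> 1) \<Longrightarrow> (\<lambda>N. \<Prod>i<N. f i) \<longlonglongrightarrow> inf_prod f"
  unfolding inf_prod_def by (intro LIMSEQ_INF decseq_partial_prod)

lemma inf_prod_eqI:
  assumes "\<And>i. f i \<le> 1" "(\<lambda>N. \<Prod>i<N. f i) \<longlonglongrightarrow> c"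
  shows "inf_prod f = c"
  using LIMSEQ_unique[OF partial_prod_tendsto_inf_prod[OF assms(1)] assms(2)] .

lemma inf_prod_le_1: "inf_prod f \<le> 1"
  unfolding inf_prod_def by (rule INF_lower2[of 0]) auto

lemma inf_prod_le_partial: "inf_prod f \<le> (\<Prod>i<N. f i)"
  unfolding inf_prod_def by (rule INF_lower) auto

lemma inf_prod_mono: "(\<And>i. f i \<le> g i) \<Longrightarrow> inf_prod f \<le> inf_prod g"
  unfolding inf_prod_def by (intro INF_mono' prod_mono_ennreal) auto

lemma borel_measurable_inf_prod [measurable (raw)]:
  "(\<And>i. (\<lambda>x. f i x) \<in> borel_measurable M) \<Longrightarrow> (\<lambda>x. inf_prod (\<lambda>i. f i x)) \<in> borel_measurable M"
  unfolding inf_prod_def by measurable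

lemma inf_prod_mult:
  assumes "\<And>i. f i \<le> 1" "\<And>i. g i \<le> 1"
  shows "inf_prod (\<lambda>i. f i * g i) = inf_prod f * inf_prod g"
proof (rule inf_prod_eqI)
  show "f i * g i \<le> 1" for i using mult_mono[OF assms, of i i] by simp
  have "inf_prod f \<noteq> top" "inf_prod g \<noteq> top"
    using inf_prod_le_1[of f] inf_prod_le_1[of g] by (auto simp: top_unique)
  then show "(\<lambda>N. \<Prod>i<N. f i * g i) \<longlonglongrightarrow> inf_prod f * inf_prod g"
    unfolding prod.distrib
    by (intro tendsto_mult_ennreal partial_prod_tendsto_inf_prod assms) auto
qed

text \<open>The image of a planar process under a multiple of the squared norm: area becomes length,
  so the intensity is constant on the half-line. The sets \<open>B\<close> range over the whole
  line, whence the intersection with \<open>{0..}\<close>.\<close>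

locale half_line_poisson = prob_space M for M :: "'a measure" +
  fixes w :: real and \<tau> :: "nat \<Rightarrow> 'a \<Rightarrow> real"
  assumes w_nonneg: "0 \<le> w"
    and point_measurable [measurable]: "\<And>i. \<tau> i \<in> borel_measurable M"
    and point_nonneg: "\<And>i x. 0 \<le> \<tau> i x"
    and finite_points: "\<And>B. B \<in> sets borel \<Longrightarrow> bounded B \<Longrightarrow> AE x in M. finite {i. \<tau> i x \<in> B}"
    and prob_count: "\<And>B m. B \<in> sets borel \<Longrightarrow> bounded B \<Longrightarrow>
      prob {x \<in> space M. card {i. \<tau> i x \<in> B} = m} =
        (w * measure lborel (B \<inter> {0..})) ^ m / fact m * exp (- (w * measure lborel (B \<inter> {0..})))"
    and indep_counts: "\<And>B :: nat \<Rightarrow> real set. disjoint_family B \<Longrightarrow>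
      (\<And>m. B m \<in> sets borel) \<Longrightarrow> (\<And>m. bounded (B m)) \<Longrightarrow>
      indep_vars (\<lambda>_. count_space UNIV) (\<lambda>m x. card {i. \<tau> i x \<in> B m}) UNIV"
begin

abbreviation count :: "real set \<Rightarrow> 'a \<Rightarrow> nat" where
  "count B x \<equiv> card {i. \<tau> i x \<in> B}"

lemma count_measurable:
  assumes "B \<in> sets borel" "bounded B"
  shows "count B \<in> measurable M (count_space UNIV)"
proof -
  \<comment> \<open>Measurability of a count is contained in the independence of a disjoint family;
    \<open>B\<close> is completed to such a family by empty sets.\<close>
  have "indep_vars (\<lambda>_. count_space UNIV) (\<lambda>m. count ((case_nat B (\<lambda>_. {})) m)) UNIV"
    using assms by (intro indep_counts) (auto simp: disjoint_family_on_def split: nat.split)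
  then have "count ((case_nat B (\<lambda>_. {})) 0) \<in> measurable M (count_space UNIV)"
    unfolding indep_vars_def by blast
  then show ?thesis by simp
qed

lemma count_generating_function:
  assumes B: "B \<in> sets borel" "bounded B" and c: "0 \<le> c" "c \<le> 1"
  shows "(\<integral>\<^sup>+x. ennreal ((1 - c) ^ count B x) \<partial>M) =
    ennreal (exp (- (w * (c * measure lborel (B \<inter> {0..})))))"
proof -
  define r where "r = w * measure lborel (B \<inter> {0..})"
  have r: "0 \<le> r" using w_nonneg by (simp add: r_def)
  have [measurable]: "count B \<in> measurable M (count_space UNIV)"
    using B by (rule count_measurable)
  have "(\<integral>\<^sup>+x. ennreal ((1 - c) ^ count B x) \<partial>M) =
      (\<integral>\<^sup>+x. (\<Sum>m. ennreal ((1 - c) ^ m) * indicator {x \<in> space M. count B x = m} x) \<partial>M)"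
  proof (intro nn_integral_cong)
    fix x assume "x \<in> space M"
    then show "ennreal ((1 - c) ^ count B x) =
        (\<Sum>m. ennreal ((1 - c) ^ m) * indicator {x \<in> space M. count B x = m} x)"
      by (subst suminf_finite[of "{count B x}"]) auto
  qed
  also have "\<dots> = (\<Sum>m. ennreal ((1 - c) ^ m) * emeasure M {x \<in> space M. count B x = m})"
    by (subst nn_integral_suminf) (auto simp: nn_integral_cmult_indicator)
  also have "\<dots> = (\<Sum>m. ennreal (((1 - c) * r) ^ m / fact m * exp (- r)))"
    using c r by (intro suminf_cong)
      (simp add: emeasure_eq_measure prob_count[OF B] r_def[symmetric] ennreal_mult'[symmetric]
        power_mult_distrib)
  also have "\<dots> = ennreal (exp ((1 - c) * r) * exp (- r))"
  proof (rule suminf_ennreal_eq)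
    show "(\<lambda>m. ((1 - c) * r) ^ m / fact m * exp (- r)) sums (exp ((1 - c) * r) * exp (- r))"
      using exp_converges[of "(1 - c) * r"] by (intro sums_mult2) (simp add: field_simps)
  qed (use c r in auto)
  also have "exp ((1 - c) * r) * exp (- r) = exp (- (w * (c * measure lborel (B \<inter> {0..}))))"
    by (simp add: exp_add[symmetric] r_def algebra_simps)
  finally show ?thesis .
qed

text \<open>Grouped by cells, the product over the points becomes \<open>(1 - c m) ^ count\<close>,
  and counts in disjoint cells are independent Poisson variables.\<close>

lemma step_generating_functional:
  fixes B :: "nat \<Rightarrow> real set"
  assumes B: "disjoint_family B" "\<And>m. B m \<in> sets borel" "\<And>m. bounded (B m)"
    and c: "\<And>m. m < K \<Longrightarrow> 0 \<le> c m" "\<And>m. m < K \<Longrightarrow> c m \<le> 1"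
  shows "(\<integral>\<^sup>+x. inf_prod (\<lambda>i. ennreal (1 - (\<Sum>m<K. c m * indicator (B m) (\<tau> i x)))) \<partial>M) =
    ennreal (exp (- (w * (\<Sum>m<K. c m * measure lborel (B m \<inter> {0..})))))"
proof -
  let ?S = "\<lambda>y. \<Sum>m<K. c m * indicator (B m) y" and ?R = "\<lambda>x. \<Prod>m<K. ennreal ((1 - c m) ^ count (B m) x)"
  have "AE x in M. \<forall>m. finite {i. \<tau> i x \<in> B m}"
    using finite_points[OF B(2,3)] by (intro AE_all_countable[THEN iffD2] allI)
  then have fin: "AE x in M. \<forall>m<K. finite {i. \<tau> i x \<in> B m}"
    by (rule eventually_mono) auto
  have eq: "inf_prod (\<lambda>i. ennreal (1 - ?S (\<tau> i x))) =
      ?R x"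
    if fin: "\<forall>m<K. finite {i. \<tau> i x \<in> B m}" for x
  proof -
    \<comment> \<open>At most one cell contains \<open>y\<close>, so that one minus the sum is a
      product.\<close>
    have val: "1 - ?S y = (\<Prod>m<K. if y \<in> B m then 1 - c m else 1)" for y
    proof (cases "\<exists>m<K. y \<in> B m")
      case True
      then obtain m where m: "m < K" "y \<in> B m" by blast
      have other: "y \<notin> B l" if "l \<noteq> m" for l
        using B(1) m(2) that by (auto simp: disjoint_family_on_def)
      have "(\<Sum>l<K. c l * indicator (B l) y) = (\<Sum>l<K. if l = m then c m else 0)"
        using m other by (intro sum.cong) (auto simp: indicator_def)
      moreover have "(\<Prod>l<K. if y \<in> B l then 1 - c l else 1) = (\<Prod>l<K. if l = m then 1 - c m else 1)"
        using m other by (intro prod.cong) auto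
      ultimately show ?thesis using m by simp
    qed simp
    have range: "0 \<le> 1 - ?S y" "1 - ?S y \<le> 1" for y
    proof -
      show "0 \<le> 1 - ?S y"
        unfolding val using c by (intro prod_nonneg) auto
      show "1 - ?S y \<le> 1"
        using c by (auto intro!: sum_nonneg)
    qed
    \<comment> \<open>Only the finitely many points in the cells have a factor other than 1, so the
      partial products are eventually constant.\<close>
    define S where "S = (\<Union>m<K. {i. \<tau> i x \<in> B m})"
    have "finite S" using fin by (auto simp: S_def)
    then obtain N0 where N0: "S \<subseteq> {..<N0}" by (meson finite_nat_iff_bounded)
    have "(\<Prod>i<N. ennreal (1 - ?S (\<tau> i x))) =
        ?R x" if "N \<ge> N0" for N
    proof -
      have "(\<Prod>i<N. 1 - ?S (\<tau> i x)) =
          (\<Prod>m<K. \<Prod>i<N. if \<tau> i x \<in> B m then 1 - c m else 1)"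
        unfolding val by (rule prod.swap)
      also have "\<dots> = (\<Prod>m<K. (1 - c m) ^ count (B m) x)"
      proof (intro prod.cong refl)
        fix m assume "m \<in> {..<K}"
        then have "{i. \<tau> i x \<in> B m} = {i \<in> {..<N}. \<tau> i x \<in> B m}"
          using N0 that by (fastforce simp: S_def)
        then show "(\<Prod>i<N. if \<tau> i x \<in> B m then 1 - c m else 1) = (1 - c m) ^ count (B m) x"
          by (simp add: prod.If_cases Int_def)
      qed
      finally show ?thesis
        using c range(1) by (subst (1 2) prod_ennreal) auto
    qed
    then have "eventually (\<lambda>N. (\<Prod>i<N. ennreal (1 - ?S (\<tau> i x))) =
        ?R x) sequentially"
      by (auto simp: eventually_sequentially)
    then show ?thesis
      using range by (intro inf_prod_eqI tendsto_eventually) auto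
  qed
  have indep: "indep_vars (\<lambda>_. borel) (\<lambda>m x. ennreal ((1 - c m) ^ count (B m) x)) {..<K}"
    by (rule indep_vars_compose2[OF indep_vars_subset[OF indep_counts[OF B]], of _ "\<lambda>m l. ennreal ((1 - c m) ^ l)"]) auto
  have "(\<integral>\<^sup>+x. inf_prod (\<lambda>i. ennreal (1 - ?S (\<tau> i x))) \<partial>M) =
      (\<integral>\<^sup>+x. ?R x \<partial>M)"
    by (intro nn_integral_cong_AE eventually_mono[OF fin]) (rule eq)
  also have "\<dots> = (\<Prod>m<K. \<integral>\<^sup>+x. ennreal ((1 - c m) ^ count (B m) x) \<partial>M)"
    by (rule indep_vars_nn_integral[OF _ indep]) auto
  also have "\<dots> = (\<Prod>m<K. ennreal (exp (- (w * (c m * measure lborel (B m \<inter> {0..}))))))"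
    using c B by (intro prod.cong count_generating_function) auto
  also have "\<dots> = ennreal (exp (- (w * (\<Sum>m<K. c m * measure lborel (B m \<inter> {0..})))))"
    by (simp add: prod_ennreal exp_sum[symmetric] sum_negf sum_distrib_left)
  finally show ?thesis .
qed

text \<open>Dyadic step functions \<open>v n\<close> increase to \<open>u\<close> on the half-line.
  The exponents converge by monotone convergence, and the products decrease, from integrable ones,
  to the product for \<open>u\<close>.\<close>

lemma generating_functional:
  fixes u :: "real \<Rightarrow> real"
  assumes [measurable]: "u \<in> borel_measurable borel"
    and u: "\<And>x. 0 \<le> u x" "\<And>x. u x \<le> 1"
    and I: "(\<integral>\<^sup>+x. ennreal (u x) * indicator {0..} x \<partial>lborel) = ennreal I" "0 \<le> I"
  shows "(\<integral>\<^sup>+x. inf_prod (\<lambda>i. ennreal (1 - u (\<tau> i x))) \<partial>M) = ennreal (exp (- (w * I)))"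
proof -
  \<comment> \<open>Level sets of \<open>u\<close> at resolution \<open>2 ^ n\<close>, cut at
    \<open>n\<close> because the counts are controlled on bounded sets only. The levels run up to
    \<open>2 ^ n\<close> inclusive, since \<open>u\<close> may take the value 1.\<close>
  define B where "B n m = {x \<in> {0..real n}. \<lfloor>2 ^ n * u x\<rfloor> = int m}" for n m :: nat
  define v where "v n x = (\<Sum>m<2 ^ n + 1. real m / 2 ^ n * indicator (B n m) x)" for n x
  let ?W = "\<lambda>n x. inf_prod (\<lambda>i. ennreal (1 - v n (\<tau> i x)))"
  have v_eq: "v n x = (if x \<in> {0..real n} then of_int \<lfloor>2 ^ n * u x\<rfloor> / 2 ^ n else 0)" for n x
  proof (cases "x \<in> {0..real n}")
    case True
    define k where "k = nat \<lfloor>2 ^ n * u x\<rfloor>"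
    have k: "\<lfloor>2 ^ n * u x\<rfloor> = int k" using u(1)[of x] by (simp add: k_def)
    have "2 ^ n * u x \<le> 2 ^ n" using u(2)[of x] by (simp add: mult_left_le)
    then have "\<lfloor>2 ^ n * u x\<rfloor> \<le> \<lfloor>2 ^ n :: real\<rfloor>" by (rule floor_mono)
    then have "int k \<le> 2 ^ n" by (simp add: k)
    then have "k < 2 ^ n + 1" by (metis Suc_eq_plus1 less_Suc_eq_le of_nat_le_iff of_nat_numeral of_nat_power)
    moreover have "v n x = (\<Sum>m<2 ^ n + 1. if m = k then real k / 2 ^ n else 0)"
      unfolding v_def using True by (intro sum.cong) (auto simp: B_def k indicator_def)
    ultimately show ?thesis using True by (simp add: k)
  qed (auto simp: v_def B_def)
  have v_range: "0 \<le> v n x" "v n x \<le> u x" for n x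
    using u(1)[of x] by (auto simp: v_eq field_simps)
  have v_mono: "v n x \<le> v (Suc n) x" for n x
  proof -
    have "2 * of_int \<lfloor>2 ^ n * u x\<rfloor> \<le> 2 * (2 ^ n * u x)" by simp
    then have "2 * \<lfloor>2 ^ n * u x\<rfloor> \<le> \<lfloor>2 ^ Suc n * u x\<rfloor>"
      by (simp add: le_floor_iff mult_ac)
    then have "2 * real_of_int \<lfloor>2 ^ n * u x\<rfloor> \<le> of_int \<lfloor>2 ^ Suc n * u x\<rfloor>"
      by linarith
    then show ?thesis
      using v_range(1)[of "Suc n" x] by (auto simp: v_eq field_simps)
  qed
  have v_lim: "(\<lambda>n. v n x) \<longlonglongrightarrow> u x" if "0 \<le> x" for x
  proof (rule tendsto_sandwich[where h = "\<lambda>_. u x"])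
    obtain n0 :: nat where n0: "x \<le> real n0" using real_arch_simple by blast
    have "u x - 1 / 2 ^ n \<le> v n x" if "n \<ge> n0" for n
    proof -
      have "2 ^ n * u x - 1 \<le> of_int \<lfloor>2 ^ n * u x\<rfloor>" by linarith
      then have "(2 ^ n * u x - 1) / 2 ^ n \<le> of_int \<lfloor>2 ^ n * u x\<rfloor> / 2 ^ n"
        by (intro divide_right_mono) auto
      moreover have "(2 ^ n * u x - 1) / 2 ^ n = u x - 1 / 2 ^ n"
        by (simp add: diff_divide_distrib)
      ultimately show ?thesis using \<open>0 \<le> x\<close> n0 that by (simp add: v_eq)
    qed
    then show "eventually (\<lambda>n. u x - 1 / 2 ^ n \<le> v n x) sequentially"
      by (auto simp: eventually_sequentially)
    have "(\<lambda>n. u x - (1 / 2) ^ n) \<longlonglongrightarrow> u x - 0"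
      by (intro tendsto_intros LIMSEQ_power_zero) auto
    then show "(\<lambda>n. u x - 1 / 2 ^ n) \<longlonglongrightarrow> u x" by (simp add: power_divide)
  qed (use v_range in \<open>auto intro!: tendsto_const always_eventually\<close>)
  have [measurable]: "B n m \<in> sets borel" for n m unfolding B_def by measurable
  have [measurable]: "v n \<in> borel_measurable borel" for n unfolding v_def by measurable
  define J where "J n = (\<Sum>m<2 ^ n + 1. real m / 2 ^ n * measure lborel (B n m \<inter> {0..}))" for n
  have step: "(\<integral>\<^sup>+x. ?W n x \<partial>M) = ennreal (exp (- (w * J n)))" for n
    unfolding v_def J_def
  proof (rule step_generating_functional)
    show "disjoint_family (B n)" by (auto simp: disjoint_family_on_def B_def)
    show "bounded (B n m)" for m
      by (rule bounded_subset[of "{0..real n}"]) (auto simp: B_def)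
  qed (auto simp: field_simps of_nat_less_iff less_Suc_eq_le)
  have J: "(\<integral>\<^sup>+x. ennreal (v n x) * indicator {0..} x \<partial>lborel) = ennreal (J n)" for n
  proof -
    have fin: "emeasure lborel (B n m \<inter> {0..}) = ennreal (measure lborel (B n m \<inter> {0..}))" for m
    proof (rule emeasure_eq_ennreal_measure)
      have "emeasure lborel (B n m \<inter> {0..}) \<le> emeasure lborel {0..real n}"
        by (rule emeasure_mono) (auto simp: B_def)
      then show "emeasure lborel (B n m \<inter> {0..}) \<noteq> top" by (auto simp: top_unique)
    qed
    have "(\<integral>\<^sup>+x. ennreal (v n x) * indicator {0..} x \<partial>lborel) =
        (\<integral>\<^sup>+x. (\<Sum>m<2 ^ n + 1. ennreal (real m / 2 ^ n) * indicator (B n m \<inter> {0..}) x) \<partial>lborel)"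
    proof (intro nn_integral_cong)
      fix x :: real
      have "ennreal (v n x) = (\<Sum>m<2 ^ n + 1. ennreal (real m / 2 ^ n * indicator (B n m) x))"
        unfolding v_def by (rule sum_ennreal[symmetric]) auto
      moreover have "ennreal (real m / 2 ^ n * indicator (B n m) x) * indicator {0..} x =
          ennreal (real m / 2 ^ n) * indicator (B n m \<inter> {0..}) x" for m
        by (auto split: split_indicator)
      ultimately show "ennreal (v n x) * indicator {0..} x =
          (\<Sum>m<2 ^ n + 1. ennreal (real m / 2 ^ n) * indicator (B n m \<inter> {0..}) x)"
        by (simp only: sum_distrib_right)
    qed
    also have "\<dots> = (\<Sum>m<2 ^ n + 1. ennreal (real m / 2 ^ n) * emeasure lborel (B n m \<inter> {0..}))"
      by (subst nn_integral_sum) (auto simp: nn_integral_cmult_indicator)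
    also have "\<dots> = (\<Sum>m<2 ^ n + 1. ennreal (real m / 2 ^ n * measure lborel (B n m \<inter> {0..})))"
      by (intro sum.cong refl, subst ennreal_mult) (auto simp: fin)
    also have "\<dots> = ennreal (J n)"
      unfolding J_def by (rule sum_ennreal) auto
    finally show ?thesis .
  qed
  have "(\<lambda>n. \<integral>\<^sup>+x. ennreal (v n x) * indicator {0..} x \<partial>lborel)
      \<longlonglongrightarrow> (\<integral>\<^sup>+x. ennreal (u x) * indicator {0..} x \<partial>lborel)"
  proof (rule nn_integral_LIMSEQ)
    show "incseq (\<lambda>n x. ennreal (v n x) * indicator {0..} x)"
      using v_mono by (intro incseq_SucI) (auto simp: le_fun_def intro!: mult_right_mono ennreal_leI)
    show "(\<lambda>n. ennreal (v n x) * indicator {0..} x) \<longlonglongrightarrow> ennreal (u x) * indicator {0..} x" for x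
      using v_lim[of x] by (cases "0 \<le> x") (auto intro!: tendsto_ennrealI)
  qed auto
  then have "J \<longlonglongrightarrow> I"
    unfolding J I(1) by (rule tendsto_ennrealD) (auto simp: I J_def intro!: sum_nonneg add_nonneg_nonneg always_eventually)
  then have lim1: "(\<lambda>n. ennreal (exp (- (w * J n)))) \<longlonglongrightarrow> ennreal (exp (- (w * I)))"
    by (intro tendsto_intros tendsto_ennrealI)
  have dec: "decseq (\<lambda>n. ?W n x)" for x
    using v_mono by (intro decseq_SucI inf_prod_mono ennreal_leI) auto
  \<comment> \<open>Both the passage to \<open>u\<close> and the infinite product are infima, so
    they may be exchanged; for finite products the limit is plain continuity.\<close>
  have inf: "(INF n. ?W n x) = inf_prod (\<lambda>i. ennreal (1 - u (\<tau> i x)))" for x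
  proof -
    have "(INF n. \<Prod>i<N. ennreal (1 - v n (\<tau> i x))) = (\<Prod>i<N. ennreal (1 - u (\<tau> i x)))" for N
    proof (rule LIMSEQ_unique[OF LIMSEQ_INF])
      show "decseq (\<lambda>n. \<Prod>i<N. ennreal (1 - v n (\<tau> i x)))"
        using v_mono by (intro decseq_SucI prod_mono_ennreal) (auto intro!: ennreal_leI)
      have r: "0 \<le> 1 - v n y" "0 \<le> 1 - u y" for n y
        using v_range(2)[of n y] u(2)[of y] by auto
      have "(\<lambda>n. ennreal (\<Prod>i<N. 1 - v n (\<tau> i x))) \<longlonglongrightarrow> ennreal (\<Prod>i<N. 1 - u (\<tau> i x))"
        by (intro tendsto_ennrealI tendsto_prod tendsto_diff tendsto_const v_lim point_nonneg)
      then show "(\<lambda>n. \<Prod>i<N. ennreal (1 - v n (\<tau> i x))) \<longlonglongrightarrow> (\<Prod>i<N. ennreal (1 - u (\<tau> i x)))"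
        using r by (simp add: prod_ennreal)
    qed
    then show ?thesis
      unfolding inf_prod_def by (subst INF_commute) simp
  qed
  have "(\<integral>\<^sup>+x. inf_prod (\<lambda>i. ennreal (1 - u (\<tau> i x))) \<partial>M) =
      (INF n. \<integral>\<^sup>+x. ?W n x \<partial>M)"
    unfolding inf[symmetric]
  proof (rule nn_integral_monotone_convergence_INF_decseq[where i = 0])
    show "decseq (\<lambda>n x. ?W n x)"
      using dec by (simp add: monotone_on_def le_fun_def)
    show "(\<integral>\<^sup>+x. ?W 0 x \<partial>M) < \<infinity>"
      unfolding step by simp
  qed measurable
  moreover have "decseq (\<lambda>n. \<integral>\<^sup>+x. ?W n x \<partial>M)"
    using dec by (auto simp: decseq_def intro!: nn_integral_mono)
  ultimately show ?thesis
    using LIMSEQ_unique[OF LIMSEQ_INF lim1] by (simp add: step)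
qed

section \<open>Almost sure geometry of the points: positive, distinct, locally finite\<close>

lemma points_positive: "AE x in M. \<forall>i. 0 < \<tau> i x"
proof -
  have [measurable]: "count {0} \<in> measurable M (count_space UNIV)"
    by (rule count_measurable) auto
  have "measure lborel ({0} \<inter> {0::real..}) = 0"
    by (rule measure_eq_0_null_sets, rule null_sets_subset[of "{0}"]) auto
  then have "prob {x \<in> space M. count {0} x = 0} = 1"
    by (subst prob_count) auto
  then have "AE x in M. count {0} x = 0"
    by (subst (asm) prob_Collect_eq_1) auto
  \<comment> \<open>A count of 0 alone does not exclude points at 0, because \<open>card\<close> is
    0 on infinite sets.\<close>
  moreover have "AE x in M. finite {i. \<tau> i x \<in> {0}}"
    by (rule finite_points) auto
  ultimately show ?thesis
  proof eventually_elim
    case (elim x)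
    then have "\<tau> i x \<noteq> 0" for i by auto
    then show ?case using point_nonneg[of _ x] by (simp add: less_le)
  qed
qed

lemma prob_count_ge_2:
  assumes B: "B \<in> sets borel" "bounded B"
  shows "prob {x \<in> space M. 2 \<le> count B x} \<le> (w * measure lborel (B \<inter> {0..}))\<^sup>2"
proof -
  define r where "r = w * measure lborel (B \<inter> {0..})"
  have r: "0 \<le> r" using w_nonneg by (simp add: r_def)
  have [measurable]: "count B \<in> measurable M (count_space UNIV)"
    using B by (rule count_measurable)
  have "{x \<in> space M. 2 \<le> count B x} =
      space M - ({x \<in> space M. count B x = 0} \<union> {x \<in> space M. count B x = 1})"
    by auto
  then have "prob {x \<in> space M. 2 \<le> count B x} =
      1 - prob ({x \<in> space M. count B x = 0} \<union> {x \<in> space M. count B x = 1})"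
    by (simp only:) (rule prob_compl, measurable)
  also have "prob ({x \<in> space M. count B x = 0} \<union> {x \<in> space M. count B x = 1}) =
      prob {x \<in> space M. count B x = 0} + prob {x \<in> space M. count B x = 1}"
    by (rule finite_measure_Union) auto
  also have "\<dots> = (1 + r) * exp (- r)"
    by (simp only: prob_count[OF B] r_def[symmetric]) (simp add: algebra_simps)
  also have "1 - (1 + r) * exp (- r) \<le> r\<^sup>2"
  proof -
    have "(1 + r) * (1 - r) \<le> (1 + r) * exp (- r)"
      using exp_ge_add_one_self[of "- r"] r by (intro mult_left_mono) auto
    then show ?thesis by (simp add: algebra_simps power2_eq_square)
  qed
  finally show ?thesis by (simp add: r_def)
qed

text \<open>Two coinciding points share a cell in every grid of mesh \<open>1 / (n + 1)\<close>. A
  cell holds two points with probability at most \<open>(w / (n + 1))\<^sup>2\<close>, and about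
  \<open>n R\<close> cells cover the range, so the union bound is of order \<open>1 / n\<close>.
  This excludes that an enumeration lists a point twice, which would give two serving base
  stations.\<close>

lemma distinct_points_below:
  fixes R :: nat
  shows "AE x in M. \<forall>i j. i \<noteq> j \<longrightarrow> \<tau> i x = \<tau> j x \<longrightarrow> \<not> \<tau> i x < real R"
proof -
  define B where "B n m = {real m / real (Suc n)..<real (Suc m) / real (Suc n)}" for n m
  define E where "E n = (\<Union>m<Suc n * R. {x \<in> space M. 2 \<le> count (B n m) x})" for n
  have B: "B n m \<in> sets borel" "bounded (B n m)" for n m
    by (auto simp: B_def)
  have [measurable]: "count (B n m) \<in> measurable M (count_space UNIV)" for n m
    using B by (rule count_measurable)
  have [measurable]: "E n \<in> events" for n unfolding E_def by measurable
  have "prob (E n) \<le> w\<^sup>2 * R / Suc n" for n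
  proof -
    have "prob (E n) \<le> (\<Sum>m<Suc n * R. prob {x \<in> space M. 2 \<le> count (B n m) x})"
      unfolding E_def by (rule finite_measure_subadditive_finite) auto
    also have "\<dots> \<le> (\<Sum>m<Suc n * R. (w / Suc n)\<^sup>2)"
    proof (intro sum_mono order_trans[OF prob_count_ge_2[OF B]])
      fix m
      have "B n m \<inter> {0..} = B n m" by (auto simp: B_def intro: order_trans[rotated])
      moreover have "measure lborel (B n m) = 1 / Suc n"
        by (simp add: B_def divide_right_mono diff_divide_distrib[symmetric])
      ultimately show "(w * measure lborel (B n m \<inter> {0..}))\<^sup>2 \<le> (w / Suc n)\<^sup>2" by simp
    qed
    also have "\<dots> = (real (Suc n) * R) * (w / Suc n)\<^sup>2"
      by (simp only: sum_constant card_lessThan of_nat_mult)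
    also have "\<dots> = w\<^sup>2 * R / Suc n"
      by (simp add: power2_eq_square del: of_nat_Suc)
    finally show ?thesis .
  qed
  then have "prob (\<Inter>n. E n) \<le> w\<^sup>2 * R / Suc n" for n
    by (rule order_trans[rotated]) (rule finite_measure_mono, auto)
  moreover have "(\<lambda>n. w\<^sup>2 * R / Suc n) \<longlonglongrightarrow> 0"
    using LIMSEQ_inverse_real_of_nat[THEN tendsto_mult_left, of "w\<^sup>2 * R"] by (simp add: field_simps)
  ultimately have "prob (\<Inter>n. E n) \<le> 0"
    by (intro LIMSEQ_le_const) auto
  then have "prob (\<Inter>n. E n) = 0"
    by (simp add: measure_le_0_iff)
  then have null: "AE x in M. x \<notin> (\<Inter>n. E n)"
    by (subst (asm) prob_eq_0) auto
  have "AE x in M. \<forall>n m. finite {i. \<tau> i x \<in> B n m}"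
    unfolding AE_all_countable using finite_points[OF B] by blast
  with null show ?thesis using AE_space
  proof eventually_elim
    case (elim x)
    show ?case
    proof (intro allI impI notI)
      fix i j assume ij: "i \<noteq> j" "\<tau> i x = \<tau> j x" "\<tau> i x < real R"
      have "x \<in> E n" for n
      proof -
        define m where "m = nat \<lfloor>\<tau> i x * Suc n\<rfloor>"
        have m: "real m \<le> \<tau> i x * Suc n" "\<tau> i x * Suc n < real m + 1"
          using point_nonneg[of i x] by (auto simp: m_def)
        have "\<tau> i x * real (Suc n) < real R * real (Suc n)"
          using ij(3) by (rule mult_strict_right_mono) simp
        then have "real m < real (Suc n * R)"
          using m(1) by (simp only: of_nat_mult mult.commute)
        then have "m < Suc n * R" by (simp only: of_nat_less_iff)
        have "\<tau> i x \<in> B n m" using m by (simp add: B_def field_simps)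
        then have "{i, j} \<subseteq> {i. \<tau> i x \<in> B n m}" using ij by auto
        then have "card {i, j} \<le> count (B n m) x" using elim(2) by (intro card_mono) auto
        then have "x \<in> {x \<in> space M. 2 \<le> count (B n m) x}" using ij(1) elim(3) by simp
        then show ?thesis using \<open>m < Suc n * R\<close> unfolding E_def by blast
      qed
      then show False using elim(1) by blast
    qed
  qed
qed

lemma distinct_points: "AE x in M. \<forall>i j. i \<noteq> j \<longrightarrow> \<tau> i x \<noteq> \<tau> j x"
proof -
  have "AE x in M. \<forall>R :: nat. \<forall>i j. i \<noteq> j \<longrightarrow> \<tau> i x = \<tau> j x \<longrightarrow> \<not> \<tau> i x < real R"
    using distinct_points_below by (subst AE_all_countable) blast
  then show ?thesis
    by eventually_elim (metis reals_Archimedean2)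
qed

lemma locally_finite: "AE x in M. \<forall>r. finite {i. \<tau> i x \<le> r}"
proof -
  have "AE x in M. \<forall>n :: nat. finite {i. \<tau> i x \<in> {0..real n}}"
    unfolding AE_all_countable by (intro allI finite_points) auto
  then show ?thesis
  proof eventually_elim
    case (elim x)
    show ?case
    proof
      fix r :: real
      obtain n :: nat where "r \<le> real n" using real_arch_simple by blast
      then have "{i. \<tau> i x \<le> r} \<subseteq> {i. \<tau> i x \<in> {0..real n}}"
        using point_nonneg[of _ x] by auto
      then show "finite {i. \<tau> i x \<le> r}" using elim finite_subset by blast
    qed
  qed
qed

end

section \<open>The functions G and H as integrals\<close>

lemma cut_plane_nonzero:
  assumes "z \<notin> complex_of_real ` {1..}" "0 \<le> c" "c \<le> 1"
  shows "1 - z * of_real c \<noteq> 0"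
proof
  assume eq: "1 - z * of_real c = 0"
  then have "c \<noteq> 0" by auto
  then have "z = of_real (1 / c)" using eq by (simp add: field_simps)
  moreover have "1 / c \<in> {1..}" using assms(2,3) \<open>c \<noteq> 0\<close> by (simp add: field_simps)
  ultimately show False using assms(1) by blast
qed

lemma open_cut_plane: "open (- complex_of_real ` {1..})"
  by (intro open_Compl closed_injective_linear_image[of "{1..}" complex_of_real])
     (auto simp: inj_def intro: linear_of_real bounded_linear.linear bounded_linear_of_real)

lemma connected_cut_plane: "connected (- complex_of_real ` {1..})"
proof (rule starlike_imp_connected)
  have "closed_segment 0 z \<subseteq> - complex_of_real ` {1..}" if "z \<notin> complex_of_real ` {1..}" for z
  proof
    fix y assume "y \<in> closed_segment 0 z"
    then obtain u where u: "0 \<le> u" "u \<le> 1" "y = u *\<^sub>R z"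
      by (auto simp: closed_segment_def)
    show "y \<in> - complex_of_real ` {1..}"
    proof
      assume "y \<in> complex_of_real ` {1..}"
      then obtain r where r: "1 \<le> r" "y = of_real r" by auto
      then have "1 - z * of_real (u / r) = 0"
        using u by (simp add: scaleR_conv_of_real mult.commute)
      moreover have "u / r \<le> 1" using r u by (simp add: divide_le_eq)
      ultimately show False using cut_plane_nonzero[OF that, of "u / r"] r u by auto
    qed
  qed
  moreover have "0 \<in> - complex_of_real ` {1..}" by auto
  ultimately show "starlike (- complex_of_real ` {1..})"
    unfolding starlike_def by blast
qed

text \<open>The definite description is unique by the identity theorem: the cut plane is open and
  connected and contains the unit disc, where the series determines the function.\<close>

lemma hypergeometric_2F1_eqI:
  assumes f: "f holomorphic_on (- complex_of_real ` {1..})"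
    and series: "\<And>u. norm u < 1 \<Longrightarrow>
      (\<lambda>n. pochhammer a n * pochhammer b n / pochhammer c n * u ^ n / fact n) sums f u"
    and z: "z \<notin> complex_of_real ` {1..}"
  shows "hypergeometric_2F1 a b c z = f z"
  unfolding hypergeometric_2F1_def
proof (rule the_equality)
  fix w
  assume "\<exists>g. g holomorphic_on (- complex_of_real ` {1..}) \<and>
    (\<forall>u. norm u < 1 \<longrightarrow>
      (\<lambda>n. pochhammer a n * pochhammer b n / pochhammer c n * u ^ n / fact n) sums g u) \<and> w = g z"
  then obtain g where g: "g holomorphic_on (- complex_of_real ` {1..})" "w = g z"
    "\<And>u. norm u < 1 \<Longrightarrow>
      (\<lambda>n. pochhammer a n * pochhammer b n / pochhammer c n * u ^ n / fact n) sums g u"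
    by blast
  have "g z = f z"
  proof (rule analytic_continuation_open[of "ball 0 1" "- complex_of_real ` {1..}" g f])
    show "ball 0 1 \<subseteq> - complex_of_real ` {1..}" by (auto simp: in_image_insert_iff)
    show "g u = f u" if "u \<in> ball 0 1" for u
      using that g(3) series by (intro sums_unique2) auto
  qed (use g(1) f z open_cut_plane connected_cut_plane in auto)
  then show "w = f z" using g(2) by simp
qed (use f series in blast)

lemma continuous_on_powr_const: "0 < p \<Longrightarrow> continuous_on {0..} (\<lambda>y::real. y powr p)"
  by (intro continuous_on_powr' continuous_intros) auto

lemma has_integral_powr_power:
  assumes "0 < p"
  shows "((\<lambda>y::real. (y powr p) ^ n) has_integral (1 / (p * n + 1))) {0..1}"
\<comment> \<open>At \<open>y = 0\<close> and \<open>n = 0\<close> the two integrands differ: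
  \<open>0 powr 0\<close> is 0 while a zeroth power is 1.\<close>
proof (rule has_integral_spike_finite[of "{0}"])
  have "p * n > -1" using assms by (simp add: less_le_trans[of _ 0])
  from has_integral_powr_from_0[OF this, of 1]
  show "((\<lambda>y. y powr (p * n)) has_integral (1 / (p * n + 1))) {0..1}" by simp
qed (auto simp: powr_power mult.commute)

text \<open>Euler's integral with third parameter \<open>b + 1\<close> has the kernel
  \<open>b * t powr (b - 1) / (1 - z * t)\<close> on the unit interval;
  \<open>t = y powr (1 / b)\<close> absorbs the weight. The integrand is then bounded and continuous
  for every \<open>z\<close> off the cut.\<close>

lemma hypergeometric_2F1_integral:
  fixes b :: real and z :: complex
  assumes b: "0 < b" and z: "z \<notin> complex_of_real ` {1..}"
  shows "hypergeometric_2F1 1 (of_real b) (of_real (b + 1)) z =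
    integral {0..1} (\<lambda>y. 1 / (1 - z * of_real (y powr (1 / b))))"
proof (rule hypergeometric_2F1_eqI[OF _ _ z])
  let ?p = "1 / b" and ?S = "- complex_of_real ` {1..}"
  define k where "k u y = 1 / (1 - u * complex_of_real (y powr ?p))" for u y
  have p: "0 < ?p" using b by simp
  have cont_powr: "continuous_on A (\<lambda>y. y powr ?p)" if "A \<subseteq> {0..}" for A :: "real set"
    using continuous_on_subset[OF continuous_on_powr_const[OF p] that] .
  have le1: "y powr ?p \<le> 1" if "y \<in> {0..1}" for y
    using that p by (simp add: powr_le1)
  have nz: "1 - u * of_real (y powr ?p) \<noteq> 0" if "u \<in> ?S" "y \<in> {0..1}" for u y
    using that le1 by (intro cut_plane_nonzero) auto
  have int: "k u integrable_on {0..1}" if "u \<in> ?S" for u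
    unfolding k_def using nz[OF that]
    by (intro integrable_continuous_real continuous_intros cont_powr) auto
  \<comment> \<open>Differentiation under the integral sign is carried out on convex sets, which the
    cut plane is not; holomorphy is local, so balls suffice.\<close>
  have "(\<lambda>u. integral (cbox 0 1) (k u)) holomorphic_on U" if U: "convex U" "U \<subseteq> ?S" for U
  proof (rule leibniz_rule_holomorphic)
    show "((\<lambda>u. k u y) has_field_derivative of_real (y powr ?p) / (1 - u * of_real (y powr ?p))\<^sup>2)
        (at u within U)" if "u \<in> U" "y \<in> cbox 0 1" for u y
      unfolding k_def using nz[of u y] that U
      by (auto intro!: derivative_eq_intros simp: power2_eq_square)
    show "k u integrable_on cbox 0 1" if "u \<in> U" for u
      using int[of u] that U by auto
    have "continuous_on (U \<times> cbox 0 (1::real)) (\<lambda>z. complex_of_real (snd z powr ?p))"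
      by (intro continuous_intros continuous_on_compose2[OF cont_powr[of "{0..1}"]]) auto
    then show "continuous_on (U \<times> cbox 0 1)
        (\<lambda>(u, y). complex_of_real (y powr ?p) / (1 - u * of_real (y powr ?p))\<^sup>2)"
      unfolding split_beta using nz U
      by (intro continuous_on_divide continuous_on_power continuous_on_diff continuous_on_mult
            continuous_on_const continuous_on_fst continuous_on_id) auto
  qed fact
  then have hol: "(\<lambda>u. integral {0..1} (k u)) holomorphic_on U" if "convex U" "U \<subseteq> ?S" for U
    using that by simp
  show "(\<lambda>u. integral {0..1} (\<lambda>y. 1 / (1 - u * of_real (y powr ?p)))) holomorphic_on ?S"
    unfolding k_def[symmetric] holomorphic_on_def
  proof
    fix u assume "u \<in> ?S"
    then obtain e where e: "0 < e" "ball u e \<subseteq> ?S"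
      using open_cut_plane open_contains_ball by blast
    have "(\<lambda>u. integral {0..1} (k u)) field_differentiable at u within ball u e"
      using hol[OF convex_ball e(2)] e(1) by (simp add: holomorphic_on_def)
    then have "(\<lambda>u. integral {0..1} (k u)) field_differentiable at u"
      using e(1) by (simp add: at_within_open[of u "ball u e"])
    then show "(\<lambda>u. integral {0..1} (k u)) field_differentiable at u within ?S"
      by (rule field_differentiable_at_within)
  qed
  show "(\<lambda>n. pochhammer 1 n * pochhammer (of_real b) n / pochhammer (of_real (b + 1)) n * u ^ n / fact n)
      sums integral {0..1} (\<lambda>y. 1 / (1 - u * of_real (y powr ?p)))" if u: "norm u < 1" for u :: complex
  proof -
    have uS: "u \<in> ?S"
    proof
      assume "u \<in> complex_of_real ` {1..}"
      then show False using u by auto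
    qed
    \<comment> \<open>Geometric series, uniform in \<open>y\<close> because
      \<open>y powr (1 / b) \<le> 1\<close>; hence it may be integrated term by term.\<close>
    have unif: "uniform_limit {0..1} (\<lambda>N y. \<Sum>n<N. u ^ n * of_real ((y powr ?p) ^ n)) (k u) sequentially"
    proof -
      have "uniform_limit {0..1} (\<lambda>N y. \<Sum>n<N. u ^ n * of_real ((y powr ?p) ^ n))
          (\<lambda>y. \<Sum>n. u ^ n * of_real ((y powr ?p) ^ n)) sequentially"
      proof (rule Weierstrass_m_test)
        show "norm (u ^ n * of_real ((y powr ?p) ^ n)) \<le> norm u ^ n" if "y \<in> {0..1}" for n y
          using le1[OF that] by (simp add: norm_mult norm_power mult_left_le power_le_one)
        show "summable (\<lambda>n. norm u ^ n)" using u by (simp add: summable_geometric)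
      qed
      moreover have "(\<Sum>n. u ^ n * of_real ((y powr ?p) ^ n)) = k u y" if "y \<in> {0..1}" for y
      proof -
        have "norm (u * of_real (y powr ?p)) < 1"
          using le1[OF that] u by (simp add: norm_mult) (smt (verit) mult_left_le norm_ge_zero)
        from suminf_geometric[OF this] show ?thesis by (simp add: k_def power_mult_distrib)
      qed
      ultimately show ?thesis
        by (subst (asm) uniform_limit_cong'[where g = "\<lambda>N y. \<Sum>n<N. u ^ n * of_real ((y powr ?p) ^ n)" and i = "k u"]) auto
    qed
    have "((\<lambda>y. u ^ n * of_real ((y powr ?p) ^ n)) has_integral u ^ n * of_real (1 / (?p * n + 1))) {0..1}" for n
      by (intro has_integral_mult_right has_integral_of_real has_integral_powr_power p)
    then have part: "((\<lambda>y. \<Sum>n<N. u ^ n * of_real ((y powr ?p) ^ n)) has_integral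
        (\<Sum>n<N. u ^ n * of_real (1 / (?p * n + 1)))) {0..1}" for N
      by (intro has_integral_sum) auto
    obtain I J where IJ: "\<And>N. ((\<lambda>y. \<Sum>n<N. u ^ n * of_real ((y powr ?p) ^ n)) has_integral I N) (cbox 0 1)"
      "(k u has_integral J) (cbox 0 1)" "(I \<longlongrightarrow> J) sequentially"
    proof (rule uniform_limit_integral_cbox)
      show "uniform_limit (cbox 0 1) (\<lambda>N y. \<Sum>n<N. u ^ n * of_real ((y powr ?p) ^ n)) (k u) sequentially"
        using unif by simp
      show "continuous_on (cbox 0 1) (\<lambda>y. \<Sum>n<N. u ^ n * complex_of_real ((y powr ?p) ^ n))" for N
        by (intro continuous_intros cont_powr) auto
    qed auto
    have "I = (\<lambda>N. \<Sum>n<N. u ^ n * of_real (1 / (?p * n + 1)))"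
      using has_integral_unique[OF IJ(1) part[folded cbox_interval]] by (rule ext)
    moreover have "J = integral {0..1} (k u)" using IJ(2) by (simp add: integral_unique)
    ultimately have "(\<lambda>n. u ^ n * of_real (1 / (?p * n + 1))) sums integral {0..1} (k u)"
      using IJ(3) by (simp add: sums_def)
    moreover have "pochhammer 1 n * pochhammer (of_real b) n / pochhammer (of_real (b + 1)) n * u ^ n / fact n =
        u ^ n * complex_of_real (1 / (?p * n + 1))" for n
    proof -
      \<comment> \<open>The quotient of the two Pochhammer symbols telescopes to
        \<open>b / (b + n)\<close>, which is the moment \<open>1 / (n / b + 1)\<close>.\<close>
      have "pochhammer b n * (b + real n) = b * pochhammer (b + 1) n"
        using pochhammer_Suc[of b n] pochhammer_rec[of b n] by simp
      moreover have "pochhammer (b + 1) n > 0" using b by (intro pochhammer_pos) auto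
      ultimately have "pochhammer b n / pochhammer (b + 1) n = 1 / (?p * n + 1)"
        using b by (simp add: field_simps)
      then have ratio: "complex_of_real (pochhammer b n / pochhammer (b + 1) n) = of_real (1 / (?p * n + 1))"
        by (rule arg_cong)
      have "pochhammer 1 n * pochhammer (of_real b) n / pochhammer (of_real (b + 1)) n * u ^ n / fact n =
          u ^ n * complex_of_real (pochhammer b n / pochhammer (b + 1) n)"
        by (simp only: pochhammer_of_real of_real_divide) (simp add: pochhammer_fact[symmetric])
      then show ?thesis by (simp only: ratio)
    qed
    moreover have "k u = (\<lambda>y. 1 / (1 - u * of_real (y powr ?p)))"
      by (rule ext) (simp only: k_def)
    ultimately show ?thesis by (simp only:)
  qed
qed

lemma hypergeometric_2F1_real_integral:
  fixes b x :: real
  assumes b: "0 < b" and x: "0 \<le> x"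
  shows "((\<lambda>y. 1 / (1 + x * y powr (1 / b))) has_integral
    Re (hypergeometric_2F1 1 (of_real b) (of_real (b + 1)) (of_real (- x)))) {0..1}"
proof -
  let ?k = "\<lambda>y. 1 / (1 - of_real (- x) * complex_of_real (y powr (1 / b)))"
  have z: "complex_of_real (- x) \<notin> complex_of_real ` {1..}"
  proof
    assume "complex_of_real (- x) \<in> complex_of_real ` {1..}"
    then obtain r where "1 \<le> r" "- x = r" by (auto simp del: of_real_minus)
    then show False using x by simp
  qed
  have nz: "1 - of_real (- x) * complex_of_real (y powr (1 / b)) \<noteq> 0" if "y \<in> {0..1}" for y
    using that b by (intro cut_plane_nonzero z) (auto simp: powr_le1)
  have "continuous_on {0..1} (\<lambda>y::real. y powr (1 / b))"
    by (rule continuous_on_subset[OF continuous_on_powr_const]) (use b in auto)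
  then have "continuous_on {0..1} ?k"
    using nz by (intro continuous_on_divide continuous_on_diff continuous_on_mult
        continuous_on_const continuous_on_of_real) auto
  then have "(?k has_integral hypergeometric_2F1 1 (of_real b) (of_real (b + 1)) (of_real (- x))) {0..1}"
    unfolding hypergeometric_2F1_integral[OF b z]
    by (intro integrable_integral integrable_continuous_real)
  from has_integral_linear[OF this bounded_linear_Re]
  show ?thesis
  proof (rule has_integral_eq[rotated])
    fix y :: real
    have "?k y = complex_of_real (1 / (1 + x * y powr (1 / b)))" by simp
    then show "(Re \<circ> ?k) y = 1 / (1 + x * y powr (1 / b))"
      by (simp only: o_def Re_complex_of_real)
  qed
qed

section \<open>Laplace factors of the interference and their integrals\<close>

text \<open>Mean of \<open>exp (- \<delta> t\<^sup>a h s\<^sup>-\<^sup>a)\<close> over an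
  exponential fading \<open>h\<close>: the effect of an interferer at \<open>s\<close> on a link of
  length \<open>t\<close>. At \<open>s = 0\<close> division by zero makes the value 1, not
  0.\<close>

definition path_factor :: "real \<Rightarrow> real \<Rightarrow> real \<Rightarrow> real \<Rightarrow> real" where
  "path_factor \<delta> a t s = 1 / (1 + \<delta> * (t / s) powr a)"

lemma path_factor_range:
  assumes "0 \<le> \<delta>"
  shows "0 < path_factor \<delta> a t s" "path_factor \<delta> a t s \<le> 1"
  using assms by (auto simp: path_factor_def add_pos_nonneg)

lemma path_factor_measurable [measurable]:
  "path_factor \<delta> a t \<in> borel_measurable borel"
  unfolding path_factor_def by measurable

lemma one_minus_path_factor:
  assumes "0 < s" "0 < \<delta>"
  shows "1 - path_factor \<delta> a 1 s = \<delta> / (s powr a + \<delta>)"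
proof -
  have p: "0 < s powr a" using assms by simp
  have "s powr a + \<delta> \<noteq> 0" "s powr a \<noteq> 0" using p assms(2) by linarith+
  then show ?thesis
    using assms by (simp add: path_factor_def powr_divide field_simps)
qed

text \<open>The change of variables is available for absolute integrability, which an integrable
  nonnegative function has for free.\<close>

lemma has_integral_substitution_nonneg:
  fixes f g h :: "real \<Rightarrow> real"
  assumes S: "S \<in> sets lebesgue"
    and deriv: "\<And>y. y \<in> S \<Longrightarrow> (g has_field_derivative g' y) (at y within S)"
    and inj: "inj_on g S"
    and h: "(h has_integral I) S" "\<And>y. y \<in> S \<Longrightarrow> 0 \<le> h y"
    and eq: "\<And>y. y \<in> S \<Longrightarrow> \<bar>g' y\<bar> * f (g y) = h y"
  shows "(f has_integral I) (g ` S)"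
proof -
  have "h absolutely_integrable_on S"
    using h by (intro nonnegative_absolutely_integrable_1) (auto simp: has_integral_iff)
  then have "(\<lambda>y. \<bar>g' y\<bar> * f (g y)) absolutely_integrable_on S"
    using eq by (subst set_integrable_cong[OF refl refl, where f' = h]) auto
  moreover have "integral S (\<lambda>y. \<bar>g' y\<bar> * f (g y)) = I"
    using integral_cong[of S _ h, OF eq] h(1) by (simp add: integral_unique)
  ultimately have "f absolutely_integrable_on (g ` S) \<and> integral (g ` S) f = I"
    using has_absolute_integral_change_of_variables_1'[OF S deriv inj, of f I] by blast
  then show ?thesis
    by (auto simp: has_integral_iff absolutely_integrable_on_def)
qed

text \<open>The substitution \<open>s = y powr (- 1 / (a - 1))\<close> maps \<open>(0, 1]\<close>
  onto \<open>[1, \<infinity>)\<close>. Its Jacobian carries the power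
  \<open>y powr (- a / (a - 1))\<close>, which cancels against the growth of \<open>s powr a\<close>
  and leaves Euler's integral with \<open>b = 1 - 1 / a\<close>, since
  \<open>1 / b = a / (a - 1)\<close>.\<close>

lemma G_fun_has_integral:
  assumes a: "1 < a" and \<delta>: "0 < \<delta>"
  shows "((\<lambda>s. \<delta> / (s powr a + \<delta>)) has_integral G_fun \<delta> (2 * a)) {1..}"
proof -
  define b where "b = 1 - 1 / a"
  define g where "g y = y powr (- 1 / (a - 1))" for y :: real
  define f where "f s = \<delta> / (s powr a + \<delta>)" for s :: real
  define h where "h y = \<delta> / (a - 1) * (1 / (1 + \<delta> * y powr (1 / b)))" for y :: real
  have b: "0 < b" "1 / b = a / (a - 1)" using a by (auto simp: b_def field_simps)
  have G: "G_fun \<delta> (2 * a) = \<delta> / (a - 1) *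
      Re (hypergeometric_2F1 1 (of_real b) (of_real (b + 1)) (of_real (- \<delta>)))"
    using a by (simp add: G_fun_def b_def) (simp add: field_simps)
  have h01: "(h has_integral G_fun \<delta> (2 * a)) {0..1}"
    unfolding h_def G using b(1) \<delta> by (intro has_integral_mult_right hypergeometric_2F1_real_integral) auto
  then have hint: "(h has_integral G_fun \<delta> (2 * a)) {0<..1}"
    by (subst has_integral_spike_set_eq[where T = "{0..1}"])
       (auto intro: negligible_subset[of "{0}"])
  have "\<bar>- 1 / (a - 1) * y powr (- 1 / (a - 1) - 1)\<bar> * f (g y) = h y" if y: "y \<in> {0<..1}" for y
  proof -
    define q where "q = y powr (1 / b)"
    have q: "0 < q" using y by (simp add: q_def)
    have "- 1 / (a - 1) - 1 = - (1 / b)" using a by (simp add: b field_simps)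
    then have "y powr (- 1 / (a - 1) - 1) = 1 / q" by (simp only: q_def powr_minus_divide)
    then have e1: "\<bar>- 1 / (a - 1) * y powr (- 1 / (a - 1) - 1)\<bar> = 1 / ((a - 1) * q)"
      using a q by (simp only:) (simp add: abs_mult)
    have "- 1 / (a - 1) * a = - (1 / b)" using b(2) by simp
    then have "g y powr a = 1 / q"
      by (simp only: g_def powr_powr q_def powr_minus_divide)
    then have "f (g y) = \<delta> / ((1 + \<delta> * q) / q)"
      using q by (simp add: f_def add_divide_distrib)
    then show ?thesis
      unfolding e1 h_def q_def[symmetric] using a q by simp
  qed
  then have "(f has_integral G_fun \<delta> (2 * a)) (g ` {0<..1})"
  proof (intro has_integral_substitution_nonneg[where h = h])
    show "(g has_field_derivative - 1 / (a - 1) * y powr (- 1 / (a - 1) - 1)) (at y within {0<..1})"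
      if "y \<in> {0<..1}" for y
      unfolding g_def using that by (auto intro!: derivative_eq_intros)
    show "inj_on g {0<..1}"
    proof (rule inj_onI)
      fix x y assume xy: "x \<in> {0<..1}" "y \<in> {0<..1}" "g x = g y"
      have "- 1 / (a - 1) * (1 - a) = 1" using a by (simp add: field_simps)
      then have "g z powr (1 - a) = z" if "z \<in> {0<..1}" for z
        using that by (simp only: g_def powr_powr) simp
      then show "x = y" using xy by metis
    qed
    show "0 \<le> h y" for y using a \<delta> by (simp add: h_def)
  qed (use hint in auto)
  moreover have "g ` {0<..1} = {1..}"
  proof safe
    fix y :: real assume "y \<in> {0<..1}"
    then show "1 \<le> g y"
      using a powr_mono'[of "- 1 / (a - 1)" 0 y] by (simp add: g_def)
  next
    fix s :: real assume s: "1 \<le> s"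
    have "(1 - a) * (- 1 / (a - 1)) = 1" using a by (simp add: field_simps)
    then have "s = g (s powr (1 - a))"
      using s by (simp only: g_def powr_powr) simp
    moreover have "s powr (1 - a) \<le> 1"
      using s a powr_mono[of "1 - a" 0 s] by simp
    ultimately show "s \<in> g ` {0<..1}" using s by (intro image_eqI) auto
  qed
  ultimately show ?thesis by (simp add: f_def[abs_def])
qed

text \<open>The substitution \<open>s powr a = \<delta> * u / (1 - u)\<close> turns the integrand
  into \<open>1 - u\<close>; the Jacobian then supplies the Beta density with parameters
  \<open>1 / a\<close> and \<open>1 - 1 / a\<close>.\<close>

lemma H_fun_has_integral:
  assumes a: "1 < a" and \<delta>: "0 < \<delta>"
  shows "((\<lambda>s. \<delta> / (s powr a + \<delta>)) has_integral H_fun \<delta> (2 * a)) {0<..}"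
proof -
  define r where "r = 1 / a"
  define g where "g u = (\<delta> * (u / (1 - u))) powr r" for u :: real
  define g' where "g' u = r * (\<delta> * (u / (1 - u))) powr (r - 1) * (\<delta> / (1 - u)\<^sup>2)" for u :: real
  define f where "f s = \<delta> / (s powr a + \<delta>)" for s :: real
  define h where "h u = r * \<delta> powr r * (u powr (r - 1) * (1 - u) powr ((1 - r) - 1))" for u :: real
  have r: "0 < r" "r < 1" "r * a = 1" using a by (auto simp: r_def)
  have H: "H_fun \<delta> (2 * a) = r * \<delta> powr r * Beta r (1 - r)"
    by (simp add: H_fun_def r_def)
  have "(h has_integral H_fun \<delta> (2 * a)) {0..1}"
    unfolding h_def H using r by (intro has_integral_mult_right has_integral_Beta_real) auto
  then have hint: "(h has_integral H_fun \<delta> (2 * a)) {0<..<1}"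
    by (simp add: has_integral_Icc_iff_Ioo)
  have "\<bar>g' u\<bar> * f (g u) = h u" if u: "u \<in> {0<..<1}" for u
  proof -
    have "g u powr a = \<delta> * (u / (1 - u))"
      using u \<delta> r by (simp add: g_def powr_powr)
    moreover have "\<delta> * (u / (1 - u)) + \<delta> = \<delta> / (1 - u)"
      using u by (simp add: field_simps)
    ultimately have e1: "f (g u) = 1 - u"
      using u \<delta> by (simp add: f_def)
    define U V W where "U = u powr (r - 1)" and "V = (1 - u) powr (1 - r)" and "W = \<delta> powr (r - 1)"
    have e2: "(\<delta> * (u / (1 - u))) powr (r - 1) = W * U * V"
      using u \<delta> powr_minus_divide[of "1 - u" "r - 1"]
      by (simp add: powr_mult powr_divide U_def V_def W_def)
    have e3: "\<bar>g' u\<bar> = r * (W * U * V) * (\<delta> / (1 - u)\<^sup>2)"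
      unfolding g'_def e2 using r \<delta> by (intro abs_of_nonneg) (simp add: U_def V_def W_def)
    have e4: "\<delta> powr r = W * \<delta>"
      using \<delta> powr_add[of \<delta> "r - 1" 1] by (simp add: W_def)
    have e5: "(1 - u) powr ((1 - r) - 1) = V / (1 - u)"
      using u powr_diff[of "1 - u" "1 - r" 1] by (simp add: V_def)
    show ?thesis
      unfolding e1 e3 h_def e4 e5 U_def[symmetric] using u by (simp add: power2_eq_square)
  qed
  then have "(f has_integral H_fun \<delta> (2 * a)) (g ` {0<..<1})"
  proof (intro has_integral_substitution_nonneg[where h = h])
    show "(g has_field_derivative g' u) (at u within {0<..<1})" if "u \<in> {0<..<1}" for u
    proof -
      have "((\<lambda>u. \<delta> * (u / (1 - u))) has_field_derivative \<delta> / (1 - u)\<^sup>2) (at u)"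
        using that by (auto intro!: derivative_eq_intros simp: power2_eq_square field_simps)
      from DERIV_fun_powr[OF this, of r] show ?thesis
        unfolding g_def g'_def using that \<delta> by (auto intro: has_field_derivative_at_within)
    qed
    show "inj_on g {0<..<1}"
    proof (rule inj_onI)
      fix x y assume xy: "x \<in> {0<..<1}" "y \<in> {0<..<1}" "g x = g y"
      have "g z powr a = \<delta> * (z / (1 - z))" if "z \<in> {0<..<1}" for z
        using that \<delta> r by (simp add: g_def powr_powr)
      then have "\<delta> * (x / (1 - x)) = \<delta> * (y / (1 - y))"
        using xy by metis
      then have "x / (1 - x) = y / (1 - y)"
        using \<delta> by (metis mult_cancel_left less_irrefl)
      then show "x = y" using xy by (simp add: frac_eq_eq algebra_simps)
    qed
    show "0 \<le> h u" for u using r by (simp add: h_def)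
  qed (use hint in auto)
  moreover have "g ` {0<..<1} = {0<..}"
  proof safe
    fix u :: real assume "u \<in> {0<..<1}"
    then show "0 < g u" using \<delta> by (simp add: g_def)
  next
    fix s :: real assume s: "0 < s"
    define v where "v = s powr a"
    define u where "u = v / (v + \<delta>)"
    have v: "0 < v" using s by (simp add: v_def)
    have u: "u \<in> {0<..<1}" using v \<delta> by (simp add: u_def)
    have "1 - u = \<delta> / (v + \<delta>)" using v \<delta> by (simp add: u_def field_simps)
    then have "\<delta> * (u / (1 - u)) = v"
      using v \<delta> by (simp add: u_def)
    then have "g u = v powr r" by (simp only: g_def)
    then have "g u = s" using s r by (simp add: v_def powr_powr mult.commute)
    then show "s \<in> g ` {0<..<1}" using u by blast
  qed
  ultimately show ?thesis by (simp add: f_def[abs_def])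
qed

lemma G_fun_nonneg: "1 < a \<Longrightarrow> 0 < \<delta> \<Longrightarrow> 0 \<le> G_fun \<delta> (2 * a)"
  by (rule has_integral_nonneg[OF G_fun_has_integral]) auto

lemma H_fun_nonneg: "1 < a \<Longrightarrow> 0 < \<delta> \<Longrightarrow> 0 \<le> H_fun \<delta> (2 * a)"
  by (rule has_integral_nonneg[OF H_fun_has_integral]) auto

lemma path_factor_scale: "0 < t \<Longrightarrow> path_factor \<delta> a t (t * s) = path_factor \<delta> a 1 s"
  by (simp add: path_factor_def)

lemma nn_integral_scale:
  fixes f :: "real \<Rightarrow> ennreal"
  assumes [measurable]: "f \<in> borel_measurable borel" and t: "0 < t"
  shows "(\<integral>\<^sup>+s. f s \<partial>lborel) = ennreal t * (\<integral>\<^sup>+s. f (t * s) \<partial>lborel)"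
  by (subst nn_integral_real_affine[of f t 0]) (use t in auto)

lemma nn_integral_path_factor_beyond:
  assumes a: "1 < a" and \<delta>: "0 < \<delta>" and t: "0 < t"
  shows "(\<integral>\<^sup>+s. ennreal (1 - path_factor \<delta> a t s) * indicator {t..} s \<partial>lborel) =
    ennreal (t * G_fun \<delta> (2 * a))"
proof -
  have "(\<integral>\<^sup>+s. ennreal (1 - path_factor \<delta> a t s) * indicator {t..} s \<partial>lborel) =
      ennreal t * (\<integral>\<^sup>+s. ennreal (1 - path_factor \<delta> a t (t * s)) * indicator {t..} (t * s) \<partial>lborel)"
    by (rule nn_integral_scale[OF _ t]) measurable
  also have "(\<integral>\<^sup>+s. ennreal (1 - path_factor \<delta> a t (t * s)) * indicator {t..} (t * s) \<partial>lborel) =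
      (\<integral>\<^sup>+s. ennreal (\<delta> / (s powr a + \<delta>)) * indicator {1..} s \<partial>lborel)"
    using t \<delta> by (intro nn_integral_cong)
      (auto simp: path_factor_scale one_minus_path_factor indicator_def)
  also have "\<dots> = ennreal (G_fun \<delta> (2 * a))"
    using \<delta> by (intro nn_integral_has_integral_lebesgue' G_fun_has_integral[OF a]) auto
  finally show ?thesis using t a \<delta> by (simp add: ennreal_mult' G_fun_nonneg)
qed

lemma nn_integral_path_factor:
  assumes a: "1 < a" and \<delta>: "0 < \<delta>" and t: "0 < t"
  shows "(\<integral>\<^sup>+s. ennreal (1 - path_factor \<delta> a t s) * indicator {0..} s \<partial>lborel) =
    ennreal (t * H_fun \<delta> (2 * a))"
proof -
  have "(\<integral>\<^sup>+s. ennreal (1 - path_factor \<delta> a t s) * indicator {0..} s \<partial>lborel) =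
      ennreal t * (\<integral>\<^sup>+s. ennreal (1 - path_factor \<delta> a t (t * s)) * indicator {0..} (t * s) \<partial>lborel)"
    by (rule nn_integral_scale[OF _ t]) measurable
  also have "(\<integral>\<^sup>+s. ennreal (1 - path_factor \<delta> a t (t * s)) * indicator {0..} (t * s) \<partial>lborel) =
      (\<integral>\<^sup>+s. ennreal (\<delta> / (s powr a + \<delta>)) * indicator {0<..} s \<partial>lborel)"
  proof (intro nn_integral_cong)
    fix s :: real
    show "ennreal (1 - path_factor \<delta> a t (t * s)) * indicator {0..} (t * s) =
        ennreal (\<delta> / (s powr a + \<delta>)) * indicator {0<..} s"
    proof (cases "s = 0")
      \<comment> \<open>Both sides vanish at 0: the path factor is 1 there by convention, and the
        right-hand indicator excludes the point.\<close>
      case True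
      then show ?thesis by (simp add: path_factor_def)
    next
      case False
      then show ?thesis
        using t \<delta> by (auto simp: path_factor_scale one_minus_path_factor indicator_def zero_le_mult_iff)
    qed
  qed
  also have "\<dots> = ennreal (H_fun \<delta> (2 * a))"
    using \<delta> by (intro nn_integral_has_integral_lebesgue' H_fun_has_integral[OF a]) auto
  finally show ?thesis using t a \<delta> by (simp add: ennreal_mult' H_fun_nonneg)
qed

lemma nn_integral_exp_minus_atLeast:
  assumes "0 < c"
  shows "(\<integral>\<^sup>+t. ennreal (exp (- (c * t))) * indicator {0..} t \<partial>lborel) = ennreal (1 / c)"
proof -
  have "((\<lambda>t. exp (- c * t)) has_integral (exp (- c * 0) / c)) {0..}"
    by (rule has_integral_exp_minus_to_infinity) fact
  then show ?thesis
    by (intro nn_integral_has_integral_lebesgue') auto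
qed

lemma nn_integral_exp_minus_greaterThan:
  assumes "0 < c"
  shows "(\<integral>\<^sup>+t. ennreal (exp (- (c * t))) * indicator {0<..} t \<partial>lborel) = ennreal (1 / c)"
proof -
  have "(\<integral>\<^sup>+t. ennreal (exp (- (c * t))) * indicator {0<..} t \<partial>lborel) =
      (\<integral>\<^sup>+t. ennreal (exp (- (c * t))) * indicator {0..} t \<partial>lborel)"
  proof (rule nn_integral_cong_AE)
    show "AE t in lborel. ennreal (exp (- (c * t))) * indicator {0<..} t = ennreal (exp (- (c * t))) * indicator {0..} t"
      using AE_lborel_singleton[of "0::real"] by eventually_elim (auto simp: indicator_def)
  qed
  then show ?thesis using nn_integral_exp_minus_atLeast[OF assms] by simp
qed

text \<open>Integrated over \<open>t\<close>, the middle term is the Frullani integral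
  \<open>ln ((c + b) / c)\<close>. These bounds give \<open>b / (c + b)\<close> and
  \<open>b / c\<close> by elementary integrals, and they agree to first order in \<open>b\<close>,
  which is all that is used.\<close>

lemma exp_difference_bounds:
  fixes b c t :: real
  assumes "0 < t" "0 \<le> b"
  shows "(exp (- (c * t)) - exp (- ((c + b) * t))) / t \<le> b * exp (- (c * t))"
    and "b * exp (- ((c + b) * t)) \<le> (exp (- (c * t)) - exp (- ((c + b) * t))) / t"
proof -
  have e: "exp (- ((c + b) * t)) = exp (- (c * t)) * exp (- (b * t))"
    by (simp add: exp_add[symmetric] algebra_simps)
  have "1 - exp (- (b * t)) \<le> b * t" using exp_ge_add_one_self[of "- (b * t)"] by simp
  then have "exp (- (c * t)) * (1 - exp (- (b * t))) \<le> exp (- (c * t)) * (b * t)"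
    by (intro mult_left_mono) auto
  then show "(exp (- (c * t)) - exp (- ((c + b) * t))) / t \<le> b * exp (- (c * t))"
    unfolding e using assms by (simp add: divide_le_eq algebra_simps)
  have "(1 + b * t) * exp (- (b * t)) \<le> exp (b * t) * exp (- (b * t))"
    using exp_ge_add_one_self[of "b * t"] by (intro mult_right_mono) auto
  also have "\<dots> = 1" by (simp add: exp_add[symmetric])
  finally have "exp (- (c * t)) * (b * t * exp (- (b * t))) \<le> exp (- (c * t)) * (1 - exp (- (b * t)))"
    by (intro mult_left_mono) (auto simp: algebra_simps)
  then show "b * exp (- ((c + b) * t)) \<le> (exp (- (c * t)) - exp (- ((c + b) * t))) / t"
    unfolding e using assms by (simp add: le_divide_eq algebra_simps)
qed

section \<open>Products over all base stations\<close>

lemma UNIV_tier: "(UNIV :: tier set) = {MBS, Helper}"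
  using tier.exhaust by auto

instance tier :: finite
  by standard (simp add: UNIV_tier)

lemma prod_le_1_ennreal:
  fixes f :: "'i \<Rightarrow> ennreal"
  shows "(\<And>i. i \<in> I \<Longrightarrow> f i \<le> 1) \<Longrightarrow> prod f I \<le> 1"
  using prod_mono_ennreal[of I f "\<lambda>_. 1"] by simp

text \<open>The two tiers are interleaved under one index, so that a single limit passes from finite
  products to the product over all base stations.\<close>

definition tier_prod :: "(tier \<Rightarrow> nat \<Rightarrow> ennreal) \<Rightarrow> ennreal" where
  "tier_prod f = inf_prod (\<lambda>i. \<Prod>k\<in>UNIV. f k i)"

lemma tier_prod_partial:
  assumes "\<And>k i. f k i \<le> 1"
  shows "(\<lambda>N. \<Prod>z\<in>UNIV \<times> {..<N}. f (fst z) (snd z)) \<longlonglongrightarrow> tier_prod f"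
proof -
  have "(\<Prod>z\<in>UNIV \<times> {..<N}. f (fst z) (snd z)) = (\<Prod>i<N. \<Prod>k\<in>UNIV. f k i)" for N
    by (subst prod.swap) (simp add: prod.cartesian_product split_beta)
  then show ?thesis
    using assms by (simp add: tier_prod_def partial_prod_tendsto_inf_prod prod_le_1_ennreal)
qed

lemma tier_prod_eqI:
  assumes "\<And>k i. f k i \<le> 1" "(\<lambda>N. \<Prod>z\<in>UNIV \<times> {..<N}. f (fst z) (snd z)) \<longlonglongrightarrow> c"
  shows "tier_prod f = c"
  using LIMSEQ_unique[OF tier_prod_partial assms(2)] assms(1) by blast

lemma tier_prod_le_1: "tier_prod f \<le> 1"
  unfolding tier_prod_def by (rule inf_prod_le_1)

lemma tier_prod_mono: "(\<And>k i. f k i \<le> g k i) \<Longrightarrow> tier_prod f \<le> tier_prod g"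
  unfolding tier_prod_def by (intro inf_prod_mono prod_mono_ennreal) auto

lemma borel_measurable_tier_prod [measurable (raw)]:
  "(\<And>k i. (\<lambda>x. f k i x) \<in> borel_measurable M) \<Longrightarrow> (\<lambda>x. tier_prod (\<lambda>k i. f k i x)) \<in> borel_measurable M"
  unfolding tier_prod_def by measurable

lemma tier_prod_mult:
  assumes "\<And>k i. f k i \<le> 1" "\<And>k i. g k i \<le> 1"
  shows "tier_prod (\<lambda>k i. f k i * g k i) = tier_prod f * tier_prod g"
  unfolding tier_prod_def prod.distrib
  using assms by (intro inf_prod_mult prod_le_1_ennreal) auto

lemma tier_prod_split:
  assumes "\<And>k i. f k i \<le> 1"
  shows "tier_prod f = (\<Prod>k\<in>UNIV. inf_prod (f k))"
  unfolding tier_prod_def UNIV_tier using assms by (simp add: inf_prod_mult)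

text \<open>A product with a single nontrivial factor equals that factor, so this is
  multiplicativity. A factor is replaced by 1 rather than divided out, which is also sound when it
  is 0.\<close>

lemma tier_prod_remove:
  assumes "\<And>k i. f k i \<le> 1"
  shows "tier_prod (\<lambda>l i. if (l, i) = (k, j) then 1 else f l i) * f k j = tier_prod f"
proof -
  have "(\<Prod>z\<in>UNIV \<times> {..<N}. if (fst z, snd z) = (k, j) then f k j else 1) = f k j" if "N > j" for N
    using that by simp
  then have "(\<lambda>N. \<Prod>z\<in>UNIV \<times> {..<N}. if (fst z, snd z) = (k, j) then f k j else 1) \<longlonglongrightarrow> f k j"
    by (intro tendsto_eventually) (auto simp: eventually_at_top_dense)
  then have "tier_prod (\<lambda>l i. if (l, i) = (k, j) then f k j else 1) = f k j"
    using assms by (intro tier_prod_eqI) auto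
  then have "tier_prod (\<lambda>l i. if (l, i) = (k, j) then 1 else f l i) * f k j =
      tier_prod (\<lambda>l i. (if (l, i) = (k, j) then 1 else f l i) * (if (l, i) = (k, j) then f k j else 1))"
    using assms by (subst tier_prod_mult) auto
  also have "\<dots> = tier_prod f"
    by (intro arg_cong[of _ _ tier_prod] ext) auto
  finally show ?thesis .
qed

lemma tier_prod_indicator:
  "tier_prod (\<lambda>k i. if P k i then 0 else 1) = (if \<exists>k i. P k i then 0 else 1)"
proof (cases "\<exists>k i. P k i")
  case True
  then obtain k j where "P k j" by blast
  then show ?thesis
    using tier_prod_remove[of "\<lambda>k i. if P k i then 0 else 1" k j] by auto
next
  case False
  then show ?thesis by (intro tier_prod_eqI) auto
qed

lemma (in prob_space) nn_integral_tier_prod: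
  assumes [measurable]: "F \<in> borel_measurable M" "\<And>k i. f k i \<in> borel_measurable M"
    and F: "\<And>x. F x \<le> 1" and f: "\<And>k i x. f k i x \<le> 1"
  shows "(\<lambda>N. \<integral>\<^sup>+x. F x * (\<Prod>z\<in>UNIV \<times> {..<N}. f (fst z) (snd z) x) \<partial>M)
    \<longlonglongrightarrow> (\<integral>\<^sup>+x. F x * tier_prod (\<lambda>k i. f k i x) \<partial>M)"
proof (rule nn_integral_dominated_convergence[where w = "\<lambda>_. 1"])
  let ?P = "\<lambda>N x. \<Prod>z\<in>UNIV \<times> {..<N}. f (fst z) (snd z) x"
  show "AE x in M. F x * (?P N x) \<le> 1" for N
  proof (rule AE_I2)
    fix x
    have "(?P N x) \<le> 1"
      using f by (rule prod_le_1_ennreal)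
    then show "F x * (?P N x) \<le> 1"
      using mult_mono[OF F[of x]] by fastforce
  qed
  show "AE x in M. (\<lambda>N. F x * (?P N x))
      \<longlonglongrightarrow> F x * tier_prod (\<lambda>k i. f k i x)"
  proof (rule AE_I2)
    fix x
    have "F x < top" using F[of x] by (simp add: le_less_trans)
    then show "(\<lambda>N. F x * (?P N x))
        \<longlonglongrightarrow> F x * tier_prod (\<lambda>k i. f k i x)"
      using tier_prod_partial[of "\<lambda>k i. f k i x"] f by (intro ennreal_tendsto_cmult) auto
  qed
qed (auto simp: emeasure_space_1)

lemma (in prob_space) nn_integral_if_event:
  assumes [measurable]: "{x \<in> space M. P x} \<in> events"
  shows "(\<integral>\<^sup>+x. (if P x then A else B) \<partial>M) =
    A * ennreal (prob {x \<in> space M. P x}) + B * ennreal (1 - prob {x \<in> space M. P x})"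
proof -
  have "(\<integral>\<^sup>+x. (if P x then A else B) \<partial>M) =
      (\<integral>\<^sup>+x. A * indicator {x \<in> space M. P x} x + B * indicator (space M - {x \<in> space M. P x}) x \<partial>M)"
    by (intro nn_integral_cong) (auto simp: indicator_def)
  also have "\<dots> = A * emeasure M {x \<in> space M. P x} + B * emeasure M (space M - {x \<in> space M. P x})"
    by (subst nn_integral_add) (auto simp: nn_integral_cmult_indicator)
  finally show ?thesis by (simp add: emeasure_eq_measure prob_compl)
qed

text \<open>The partial products of the two sides have equal means by \<open>decouple_prod\<close>;
  as they are bounded by 1, dominated convergence gives both integrals as the limit of one
  sequence.\<close>

lemma (in independent_sources) decouple_tier_prod:
  fixes K :: "tier \<Rightarrow> nat \<Rightarrow> 'i set"
  assumes disj: "\<And>k i. J \<inter> K k i = {}" "\<And>k i l j. (k, i) \<noteq> (l, j) \<Longrightarrow> K k i \<inter> K l j = {}"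
    and G: "G \<in> borel_measurable (gen J)" "\<And>x. G x \<le> 1"
    and f: "\<And>k i. (\<lambda>(x, y). f k i x y) \<in> borel_measurable (gen J \<Otimes>\<^sub>M gen (K k i))"
      "\<And>k i x y. f k i x y \<le> 1"
  shows "(\<integral>\<^sup>+x. G x * tier_prod (\<lambda>k i. f k i x x) \<partial>M) =
    (\<integral>\<^sup>+x. G x * tier_prod (\<lambda>k i. \<integral>\<^sup>+y. f k i x y \<partial>M) \<partial>M)"
proof (rule LIMSEQ_unique)
  have [measurable]: "G \<in> borel_measurable M" by (rule measurable_gen) fact
  have diag [measurable]: "(\<lambda>x. f k i x x) \<in> borel_measurable M" for k i
  proof -
    have "(\<lambda>x. (x, x)) \<in> measurable M (gen J \<Otimes>\<^sub>M gen (K k i))"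
      by (intro measurable_Pair id_measurable_gen)
    from measurable_compose[OF this f(1)] show ?thesis by simp
  qed
  show "(\<lambda>N. \<integral>\<^sup>+x. G x * (\<Prod>z\<in>UNIV \<times> {..<N}. f (fst z) (snd z) x x) \<partial>M)
      \<longlonglongrightarrow> (\<integral>\<^sup>+x. G x * tier_prod (\<lambda>k i. f k i x x) \<partial>M)"
    by (rule nn_integral_tier_prod) (auto simp: G f)
  have [measurable]: "(\<lambda>x. \<integral>\<^sup>+y. f k i x y \<partial>M) \<in> borel_measurable M" for k i
    by (rule measurable_gen[OF decouple_measurable[OF f(1)]])
  have "(\<lambda>N. \<integral>\<^sup>+x. G x * (\<Prod>z\<in>UNIV \<times> {..<N}. \<integral>\<^sup>+y. f (fst z) (snd z) x y \<partial>M) \<partial>M)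
      \<longlonglongrightarrow> (\<integral>\<^sup>+x. G x * tier_prod (\<lambda>k i. \<integral>\<^sup>+y. f k i x y \<partial>M) \<partial>M)"
  proof (rule nn_integral_tier_prod)
    show "(\<integral>\<^sup>+y. f k i x y \<partial>M) \<le> 1" for k i x
      using nn_integral_mono[of M "f k i x" "\<lambda>_. 1"] f(2) by (simp add: emeasure_space_1)
  qed (auto simp: G)
  moreover have "(\<integral>\<^sup>+x. G x * (\<Prod>z\<in>UNIV \<times> {..<N}. \<integral>\<^sup>+y. f (fst z) (snd z) x y \<partial>M) \<partial>M) =
      (\<integral>\<^sup>+x. G x * (\<Prod>z\<in>UNIV \<times> {..<N}. f (fst z) (snd z) x x) \<partial>M)" for N
  proof (rule decouple_prod[symmetric, where J = J and K = "\<lambda>z. K (fst z) (snd z)"])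
    show "disjoint_family_on (\<lambda>z. K (fst z) (snd z)) (UNIV \<times> {..<N})"
      using disj(2) by (fastforce simp: disjoint_family_on_def)
  qed (auto simp: disj G f)
  ultimately show "(\<lambda>N. \<integral>\<^sup>+x. G x * (\<Prod>z\<in>UNIV \<times> {..<N}. f (fst z) (snd z) x x) \<partial>M)
      \<longlonglongrightarrow> (\<integral>\<^sup>+x. G x * tier_prod (\<lambda>k i. \<integral>\<^sup>+y. f k i x y \<partial>M) \<partial>M)"
    by simp
qed

section \<open>The abstract two-tier network\<close>

text \<open>An MBS is a candidate and active without any random mark, so it depends on no source at
  all.\<close>

fun cand_src :: "tier \<Rightarrow> nat \<Rightarrow> source set" where
  "cand_src MBS j = {}"
| "cand_src Helper j = {Storage j}"

fun act_src :: "tier \<Rightarrow> nat \<Rightarrow> source set" where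
  "act_src MBS j = {}"
| "act_src Helper j = {Activity j}"

lemma cand_src_subset: "cand_src k j \<subseteq> range Storage"
  by (cases k) auto

lemma act_src_subset: "act_src k j \<subseteq> range Activity"
  by (cases k) auto

lemma cand_src_disjoint: "(k, i) \<noteq> (l, j) \<Longrightarrow> cand_src k i \<inter> cand_src l j = {}"
  by (cases k; cases l) auto

lemma act_src_disjoint: "(k, i) \<noteq> (l, j) \<Longrightarrow> act_src k i \<inter> act_src l j = {}"
  by (cases k; cases l) auto

text \<open>The coordinate \<open>\<tau>\<close> of a point \<open>x\<close> of tier \<open>k\<close> is \<open>\<bar>x\<bar>\<^sup>2 / P\<^sub>k powr (1 / a)\<close> with
  \<open>a\<close> half the path loss exponent, so that its mean received power is \<open>\<tau> powr - a\<close> in either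
  tier and the strongest point has the smallest coordinate.\<close>

locale two_tier_network = independent_sources M F for M :: "'a measure" and F :: "source \<Rightarrow> 'a set set" +
  fixes a :: real and w p q :: "tier \<Rightarrow> real"
    and \<tau> fad :: "tier \<Rightarrow> nat \<Rightarrow> 'a \<Rightarrow> real"
    and cand act :: "tier \<Rightarrow> nat \<Rightarrow> 'a \<Rightarrow> bool"
  assumes a: "1 < a"
    and w_pos: "\<And>k. 0 < w k"
    and points: "\<And>k. half_line_poisson M (w k) (\<tau> k)"
    and \<tau>_gen: "\<And>k j. \<tau> k j \<in> borel_measurable (gen {Locations k})"
    and fad_gen: "\<And>k j. fad k j \<in> borel_measurable (gen {Fading k j})"
    and cand_gen: "\<And>k j. Measurable.pred (gen (cand_src k j)) (cand k j)"
    and act_gen: "\<And>k j. Measurable.pred (gen (act_src k j)) (act k j)"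
    and fad_nonneg: "\<And>k j x. 0 \<le> fad k j x"
    and fad_tail: "\<And>k j c. 0 \<le> c \<Longrightarrow> prob {x \<in> space M. c \<le> fad k j x} = exp (- c)"
    and fad_laplace: "\<And>k j s. 0 \<le> s \<Longrightarrow> (\<integral>\<^sup>+x. ennreal (exp (- (s * fad k j x))) \<partial>M) = ennreal (1 / (1 + s))"
    and prob_cand: "\<And>k j. prob {x \<in> space M. cand k j x} = p k"
    and prob_act: "\<And>k j. prob {x \<in> space M. act k j x} = q k"
    and p_MBS: "p MBS = 1"
begin

sublocale P: half_line_poisson M "w k" "\<tau> k" for k
  by (rule points)

lemma \<tau>_measurable [measurable]: "\<tau> k j \<in> borel_measurable M"
  by (rule measurable_gen[OF \<tau>_gen])

lemma fad_measurable [measurable]: "fad k j \<in> borel_measurable M"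
  by (rule measurable_gen[OF fad_gen])

lemma cand_measurable [measurable]: "Measurable.pred M (cand k j)"
  by (rule measurable_gen[OF cand_gen])

lemma act_measurable [measurable]: "Measurable.pred M (act k j)"
  by (rule measurable_gen[OF act_gen])

lemma p_range: "0 \<le> p k" "p k \<le> 1"
  unfolding prob_cand[of k 0, symmetric] by auto

lemma q_range: "0 \<le> q k" "q k \<le> 1"
  unfolding prob_act[of k 0, symmetric] by auto

text \<open>The path factor averaged over the activity mark: a silent base station, of probability
  \<open>1 - q k\<close>, contributes the factor 1.\<close>

definition psi :: "real \<Rightarrow> tier \<Rightarrow> real \<Rightarrow> real \<Rightarrow> real" where
  "psi \<delta> k t s = 1 - q k * (1 - path_factor \<delta> a t s)"

lemma psi_measurable [measurable]: "psi \<delta> k t \<in> borel_measurable borel"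
  unfolding psi_def by measurable

lemma psi_range:
  assumes "0 \<le> \<delta>"
  shows "0 < psi \<delta> k t s" "psi \<delta> k t s \<le> 1"
proof -
  have "q k * (1 - path_factor \<delta> a t s) \<le> 1 * (1 - path_factor \<delta> a t s)"
    using q_range[of k] path_factor_range[OF assms, of a t s] by (intro mult_right_mono) auto
  then show "0 < psi \<delta> k t s"
    using path_factor_range[OF assms, of a t s] by (simp add: psi_def)
  show "psi \<delta> k t s \<le> 1"
    using q_range[of k] path_factor_range[OF assms, of a t s] by (simp add: psi_def)
qed

text \<open>The storage marks are averaged before the locations. A point then contributes the convex
  combination of its two factors, so the generating functional of the full process applies and
  thinned processes never have to be constructed.\<close>

lemma environment_functional:
  fixes g1 g0 :: "tier \<Rightarrow> real \<Rightarrow> real"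
  assumes [measurable]: "\<And>k. g1 k \<in> borel_measurable borel" "\<And>k. g0 k \<in> borel_measurable borel"
    and g1: "\<And>k s. 0 \<le> g1 k s" "\<And>k s. g1 k s \<le> 1"
    and g0: "\<And>k s. 0 \<le> g0 k s" "\<And>k s. g0 k s \<le> 1"
    and I: "\<And>k. (\<integral>\<^sup>+s. ennreal (1 - (p k * g1 k s + (1 - p k) * g0 k s)) * indicator {0..} s \<partial>lborel) = ennreal (I k)"
      "\<And>k. 0 \<le> I k"
  shows "(\<integral>\<^sup>+x. tier_prod (\<lambda>k i. ennreal (if cand k i x then g1 k (\<tau> k i x) else g0 k (\<tau> k i x))) \<partial>M) =
    ennreal (exp (- (\<Sum>k\<in>UNIV. w k * I k)))"
proof -
  define u where "u k s = 1 - (p k * g1 k s + (1 - p k) * g0 k s)" for k s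
  have convex: "0 \<le> p k * g1 k s + (1 - p k) * g0 k s" "p k * g1 k s + (1 - p k) * g0 k s \<le> 1" for k s
  proof -
    show "0 \<le> p k * g1 k s + (1 - p k) * g0 k s"
      using p_range[of k] g1(1)[of k s] g0(1)[of k s] by (intro add_nonneg_nonneg mult_nonneg_nonneg) auto
    have "p k * g1 k s + (1 - p k) * g0 k s \<le> p k * 1 + (1 - p k) * 1"
      using p_range[of k] g1(2)[of k s] g0(2)[of k s] by (intro add_mono mult_left_mono) auto
    then show "p k * g1 k s + (1 - p k) * g0 k s \<le> 1" by simp
  qed
  have u: "0 \<le> u k s" "u k s \<le> 1" for k s
    using convex[of k s] by (auto simp: u_def)
  have [measurable]: "u k \<in> borel_measurable borel" for k unfolding u_def by measurable
  define f where "f k i x y = ennreal (if cand k i y then g1 k (\<tau> k i x) else g0 k (\<tau> k i x))" for k i x y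
  have f_meas: "(\<lambda>(x, y). f k i x y) \<in> borel_measurable (gen (range Locations) \<Otimes>\<^sub>M gen (cand_src k i))" for k i
  proof -
    note [measurable] = cand_gen[of k i]
    have [measurable]: "\<tau> k i \<in> borel_measurable (gen (range Locations))"
      by (rule measurable_gen_mono[OF _ \<tau>_gen]) auto
    show ?thesis unfolding f_def split_beta by measurable
  qed
  have inner: "(\<integral>\<^sup>+y. f k i x y \<partial>M) = ennreal (1 - u k (\<tau> k i x))" for k i x
  proof -
    have "(\<integral>\<^sup>+y. f k i x y \<partial>M) = (\<integral>\<^sup>+y. (if cand k i y then ennreal (g1 k (\<tau> k i x)) else ennreal (g0 k (\<tau> k i x))) \<partial>M)"
      by (intro nn_integral_cong) (simp add: f_def)
    also have "\<dots> = ennreal (g1 k (\<tau> k i x)) * ennreal (p k) + ennreal (g0 k (\<tau> k i x)) * ennreal (1 - p k)"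
      by (subst nn_integral_if_event) (auto simp: prob_cand)
    also have "\<dots> = ennreal (1 - u k (\<tau> k i x))"
      using g1(1)[of k "\<tau> k i x"] g0(1)[of k "\<tau> k i x"] p_range[of k]
      by (simp add: ennreal_mult[symmetric] ennreal_plus[symmetric] u_def mult.commute del: ennreal_plus)
    finally show ?thesis .
  qed
  have "(\<integral>\<^sup>+x. tier_prod (\<lambda>k i. f k i x x) \<partial>M) = (\<integral>\<^sup>+x. 1 * tier_prod (\<lambda>k i. f k i x x) \<partial>M)"
    by simp
  also have "\<dots> = (\<integral>\<^sup>+x. 1 * tier_prod (\<lambda>k i. \<integral>\<^sup>+y. f k i x y \<partial>M) \<partial>M)"
  proof (rule decouple_tier_prod[where J = "range Locations" and K = cand_src])
    show "range Locations \<inter> cand_src k i = {}" for k i using cand_src_subset[of k i] by auto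
    show "f k i x y \<le> 1" for k i x y using g1 g0 by (simp add: f_def)
    show "cand_src k i \<inter> cand_src l j = {}" if "(k, i) \<noteq> (l, j)" for k i l j
      using that by (rule cand_src_disjoint)
  qed (auto intro: f_meas)
  also have "\<dots> = (\<integral>\<^sup>+x. inf_prod (\<lambda>i. ennreal (1 - u MBS (\<tau> MBS i x))) * inf_prod (\<lambda>i. ennreal (1 - u Helper (\<tau> Helper i x))) \<partial>M)"
    unfolding inner using u by (subst tier_prod_split) (auto simp: UNIV_tier)
  also have "\<dots> = (\<integral>\<^sup>+x. \<integral>\<^sup>+y. inf_prod (\<lambda>i. ennreal (1 - u MBS (\<tau> MBS i x))) * inf_prod (\<lambda>i. ennreal (1 - u Helper (\<tau> Helper i y))) \<partial>M \<partial>M)"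
  proof (rule decouple[where J = "{Locations MBS}" and K = "{Locations Helper}"])
    note [measurable] = \<tau>_gen[of MBS] \<tau>_gen[of Helper]
    show "(\<lambda>(x, y). inf_prod (\<lambda>i. ennreal (1 - u MBS (\<tau> MBS i x))) * inf_prod (\<lambda>i. ennreal (1 - u Helper (\<tau> Helper i y))))
        \<in> borel_measurable (gen {Locations MBS} \<Otimes>\<^sub>M gen {Locations Helper})"
      unfolding split_beta by measurable
  qed auto
  also have "\<dots> = ennreal (exp (- (w MBS * I MBS))) * ennreal (exp (- (w Helper * I Helper)))"
    using I u by (simp add: nn_integral_cmult nn_integral_multc P.generating_functional[of "u k" "I k" k for k] u_def[symmetric])
  also have "\<dots> = ennreal (exp (- (\<Sum>k\<in>UNIV. w k * I k)))"
    by (simp add: UNIV_tier ennreal_mult'[symmetric] exp_add[symmetric])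
  finally show ?thesis by (simp add: f_def)
qed

lemma fad_pathloss_laplace:
  assumes "0 \<le> \<delta>" "0 \<le> t" "0 \<le> s"
  shows "(\<integral>\<^sup>+y. ennreal (exp (- (\<delta> * t powr a * (fad k i y * s powr (- a))))) \<partial>M) =
    ennreal (path_factor \<delta> a t s)"
proof -
  have eq: "\<delta> * t powr a * (h * s powr (- a)) = \<delta> * (t / s) powr a * h" for h
    using assms by (simp add: powr_divide powr_minus_divide)
  show ?thesis
    unfolding eq path_factor_def using assms by (intro fad_laplace) auto
qed

text \<open>By the generating functional, \<open>E exp (- t\<^sup>a \<Sum> h \<tau>\<^sup>-\<^sup>a)\<close> tends to 1 as \<open>t\<close> tends to 0,
  which excludes a divergent sum.\<close>

lemma received_power_summable: "AE x in M. \<forall>k. summable (\<lambda>i. fad k i x * \<tau> k i x powr (- a))"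
proof -
  have "AE x in M. summable (\<lambda>i. fad k i x * \<tau> k i x powr (- a))" for k
  proof -
    define S where "S N x = (\<Sum>i<N. fad k i x * \<tau> k i x powr (- a))" for N x
    have [measurable]: "S N \<in> borel_measurable M" for N unfolding S_def by measurable
    define B where "B = {x \<in> space M. \<exists>C::nat. \<forall>N. S N x \<le> real C}"
    have [measurable]: "B \<in> events" unfolding B_def by measurable
    define L where "L t x = inf_prod (\<lambda>i. ennreal (exp (- (1 * t powr a * (fad k i x * \<tau> k i x powr (- a))))))" for t x
    have L_le: "L t x \<le> indicator B x" if t: "0 < t" and x: "x \<in> space M" for t x
    proof -
      show ?thesis
      proof (cases "L t x = 0")
        case False
        moreover have "L t x \<le> 1" unfolding L_def by (rule inf_prod_le_1)
        ultimately obtain c where c: "0 < c" "L t x = ennreal c"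
          by (cases "L t x") (auto simp: top_unique)
        \<comment> \<open>A positive infinite product bounds all partial sums through its logarithm;
          if they are unbounded, the product is 0.\<close>
        have "S N x \<le> - ln c / t powr a" for N
        proof -
          have "L t x \<le> (\<Prod>i<N. ennreal (exp (- (1 * t powr a * (fad k i x * \<tau> k i x powr (- a))))))"
            unfolding L_def by (rule inf_prod_le_partial)
          also have "\<dots> = ennreal (exp (- (t powr a * S N x)))"
            by (simp add: prod_ennreal exp_sum[symmetric] S_def sum_negf sum_distrib_left)
          finally have "c \<le> exp (- (t powr a * S N x))" by (simp add: c)
          then have "ln c \<le> ln (exp (- (t powr a * S N x)))" using c(1) by (subst ln_le_cancel_iff) auto
          then have "ln c \<le> - (t powr a * S N x)" by simp
          then show ?thesis using t by (simp add: field_simps)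
        qed
        then have "\<forall>N. S N x \<le> real (nat \<lceil>- ln c / t powr a\<rceil>)"
          using order_trans[OF _ real_nat_ceiling_ge] by blast
        then have "x \<in> B" unfolding B_def using x by blast
        then show ?thesis unfolding L_def by (simp add: inf_prod_le_1)
      qed simp
    qed
    have int_L: "(\<integral>\<^sup>+x. L t x \<partial>M) = ennreal (exp (- (w k * (t * H_fun 1 (2 * a)))))" if t: "0 < t" for t
    proof -
      \<comment> \<open>Trivial factors in the other tier reduce the decoupling of both tiers to
        tier \<open>k\<close>.\<close>
      define f where "f l i x y = (if l = k then ennreal (exp (- (1 * t powr a * (fad k i y * \<tau> k i x powr (- a))))) else 1)" for l i x y
      have f_le: "f l i x y \<le> 1" for l i x y
        using fad_nonneg by (simp add: f_def)
      have "(\<integral>\<^sup>+x. 1 * tier_prod (\<lambda>l i. f l i x x) \<partial>M) = (\<integral>\<^sup>+x. 1 * tier_prod (\<lambda>l i. \<integral>\<^sup>+y. f l i x y \<partial>M) \<partial>M)"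
      proof (rule decouple_tier_prod[where J = "{Locations k}" and K = "\<lambda>l i. {Fading l i}"])
        note [measurable] = \<tau>_gen[of k] fad_gen
        show "(\<lambda>(x, y). f l i x y) \<in> borel_measurable (gen {Locations k} \<Otimes>\<^sub>M gen {Fading l i})" for l i
          unfolding f_def split_beta by (cases "l = k") simp_all
      qed (auto simp: f_le)
      moreover have "tier_prod (\<lambda>l i. f l i x x) = L t x" for x
        using f_le by (subst tier_prod_split) (cases k; auto simp: UNIV_tier f_def L_def inf_prod_def)+
      moreover have "tier_prod (\<lambda>l i. \<integral>\<^sup>+y. f l i x y \<partial>M) = inf_prod (\<lambda>i. ennreal (1 - (1 - path_factor 1 a t (\<tau> k i x))))" for x
      proof -
        have "(\<integral>\<^sup>+y. f l i x y \<partial>M) = (if l = k then ennreal (path_factor 1 a t (\<tau> k i x)) else 1)" for l i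
          using fad_pathloss_laplace[of 1 t "\<tau> k i x" k i] t P.point_nonneg[of k i x]
          by (simp add: f_def emeasure_space_1)
        then show ?thesis
          using path_factor_range[of 1 a t]
          by (subst tier_prod_split) (cases k; auto simp: UNIV_tier inf_prod_def)+
      qed
      ultimately have "(\<integral>\<^sup>+x. L t x \<partial>M) = (\<integral>\<^sup>+x. inf_prod (\<lambda>i. ennreal (1 - (1 - path_factor 1 a t (\<tau> k i x)))) \<partial>M)"
        by simp
      also have "\<dots> = ennreal (exp (- (w k * (t * H_fun 1 (2 * a)))))"
      proof (rule P.generating_functional)
        show "0 \<le> 1 - path_factor 1 a t s" "1 - path_factor 1 a t s \<le> 1" for s
          using path_factor_range[of 1 a t s] by auto
      qed (use nn_integral_path_factor[OF a _ t, of 1] H_fun_nonneg[OF a, of 1] t in auto)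
      finally show ?thesis .
    qed
    have low: "exp (- (w k * (t * H_fun 1 (2 * a)))) \<le> prob B" if t: "0 < t" for t
    proof -
      have "ennreal (exp (- (w k * (t * H_fun 1 (2 * a))))) \<le> (\<integral>\<^sup>+x. indicator B x \<partial>M)"
        unfolding int_L[OF t, symmetric] using L_le[OF t] by (rule nn_integral_mono)
      then show ?thesis by (simp add: emeasure_eq_measure)
    qed
    have "exp (- (w k * (1 / real (Suc n) * H_fun 1 (2 * a)))) \<le> prob B" for n
      by (rule low) simp
    moreover have "(\<lambda>n. exp (- (w k * (1 / real (Suc n) * H_fun 1 (2 * a))))) \<longlonglongrightarrow> exp (- (w k * (0 * H_fun 1 (2 * a))))"
      by (intro tendsto_intros LIMSEQ_Suc[OF lim_1_over_n])
    ultimately have "1 \<le> prob B"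
      by (intro LIMSEQ_le_const2[where X = "\<lambda>n. exp (- (w k * (1 / real (Suc n) * H_fun 1 (2 * a))))"]) auto
    then have "prob B = 1" by (simp add: antisym)
    then have "AE x in M. x \<in> B" by (simp add: prob_eq_1)
    then show ?thesis
    proof eventually_elim
      case (elim x)
      then obtain C :: nat where "\<forall>N. S N x \<le> real C" unfolding B_def by blast
      then show ?case
        using fad_nonneg unfolding S_def by (intro summableI_nonneg_bounded[where x = "real C"]) auto
    qed
  qed
  then show ?thesis by (simp add: AE_all_countable)
qed

section \<open>Coverage by a fixed base station\<close>

text \<open>The sources that determine which base station serves; they stay frozen while fadings and
  activities are averaged.\<close>

definition env :: "source set" where
  "env = range Locations \<union> range Storage"

lemma \<tau>_env [measurable]: "\<tau> k j \<in> borel_measurable (gen env)"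
  by (rule measurable_gen_mono[OF _ \<tau>_gen]) (auto simp: env_def)

lemma cand_env [measurable]: "Measurable.pred (gen env) (cand k j)"
  by (rule measurable_gen_mono[OF _ cand_gen]) (use cand_src_subset[of k j] in \<open>auto simp: env_def\<close>)

definition serving :: "tier \<Rightarrow> nat \<Rightarrow> 'a \<Rightarrow> bool" where
  "serving k j x \<longleftrightarrow> cand k j x \<and> (\<forall>l i. cand l i x \<longrightarrow> \<tau> k j x \<le> \<tau> l i x)"

definition interferer :: "tier \<Rightarrow> nat \<Rightarrow> tier \<Rightarrow> nat \<Rightarrow> 'a \<Rightarrow> real" where
  "interferer k j l i x = (if (l, i) \<noteq> (k, j) \<and> act l i x then fad l i x * \<tau> l i x powr (- a) else 0)"

definition interf :: "tier \<Rightarrow> nat \<Rightarrow> 'a \<Rightarrow> real" where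
  "interf k j x = (\<Sum>l\<in>UNIV. \<Sum>i. interferer k j l i x)"

text \<open>The SINR condition solved for the fading of the serving base station, so that the
  exponential tail can be applied to it.\<close>

definition covered :: "real \<Rightarrow> real \<Rightarrow> tier \<Rightarrow> nat \<Rightarrow> 'a set" where
  "covered \<delta> \<nu> k j =
    {x \<in> space M. serving k j x \<and> \<delta> * \<tau> k j x powr a * (interf k j x + \<nu>) \<le> fad k j x}"

lemma interferer_nonneg: "0 \<le> interferer k j l i x"
  using fad_nonneg by (simp add: interferer_def)

lemma serving_env [measurable]: "Measurable.pred (gen env) (serving k j)"
  unfolding serving_def by measurable

lemma serving_measurable [measurable]: "Measurable.pred M (serving k j)"
  by (rule measurable_gen[OF serving_env])

text \<open>The interference leaves out the serving base station and hence does not involve its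
  fading, which can be averaged separately.\<close>

lemma interf_gen: "interf k j \<in> borel_measurable (gen (UNIV - {Fading k j, Load}))"
proof -
  let ?G = "gen (UNIV - {Fading k j, Load})"
  have [measurable]: "\<tau> l i \<in> borel_measurable ?G" for l i
    by (rule measurable_gen_mono[OF _ \<tau>_gen]) auto
  have [measurable]: "Measurable.pred ?G (act l i)" for l i
    by (rule measurable_gen_mono[OF _ act_gen]) (use act_src_subset[of l i] in auto)
  have "interferer k j l i \<in> borel_measurable ?G" for l i
  proof (cases "(l, i) = (k, j)")
    case True
    then show ?thesis by (simp add: interferer_def[abs_def])
  next
    case False
    then have [measurable]: "fad l i \<in> borel_measurable ?G"
      by (intro measurable_gen_mono[OF _ fad_gen]) auto
    show ?thesis unfolding interferer_def[abs_def] by measurable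
  qed
  note [measurable] = this
  show ?thesis unfolding interf_def[abs_def] by measurable
qed

lemma covered_gen: "covered \<delta> \<nu> k j \<in> sets (gen (UNIV - {Load}))"
proof -
  let ?G = "gen (UNIV - {Load})"
  have [measurable]: "\<tau> k j \<in> borel_measurable ?G"
    by (rule measurable_gen_mono[OF _ \<tau>_gen]) auto
  have [measurable]: "fad k j \<in> borel_measurable ?G"
    by (rule measurable_gen_mono[OF _ fad_gen]) auto
  have [measurable]: "interf k j \<in> borel_measurable ?G"
    by (rule measurable_gen_mono[OF _ interf_gen]) auto
  have [measurable]: "Measurable.pred ?G (serving k j)"
    by (rule measurable_gen_mono[OF _ serving_env]) (auto simp: env_def)
  have "{x \<in> space ?G. serving k j x \<and> \<delta> * \<tau> k j x powr a * (interf k j x + \<nu>) \<le> fad k j x} \<in> sets ?G"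
    by measurable
  then show ?thesis by (simp add: covered_def)
qed

lemma covered_events [measurable]: "covered \<delta> \<nu> k j \<in> events"
  using covered_gen sets_gen_events by blast

lemma summable_interferer:
  assumes "\<forall>l. summable (\<lambda>i. fad l i x * \<tau> l i x powr (- a))"
  shows "summable (\<lambda>i. interferer k j l i x)"
proof (rule summable_comparison_test)
  show "\<exists>N. \<forall>i\<ge>N. norm (interferer k j l i x) \<le> fad l i x * \<tau> l i x powr (- a)"
    using fad_nonneg by (auto simp: interferer_def)
qed (use assms in blast)

lemma interf_nonneg:
  assumes "\<forall>l. summable (\<lambda>i. fad l i x * \<tau> l i x powr (- a))"
  shows "0 \<le> interf k j x"
  unfolding interf_def using interferer_nonneg
  by (intro sum_nonneg suminf_nonneg summable_interferer[OF assms]) auto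

text \<open>Two samples, as \<open>decouple_tier_prod\<close> requires: \<open>x\<close> carries the
  locations, \<open>y\<close> the fading and activity to be averaged.\<close>

definition interference_factor :: "real \<Rightarrow> tier \<Rightarrow> nat \<Rightarrow> tier \<Rightarrow> nat \<Rightarrow> 'a \<Rightarrow> 'a \<Rightarrow> ennreal" where
  "interference_factor \<delta> k j l i x y = (if (l, i) \<noteq> (k, j) \<and> act l i y
    then ennreal (exp (- (\<delta> * \<tau> k j x powr a * (fad l i y * \<tau> l i x powr (- a))))) else 1)"

lemma interference_factor_le_1: "0 \<le> \<delta> \<Longrightarrow> interference_factor \<delta> k j l i x y \<le> 1"
  using fad_nonneg by (simp add: interference_factor_def)

lemma exp_interf:
  assumes "0 \<le> \<delta>" "\<forall>l. summable (\<lambda>i. fad l i x * \<tau> l i x powr (- a))"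
  shows "ennreal (exp (- (\<delta> * \<tau> k j x powr a * interf k j x))) =
    tier_prod (\<lambda>l i. interference_factor \<delta> k j l i x x)"
proof (rule tier_prod_eqI[symmetric])
  define c where "c = \<delta> * \<tau> k j x powr a"
  have fac: "interference_factor \<delta> k j l i x x = ennreal (exp (- (c * interferer k j l i x)))" for l i
    by (simp add: interference_factor_def interferer_def c_def)
  have "(\<Prod>z\<in>UNIV \<times> {..<N}. interference_factor \<delta> k j (fst z) (snd z) x x) =
      ennreal (exp (- (c * (\<Sum>l\<in>UNIV. \<Sum>i<N. interferer k j l i x))))" for N
    unfolding fac sum.cartesian_product
    by (simp add: prod_ennreal exp_sum[symmetric] sum_negf sum_distrib_left split_beta)
  moreover have "(\<lambda>N. ennreal (exp (- (c * (\<Sum>l\<in>UNIV. \<Sum>i<N. interferer k j l i x)))))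
      \<longlonglongrightarrow> ennreal (exp (- (c * interf k j x)))"
    unfolding interf_def
    by (intro tendsto_ennrealI tendsto_intros summable_LIMSEQ summable_interferer assms)
  ultimately show "(\<lambda>N. \<Prod>z\<in>UNIV \<times> {..<N}. interference_factor \<delta> k j (fst z) (snd z) x x)
      \<longlonglongrightarrow> ennreal (exp (- (\<delta> * \<tau> k j x powr a * interf k j x)))"
    by (simp add: c_def)
qed (rule interference_factor_le_1, fact)

lemma nn_integral_interference_factor:
  assumes \<delta>: "0 \<le> \<delta>"
  shows "(\<integral>\<^sup>+y. interference_factor \<delta> k j l i x y \<partial>M) =
    (if (l, i) = (k, j) then 1 else ennreal (psi \<delta> l (\<tau> k j x) (\<tau> l i x)))"
proof (cases "(l, i) = (k, j)")
  case True
  then show ?thesis by (simp add: interference_factor_def emeasure_space_1)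
next
  case False
  define e where "e y = ennreal (exp (- (\<delta> * \<tau> k j x powr a * (fad l i y * \<tau> l i x powr (- a)))))" for y
  define \<phi> where "\<phi> = path_factor \<delta> a (\<tau> k j x) (\<tau> l i x)"
  have \<phi>: "0 \<le> \<phi>" using path_factor_range[OF \<delta>] by (simp add: \<phi>_def less_imp_le)
  have [measurable]: "fad l i \<in> borel_measurable (gen {Fading l i})" by (rule fad_gen)
  have e_gen [measurable]: "e \<in> borel_measurable (gen {Fading l i})" unfolding e_def by measurable
  have [measurable]: "Measurable.pred (gen (act_src l i)) (act l i)" by (rule act_gen)
  have "(\<integral>\<^sup>+y. interference_factor \<delta> k j l i x y \<partial>M) = (\<integral>\<^sup>+y. (if act l i y then e y else 1) \<partial>M)"
    using False by (intro nn_integral_cong) (auto simp: interference_factor_def e_def)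
  also have "\<dots> = (\<integral>\<^sup>+y. \<integral>\<^sup>+z. (if act l i z then e y else 1) \<partial>M \<partial>M)"
  proof (rule decouple[where J = "{Fading l i}" and K = "act_src l i"])
    show "{Fading l i} \<inter> act_src l i = {}" using act_src_subset[of l i] by auto
    show "(\<lambda>(y, z). if act l i z then e y else 1) \<in> borel_measurable (gen {Fading l i} \<Otimes>\<^sub>M gen (act_src l i))"
      unfolding split_beta by measurable
  qed
  also have "\<dots> = (\<integral>\<^sup>+y. e y * ennreal (q l) + ennreal (1 - q l) \<partial>M)"
    by (subst nn_integral_if_event) (auto simp: prob_act)
  also have "\<dots> = (\<integral>\<^sup>+y. e y \<partial>M) * ennreal (q l) + ennreal (1 - q l)"
    using measurable_gen[OF e_gen] by (subst nn_integral_add) (auto simp: nn_integral_multc emeasure_space_1)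
  also have "(\<integral>\<^sup>+y. e y \<partial>M) = ennreal \<phi>"
    unfolding e_def \<phi>_def using \<delta> P.point_nonneg by (intro fad_pathloss_laplace) auto
  also have "ennreal \<phi> * ennreal (q l) + ennreal (1 - q l) = ennreal (psi \<delta> l (\<tau> k j x) (\<tau> l i x))"
    using \<phi> q_range[of l]
    by (simp add: ennreal_mult[symmetric] ennreal_plus[symmetric] psi_def \<phi>_def[symmetric] algebra_simps
        del: ennreal_plus)
  finally show ?thesis using False by (simp only: if_False)
qed

text \<open>The fading of the serving base station is averaged first: its tail turns the event into
  the exponential of minus noise and interference. The interference part is a product over base
  stations, so given \<open>env\<close> the remaining marks average factor by factor.\<close>

lemma emeasure_covered:
  assumes \<delta>: "0 \<le> \<delta>" and \<nu>: "0 \<le> \<nu>"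
  shows "emeasure M (covered \<delta> \<nu> k j) =
    (\<integral>\<^sup>+x. (if serving k j x then ennreal (exp (- (\<delta> * \<tau> k j x powr a * \<nu>))) else 0) *
      tier_prod (\<lambda>l i. if (l, i) = (k, j) then 1 else ennreal (psi \<delta> l (\<tau> k j x) (\<tau> l i x))) \<partial>M)"
proof -
  define G where "G x = (if serving k j x then ennreal (exp (- (\<delta> * \<tau> k j x powr a * \<nu>))) else 0)" for x
  have G_le: "G x \<le> 1" for x using \<delta> \<nu> by (simp add: G_def)
  have G_gen: "G \<in> borel_measurable (gen env)" unfolding G_def by measurable
  define c where "c x = \<delta> * \<tau> k j x powr a * (interf k j x + \<nu>)" for x
  let ?H = "UNIV - {Fading k j, Load}"
  have serving_H [measurable]: "Measurable.pred (gen ?H) (serving k j)"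
    by (rule measurable_gen_mono[OF _ serving_env]) (auto simp: env_def)
  have [measurable]: "c \<in> borel_measurable (gen ?H)"
  proof -
    note [measurable] = interf_gen[of k j]
    have [measurable]: "\<tau> k j \<in> borel_measurable (gen ?H)"
      by (rule measurable_gen_mono[OF _ \<tau>_gen]) auto
    show ?thesis unfolding c_def[abs_def] by measurable
  qed
  have [measurable]: "fad k j \<in> borel_measurable (gen {Fading k j})" by (rule fad_gen)
  have "emeasure M (covered \<delta> \<nu> k j) = (\<integral>\<^sup>+x. (if serving k j x \<and> c x \<le> fad k j x then 1 else 0) \<partial>M)"
  proof -
    have "emeasure M (covered \<delta> \<nu> k j) = (\<integral>\<^sup>+x. indicator (covered \<delta> \<nu> k j) x \<partial>M)"
      by simp
    also have "\<dots> = (\<integral>\<^sup>+x. (if serving k j x \<and> c x \<le> fad k j x then 1 else 0) \<partial>M)"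
      by (intro nn_integral_cong) (auto simp: covered_def c_def indicator_def)
    finally show ?thesis .
  qed
  also have "\<dots> = (\<integral>\<^sup>+x. \<integral>\<^sup>+y. (if serving k j x \<and> c x \<le> fad k j y then 1 else 0) \<partial>M \<partial>M)"
  proof (rule decouple[where J = ?H and K = "{Fading k j}"])
    show "(\<lambda>(x, y). if serving k j x \<and> c x \<le> fad k j y then 1 else 0)
        \<in> borel_measurable (gen ?H \<Otimes>\<^sub>M gen {Fading k j})"
      unfolding split_beta by measurable
  qed auto
  also have "\<dots> = (\<integral>\<^sup>+x. G x * tier_prod (\<lambda>l i. interference_factor \<delta> k j l i x x) \<partial>M)"
  \<comment> \<open>Almost surely the series converge, so that their sums are the true interference
    and the tail formula gets a nonnegative argument.\<close>
  proof (rule nn_integral_cong_AE, use received_power_summable in eventually_elim)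
    case (elim x)
    have "0 \<le> c x" unfolding c_def using \<delta> \<nu> interf_nonneg[OF elim] by simp
    then have "(\<integral>\<^sup>+y. (if serving k j x \<and> c x \<le> fad k j y then 1 else 0) \<partial>M) =
        (if serving k j x then ennreal (exp (- c x)) else 0)"
      by (cases "serving k j x") (simp_all add: nn_integral_if_event fad_tail)
    also have "exp (- c x) = exp (- (\<delta> * \<tau> k j x powr a * \<nu>)) * exp (- (\<delta> * \<tau> k j x powr a * interf k j x))"
      by (simp add: c_def exp_add[symmetric] algebra_simps)
    finally show ?case
      using exp_interf[OF \<delta> elim] by (simp add: G_def ennreal_mult')
  qed
  also have "\<dots> = (\<integral>\<^sup>+x. G x * tier_prod (\<lambda>l i. \<integral>\<^sup>+y. interference_factor \<delta> k j l i x y \<partial>M) \<partial>M)"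
  proof (rule decouple_tier_prod[where J = env and K = "\<lambda>l i. insert (Fading l i) (act_src l i)"])
    show "env \<inter> insert (Fading l i) (act_src l i) = {}" for l i
      using act_src_subset[of l i] by (auto simp: env_def)
    show "insert (Fading l i) (act_src l i) \<inter> insert (Fading l' i') (act_src l' i') = {}"
      if "(l, i) \<noteq> (l', i')" for l i l' i'
      using act_src_disjoint[OF that] act_src_subset[of l i] act_src_subset[of l' i'] that by auto
    show "(\<lambda>(x, y). interference_factor \<delta> k j l i x y)
        \<in> borel_measurable (gen env \<Otimes>\<^sub>M gen (insert (Fading l i) (act_src l i)))" for l i
    proof -
      have [measurable]: "fad l i \<in> borel_measurable (gen (insert (Fading l i) (act_src l i)))"
        by (rule measurable_gen_mono[OF _ fad_gen]) auto
      have [measurable]: "Measurable.pred (gen (insert (Fading l i) (act_src l i))) (act l i)"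
        by (rule measurable_gen_mono[OF _ act_gen]) auto
      show ?thesis unfolding interference_factor_def split_beta by measurable
    qed
  qed (use G_gen G_le interference_factor_le_1[OF \<delta>] in auto)
  finally show ?thesis by (simp only: G_def nn_integral_interference_factor[OF \<delta>])
qed

end

context two_tier_network
begin

section \<open>The serving base station\<close>

text \<open>\<open>clear \<delta> s t\<close> is the conditional Laplace factor of the interference at distance \<open>t\<close>, on the
  event that every candidate of tier \<open>l\<close> is beyond \<open>s l\<close>.\<close>

definition clear :: "real \<Rightarrow> (tier \<Rightarrow> real) \<Rightarrow> real \<Rightarrow> 'a \<Rightarrow> ennreal" where
  "clear \<delta> s t x = tier_prod (\<lambda>l i.
    ennreal (if cand l i x then (if \<tau> l i x < s l then 0 else psi \<delta> l t (\<tau> l i x)) else psi \<delta> l t (\<tau> l i x)))"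

text \<open>Nearest candidate of its own tier only. The competition with the other tier is moved
  into \<open>others_clear\<close>, a function of the distance that is monotone and continuous from
  the left.\<close>

definition first :: "tier \<Rightarrow> nat \<Rightarrow> 'a \<Rightarrow> bool" where
  "first k j x \<longleftrightarrow> cand k j x \<and> (\<forall>i. cand k i x \<longrightarrow> \<tau> k j x \<le> \<tau> k i x)"

text \<open>The bound 0 imposes nothing on tier \<open>k\<close>, since coordinates are
  nonnegative.\<close>

definition others_clear :: "real \<Rightarrow> tier \<Rightarrow> real \<Rightarrow> 'a \<Rightarrow> ennreal" where
  "others_clear \<delta> k t = clear \<delta> ((\<lambda>_. t)(k := 0)) t"

lemma first_measurable [measurable]: "Measurable.pred M (first k j)"
  unfolding first_def by measurable

lemma clear_measurable [measurable]: "clear \<delta> s t \<in> borel_measurable M"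
  unfolding clear_def by measurable

lemma others_clear_measurable_pair [measurable]:
  "(\<lambda>z. others_clear \<delta> k (fst z) (snd z)) \<in> borel_measurable (lborel \<Otimes>\<^sub>M M)"
  unfolding others_clear_def clear_def fun_upd_apply psi_def path_factor_def by measurable

lemma others_clear_measurable_random [measurable]:
  assumes [measurable]: "T \<in> borel_measurable M"
  shows "(\<lambda>x. others_clear \<delta> k (T x) x) \<in> borel_measurable M"
  unfolding others_clear_def clear_def fun_upd_apply psi_def path_factor_def by measurable

lemma clear_le_1: "clear \<delta> s t x \<le> 1"
  unfolding clear_def by (rule tier_prod_le_1)

lemma others_clear_le_1: "others_clear \<delta> k t x \<le> 1"
  unfolding others_clear_def by (rule clear_le_1)

section \<open>Monotonicity, scaling and one-sided continuity in the distance\<close>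

lemma path_factor_antimono:
  assumes "0 \<le> \<delta>" "0 \<le> t" "t \<le> t'" "0 \<le> s"
  shows "path_factor \<delta> a t' s \<le> path_factor \<delta> a t s"
proof -
  have "(t / s) powr a \<le> (t' / s) powr a"
    using assms a by (intro powr_mono2 divide_right_mono) auto
  then have "1 + \<delta> * (t / s) powr a \<le> 1 + \<delta> * (t' / s) powr a"
    using assms(1) by (simp add: mult_left_mono)
  moreover have "0 < 1 + \<delta> * (t / s) powr a"
    using assms(1) by (intro add_pos_nonneg) auto
  ultimately show ?thesis
    unfolding path_factor_def by (simp add: frac_le)
qed

lemma psi_antimono:
  assumes "0 \<le> \<delta>" "0 \<le> t" "t \<le> t'" "0 \<le> s"
  shows "psi \<delta> l t' s \<le> psi \<delta> l t s"
  using path_factor_antimono[OF assms] q_range[of l] by (simp add: psi_def mult_left_mono)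

text \<open>Positivity of \<open>s\<close> avoids the conventional value 1 of the path factor at 0,
  which would break monotonicity.\<close>

lemma psi_mono:
  assumes "0 \<le> \<delta>" "0 \<le> t" "0 < s" "s \<le> s'"
  shows "psi \<delta> l t s \<le> psi \<delta> l t s'"
proof -
  have "(t / s') powr a \<le> (t / s) powr a"
    using assms a by (intro powr_mono2 divide_left_mono) auto
  then have "1 + \<delta> * (t / s') powr a \<le> 1 + \<delta> * (t / s) powr a"
    using assms(1) by (simp add: mult_left_mono)
  moreover have "0 < 1 + \<delta> * (t / s') powr a"
    using assms(1) by (intro add_pos_nonneg) auto
  ultimately have "path_factor \<delta> a t s \<le> path_factor \<delta> a t s'"
    unfolding path_factor_def by (simp add: frac_le)
  then show ?thesis using q_range[of l] by (simp add: psi_def mult_left_mono)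
qed

lemma psi_scale: "0 < t \<Longrightarrow> psi \<delta> l t (t * s) = psi \<delta> l 1 s"
  by (simp add: psi_def path_factor_scale)

lemma psi_diag: "0 < t \<Longrightarrow> psi \<delta> l t t = psi \<delta> l 1 1"
  using psi_scale[of t \<delta> l 1] by simp

lemma clear_split:
  assumes "0 \<le> \<delta>"
  shows "clear \<delta> s t x = (if \<exists>l i. cand l i x \<and> \<tau> l i x < s l then 0 else 1) *
    tier_prod (\<lambda>l i. ennreal (psi \<delta> l t (\<tau> l i x)))"
proof -
  have "clear \<delta> s t x = tier_prod (\<lambda>l i. (if cand l i x \<and> \<tau> l i x < s l then 0 else 1) *
      ennreal (psi \<delta> l t (\<tau> l i x)))"
    unfolding clear_def by (intro arg_cong[of _ _ tier_prod] ext) auto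
  also have "\<dots> = tier_prod (\<lambda>l i. if cand l i x \<and> \<tau> l i x < s l then 0 else 1) *
      tier_prod (\<lambda>l i. ennreal (psi \<delta> l t (\<tau> l i x)))"
    using psi_range[OF assms] by (intro tier_prod_mult) auto
  finally show ?thesis by (simp only: tier_prod_indicator)
qed

lemma ex_upd_iff:
  "(\<exists>l i. R l i \<and> \<tau> l i x < ((\<lambda>_. t)(k := s)) l) \<longleftrightarrow>
    (\<exists>i. R k i \<and> \<tau> k i x < s) \<or> (\<exists>l i. l \<noteq> k \<and> R l i \<and> \<tau> l i x < t)"
proof -
  have "(\<exists>l. Q l) \<longleftrightarrow> Q k \<or> (\<exists>l. l \<noteq> k \<and> Q l)" for Q
    by (cases "Q k") metis+
  from this[of "\<lambda>l. \<exists>i. R l i \<and> \<tau> l i x < ((\<lambda>_. t)(k := s)) l"]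
  show ?thesis by (simp cong: conj_cong)
qed

lemma others_clear_split:
  assumes "0 \<le> \<delta>"
  shows "others_clear \<delta> k t x = (if \<exists>l i. l \<noteq> k \<and> cand l i x \<and> \<tau> l i x < t then 0 else 1) *
    tier_prod (\<lambda>l i. ennreal (psi \<delta> l t (\<tau> l i x)))"
proof -
  have "\<not> (\<exists>i. cand k i x \<and> \<tau> k i x < 0)"
    using P.point_nonneg by (metis not_less)
  then show ?thesis
    unfolding others_clear_def clear_split[OF assms] ex_upd_iff by auto
qed

lemma clear_restrict:
  assumes "0 \<le> \<delta>"
  shows "clear \<delta> ((\<lambda>_. t)(k := s)) t x =
    (if \<forall>i. cand k i x \<longrightarrow> s \<le> \<tau> k i x then 1 else 0) * others_clear \<delta> k t x"
proof -
  have "(\<forall>i. cand k i x \<longrightarrow> s \<le> \<tau> k i x) \<longleftrightarrow> \<not> (\<exists>i. cand k i x \<and> \<tau> k i x < s)"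
    by (auto simp: not_less)
  then show ?thesis
    unfolding others_clear_split[OF assms] clear_split[OF assms] ex_upd_iff by auto
qed

lemma serving_iff_first:
  "serving k j x \<longleftrightarrow> first k j x \<and> \<not> (\<exists>l i. l \<noteq> k \<and> cand l i x \<and> \<tau> l i x < \<tau> k j x)"
proof
  assume "serving k j x"
  then show "first k j x \<and> \<not> (\<exists>l i. l \<noteq> k \<and> cand l i x \<and> \<tau> l i x < \<tau> k j x)"
    by (auto simp: serving_def first_def not_less)
next
  assume F: "first k j x \<and> \<not> (\<exists>l i. l \<noteq> k \<and> cand l i x \<and> \<tau> l i x < \<tau> k j x)"
  have "\<tau> k j x \<le> \<tau> l i x" if "cand l i x" for l i
  proof (cases "l = k")
    case True
    then show ?thesis using F that by (simp add: first_def)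
  next
    case False
    then show ?thesis using F that not_less by blast
  qed
  then show "serving k j x" using F by (simp add: serving_def first_def)
qed

text \<open>Absence of closer candidates in the other tier passes from the event into the product,
  where it is the zero-one factor of \<open>others_clear\<close>.\<close>

lemma serving_others_clear:
  assumes "0 \<le> \<delta>"
  shows "(if serving k j x then c else 0) * tier_prod (\<lambda>l i. ennreal (psi \<delta> l (\<tau> k j x) (\<tau> l i x))) =
    (if first k j x then c * others_clear \<delta> k (\<tau> k j x) x else 0)"
proof (cases "\<exists>l i. l \<noteq> k \<and> cand l i x \<and> \<tau> l i x < \<tau> k j x")
  case True
  then show ?thesis by (simp only: others_clear_split[OF assms] serving_iff_first) simp
next
  case False
  then show ?thesis by (simp only: others_clear_split[OF assms] serving_iff_first) simp
qed

lemma others_clear_antimono: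
  assumes "0 \<le> \<delta>" "0 \<le> t" "t \<le> t'"
  shows "others_clear \<delta> k t' x \<le> others_clear \<delta> k t x"
  unfolding others_clear_def clear_def
proof (intro tier_prod_mono ennreal_leI)
  fix l i
  show "(if cand l i x then (if \<tau> l i x < ((\<lambda>_. t')(k := 0)) l then 0 else psi \<delta> l t' (\<tau> l i x)) else psi \<delta> l t' (\<tau> l i x))
      \<le> (if cand l i x then (if \<tau> l i x < ((\<lambda>_. t)(k := 0)) l then 0 else psi \<delta> l t (\<tau> l i x)) else psi \<delta> l t (\<tau> l i x))"
    using psi_antimono[OF assms P.point_nonneg[of l i x], of l] psi_range(1)[OF assms(1), of l t "\<tau> l i x"]
      assms(3) by auto
qed

text \<open>The exclusion \<open>\<tau> < t\<close> is strict: a point below \<open>T\<close> is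
  eventually below \<open>t n\<close>, and a point at or above \<open>T\<close> never is, so each
  factor converges when \<open>t n\<close> increases to \<open>T\<close>. Monotonicity makes the
  limit an infimum, which commutes with that of the partial products.\<close>

lemma others_clear_left_continuous:
  assumes \<delta>: "0 \<le> \<delta>" and t: "incseq t" "t \<longlonglongrightarrow> T" "\<And>n. 0 < t n"
  shows "(\<lambda>n. others_clear \<delta> k (t n) x) \<longlonglongrightarrow> others_clear \<delta> k T x"
proof -
  define g where "g u l i = (if cand l i x then (if \<tau> l i x < ((\<lambda>_. u)(k := 0)) l then 0 else psi \<delta> l u (\<tau> l i x))
    else psi \<delta> l u (\<tau> l i x))" for u l i
  have Z: "others_clear \<delta> k u x = (INF N. \<Prod>i<N. \<Prod>l\<in>UNIV. ennreal (g u l i))" for u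
    by (simp add: others_clear_def clear_def tier_prod_def inf_prod_def g_def)
  have tT: "t n \<le> T" for n using t(1,2) by (rule incseq_le)
  have T: "0 < T" using t(3)[of 0] tT[of 0] by simp
  have g_nonneg: "0 \<le> g u l i" for u l i
    using psi_range(1)[OF \<delta>] by (simp add: g_def less_imp_le)
  have g_lim: "(\<lambda>n. g (t n) l i) \<longlonglongrightarrow> g T l i" for l i
  proof -
    have psi_lim: "(\<lambda>n. psi \<delta> l (t n) (\<tau> l i x)) \<longlonglongrightarrow> psi \<delta> l T (\<tau> l i x)"
    \<comment> \<open>At the coordinate 0 the factor is constantly 1 by division by zero.\<close>
    proof (cases "\<tau> l i x = 0")
      case False
      then have "T / \<tau> l i x \<noteq> 0" using T by simp
      moreover have "1 + \<delta> * (T / \<tau> l i x) powr a \<noteq> 0"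
        using \<delta> by (intro less_imp_neq[symmetric] add_pos_nonneg) auto
      ultimately show ?thesis
        unfolding psi_def path_factor_def using t(2) False
        by (intro tendsto_intros) auto
    qed (simp add: psi_def path_factor_def)
    show ?thesis
    proof (cases "cand l i x \<and> l \<noteq> k \<and> \<tau> l i x < T")
      case True
      then have "eventually (\<lambda>n. \<tau> l i x < t n) sequentially"
        using t(2) by (intro order_tendstoD) auto
      then have "eventually (\<lambda>n. g (t n) l i = g T l i) sequentially"
        by eventually_elim (use True in \<open>auto simp: g_def\<close>)
      then show ?thesis by (rule tendsto_eventually)
    next
      case False
      then have "g (t n) l i = psi \<delta> l (t n) (\<tau> l i x)" "g T l i = psi \<delta> l T (\<tau> l i x)" for n
        using P.point_nonneg[of l i x] tT[of n] by (auto simp: g_def)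
      then show ?thesis using psi_lim by simp
    qed
  qed
  have dec: "decseq (\<lambda>n. others_clear \<delta> k (t n) x)"
    using t by (auto simp: decseq_def incseq_def less_imp_le intro!: others_clear_antimono[OF \<delta>])
  have part: "(INF n. \<Prod>i<N. \<Prod>l\<in>UNIV. ennreal (g (t n) l i)) = (\<Prod>i<N. \<Prod>l\<in>UNIV. ennreal (g T l i))" for N
  proof (rule LIMSEQ_unique[OF LIMSEQ_INF])
    show "decseq (\<lambda>n. \<Prod>i<N. \<Prod>l\<in>UNIV. ennreal (g (t n) l i))"
    proof (rule decseq_SucI, intro prod_mono_ennreal ennreal_leI)
      fix n l i
      show "g (t (Suc n)) l i \<le> g (t n) l i"
        using psi_antimono[OF \<delta> less_imp_le[OF t(3)[of n]] _ P.point_nonneg[of l i x], of "t (Suc n)" l]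
          psi_range(1)[OF \<delta>, of l "t n" "\<tau> l i x"] incseq_SucD[OF t(1), of n]
        by (auto simp: g_def)
    qed
    have "(\<lambda>n. ennreal (\<Prod>i<N. \<Prod>l\<in>UNIV. g (t n) l i)) \<longlonglongrightarrow> ennreal (\<Prod>i<N. \<Prod>l\<in>UNIV. g T l i)"
      by (intro tendsto_ennrealI tendsto_prod g_lim)
    then show "(\<lambda>n. \<Prod>i<N. \<Prod>l\<in>UNIV. ennreal (g (t n) l i)) \<longlonglongrightarrow> (\<Prod>i<N. \<Prod>l\<in>UNIV. ennreal (g T l i))"
      using g_nonneg by (simp add: prod_ennreal prod_nonneg)
  qed
  have "(INF n. others_clear \<delta> k (t n) x) = others_clear \<delta> k T x"
    unfolding Z by (subst INF_commute) (simp only: part)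
  then show ?thesis using LIMSEQ_INF[OF dec] by simp
qed

text \<open>Local finiteness gives a minimum, distinctness makes it unique. The premise matters for
  a first-group request, where no helper is a candidate.\<close>

lemma unique_first:
  "AE x in M. \<forall>k. (\<exists>j. cand k j x) \<longrightarrow> (\<exists>j. 0 < \<tau> k j x \<and> first k j x \<and> (\<forall>i. first k i x \<longrightarrow> i = j))"
proof -
  have "AE x in M. (\<exists>j. cand k j x) \<longrightarrow> (\<exists>j. 0 < \<tau> k j x \<and> first k j x \<and> (\<forall>i. first k i x \<longrightarrow> i = j))" for k
    using P.locally_finite[of k] P.distinct_points[of k] P.points_positive[of k]
  proof eventually_elim
    case (elim x)
    show ?case
    proof
      assume "\<exists>j. cand k j x"
      then obtain j0 where j0: "cand k j0 x" by blast
      define A where "A = {i. cand k i x \<and> \<tau> k i x \<le> \<tau> k j0 x}"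
      have "finite A" using elim(1) by (auto simp: A_def intro: rev_finite_subset)
      moreover have "A \<noteq> {}" using j0 by (auto simp: A_def)
      ultimately obtain j where j: "j \<in> A" "\<forall>i\<in>A. \<tau> k j x \<le> \<tau> k i x"
        using ex_min_if_finite[of "(\<lambda>i. \<tau> k i x) ` A"] by (metis (no_types, lifting) arg_min_if_finite(1) arg_min_least)
      have "first k j x"
        unfolding first_def
      proof (intro conjI allI impI)
        fix i assume "cand k i x"
        then show "\<tau> k j x \<le> \<tau> k i x"
          using j by (cases "i \<in> A") (auto simp: A_def)
      qed (use j in \<open>auto simp: A_def\<close>)
      moreover have "i = j" if "first k i x" for i
        using that \<open>first k j x\<close> elim(2) unfolding first_def by (metis order_antisym)
      ultimately show "\<exists>j. 0 < \<tau> k j x \<and> first k j x \<and> (\<forall>i. first k i x \<longrightarrow> i = j)"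
        using elim(3) by blast
    qed
  qed
  then show ?thesis by (simp add: AE_all_countable)
qed

lemma suminf_first:
  fixes f :: "nat \<Rightarrow> ennreal"
  assumes "first k j x" "\<forall>i. first k i x \<longrightarrow> i = j"
  shows "(\<Sum>i. if first k i x then f i else 0) = f j"
proof -
  have "(if first k i x then f i else 0) = 0" if "i \<notin> {j}" for i
    using assms(2) that by auto
  then have "(\<Sum>i. if first k i x then f i else 0) = (\<Sum>i\<in>{j}. if first k i x then f i else 0)"
    by (intro suminf_finite) blast+
  then show ?thesis using assms(1) by simp
qed

lemma suminf_no_first:
  fixes f :: "nat \<Rightarrow> ennreal"
  assumes "\<nexists>j. cand k j x"
  shows "(\<Sum>i. if first k i x then f i else 0) = 0"
  using assms by (simp add: first_def)

section \<open>The coverage probability without noise\<close>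

text \<open>Decay rate in \<open>t\<close> of the mean of \<open>clear\<close>: \<open>p l\<close>
  for candidates nearer than \<open>t\<close>, which are forbidden; the \<open>H\<close> term for
  active non-candidates, which may be anywhere; the \<open>G\<close> term for active candidates
  beyond \<open>t\<close>.\<close>

definition rate_const :: "real \<Rightarrow> real" where
  "rate_const \<delta> = (\<Sum>l\<in>UNIV. w l * (p l + (1 - p l) * q l * H_fun \<delta> (2 * a) + p l * q l * G_fun \<delta> (2 * a)))"

lemma rate_const_pos:
  assumes "0 < \<delta>"
  shows "0 < rate_const \<delta>"
proof -
  have nonneg: "0 \<le> (1 - p l) * q l * H_fun \<delta> (2 * a) + p l * q l * G_fun \<delta> (2 * a)" for l
    using p_range[of l] q_range[of l] G_fun_nonneg[OF a assms] H_fun_nonneg[OF a assms]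
    by (intro add_nonneg_nonneg mult_nonneg_nonneg) auto
  have "0 < w MBS * (p MBS + (1 - p MBS) * q MBS * H_fun \<delta> (2 * a) + p MBS * q MBS * G_fun \<delta> (2 * a))"
    using w_pos[of MBS] nonneg[of MBS] by (intro mult_pos_pos) (auto simp: p_MBS)
  moreover have "0 \<le> w Helper * (p Helper + (1 - p Helper) * q Helper * H_fun \<delta> (2 * a) + p Helper * q Helper * G_fun \<delta> (2 * a))"
    using w_pos[of Helper] nonneg[of Helper] p_range[of Helper] by (intro mult_nonneg_nonneg) auto
  ultimately show ?thesis by (simp add: rate_const_def UNIV_tier)
qed

lemma nn_integral_clear:
  assumes \<delta>: "0 < \<delta>" and t: "0 < t" "t \<le> s"
    and \<Lambda>: "(\<integral>\<^sup>+\<sigma>. ennreal (psi \<delta> k t \<sigma>) * indicator {t..<s} \<sigma> \<partial>lborel) = ennreal \<Lambda>" "0 \<le> \<Lambda>"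
  shows "(\<integral>\<^sup>+x. clear \<delta> ((\<lambda>_. t)(k := s)) t x \<partial>M) = ennreal (exp (- (rate_const \<delta> * t + w k * (p k * \<Lambda>))))"
proof -
  define v where "v = (\<lambda>_. t)(k := s)"
  define I where "I l = t * (p l + (1 - p l) * q l * H_fun \<delta> (2 * a) + p l * q l * G_fun \<delta> (2 * a)) +
      (if l = k then p k * \<Lambda> else 0)" for l
  define g1 where "g1 l \<sigma> = (if \<sigma> < v l then 0 else psi \<delta> l t \<sigma>)" for l \<sigma>
  let ?u = "\<lambda>l \<sigma>. 1 - (p l * g1 l \<sigma> + (1 - p l) * psi \<delta> l t \<sigma>)"
  have H0: "0 \<le> H_fun \<delta> (2 * a)" and G0: "0 \<le> G_fun \<delta> (2 * a)"
    using a \<delta> by (auto intro: H_fun_nonneg G_fun_nonneg)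
  have psi: "0 \<le> psi \<delta> l t \<sigma>" "psi \<delta> l t \<sigma> \<le> 1" for l \<sigma>
    using psi_range[of \<delta> l t \<sigma>] \<delta> by (auto simp: less_imp_le)
  have pf: "0 \<le> 1 - path_factor \<delta> a t \<sigma>" for \<sigma>
    using path_factor_range[of \<delta> a t \<sigma>] \<delta> by simp
  have int: "(\<integral>\<^sup>+\<sigma>. ennreal (?u l \<sigma>) * indicator {0..} \<sigma> \<partial>lborel) = ennreal (I l)" for l
  proof -
    \<comment> \<open>Loss of the mean factor at \<open>\<sigma>\<close>. \<open>A\<close>:
      candidates nearer than \<open>t\<close>, which give 0; \<open>B\<close>: interfering
      non-candidates; \<open>C\<close>: interfering candidates beyond \<open>t\<close>;
      \<open>D\<close>: in tier \<open>k\<close> between \<open>t\<close> and \<open>s\<close> the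
      factor \<open>psi\<close> is replaced by 0, a loss of \<open>psi\<close> on top of the
      \<open>1 - psi\<close> already counted in \<open>C\<close>.\<close>
    define A B C D where "A \<sigma> = ennreal (p l) * indicator {0..<t} \<sigma>"
      and "B \<sigma> = ennreal ((1 - p l) * q l) * (ennreal (1 - path_factor \<delta> a t \<sigma>) * indicator {0..} \<sigma>)"
      and "C \<sigma> = ennreal (p l * q l) * (ennreal (1 - path_factor \<delta> a t \<sigma>) * indicator {t..} \<sigma>)"
      and "D \<sigma> = (if l = k then ennreal (p k) * (ennreal (psi \<delta> k t \<sigma>) * indicator {t..<s} \<sigma>) else 0)" for \<sigma>
    have [measurable]: "A \<in> borel_measurable lborel" "B \<in> borel_measurable lborel"
      "C \<in> borel_measurable lborel" "D \<in> borel_measurable lborel"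
      unfolding A_def[abs_def] B_def[abs_def] C_def[abs_def] D_def[abs_def] by measurable
    have "ennreal (?u l \<sigma>) * indicator {0..} \<sigma> = A \<sigma> + B \<sigma> + C \<sigma> + D \<sigma>" for \<sigma>
    proof -
      let ?\<phi> = "1 - path_factor \<delta> a t \<sigma>"
      have nn: "0 \<le> p l" "0 \<le> (1 - p l) * q l * ?\<phi>" "0 \<le> p l * q l * ?\<phi>" "0 \<le> p l * psi \<delta> l t \<sigma>"
        using p_range[of l] q_range[of l] pf[of \<sigma>] psi[of l \<sigma>] by auto
      have B: "B \<sigma> = ennreal ((1 - p l) * q l * ?\<phi>) * indicator {0..} \<sigma>"
        and C: "C \<sigma> = ennreal (p l * q l * ?\<phi>) * indicator {t..} \<sigma>"
        and D: "D \<sigma> = (if l = k then ennreal (p l * psi \<delta> l t \<sigma>) * indicator {t..<s} \<sigma> else 0)"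
        using p_range[of l] q_range[of l] pf[of \<sigma>] psi[of l \<sigma>]
        by (auto simp: B_def C_def D_def ennreal_mult mult.assoc)
      consider "\<sigma> < 0" | "0 \<le> \<sigma>" "\<sigma> < t" | "t \<le> \<sigma>" "\<sigma> < v l" | "t \<le> \<sigma>" "v l \<le> \<sigma>" by linarith
      then show ?thesis
      proof cases
        case 1
        then show ?thesis using t by (simp add: A_def B C D)
      next
        case 2
        then have "\<sigma> < v l" using t by (simp add: v_def)
        then have "?u l \<sigma> = p l + (1 - p l) * q l * ?\<phi>"
          by (simp add: g1_def psi_def algebra_simps)
        then show ?thesis using 2 nn by (simp add: A_def B C D ennreal_plus)
      next
        case 3
        then have lk: "l = k" "\<sigma> < s" by (auto simp: v_def split: if_splits)
        have "?u l \<sigma> = (1 - p l) * q l * ?\<phi> + (p l * q l * ?\<phi> + p l * psi \<delta> l t \<sigma>)"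
          using 3 by (simp add: g1_def psi_def algebra_simps)
        moreover have "0 \<le> \<sigma>" using 3 t by simp
        ultimately show ?thesis
          using 3 lk nn by (simp add: A_def B C D ennreal_plus add.assoc del: mult_nonneg_nonneg)
      next
        case 4
        then have "?u l \<sigma> = (1 - p l) * q l * ?\<phi> + p l * q l * ?\<phi>"
          by (simp add: g1_def psi_def algebra_simps)
        moreover have "0 \<le> \<sigma>" "l = k \<longrightarrow> \<not> \<sigma> < s" using 4 t by (auto simp: v_def)
        ultimately show ?thesis using 4 nn by (auto simp: A_def B C D ennreal_plus)
      qed
    qed
    then have "(\<integral>\<^sup>+\<sigma>. ennreal (?u l \<sigma>) * indicator {0..} \<sigma> \<partial>lborel) =
        (\<integral>\<^sup>+\<sigma>. A \<sigma> + B \<sigma> + C \<sigma> + D \<sigma> \<partial>lborel)"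
      by simp
    also have "\<dots> = (\<integral>\<^sup>+\<sigma>. A \<sigma> \<partial>lborel) + (\<integral>\<^sup>+\<sigma>. B \<sigma> \<partial>lborel) + (\<integral>\<^sup>+\<sigma>. C \<sigma> \<partial>lborel) + (\<integral>\<^sup>+\<sigma>. D \<sigma> \<partial>lborel)"
      by (simp add: nn_integral_add)
    also have "(\<integral>\<^sup>+\<sigma>. A \<sigma> \<partial>lborel) = ennreal (p l * t)"
      unfolding A_def using t p_range[of l] by (simp add: nn_integral_cmult_indicator ennreal_mult)
    also have "(\<integral>\<^sup>+\<sigma>. B \<sigma> \<partial>lborel) = ennreal ((1 - p l) * q l * (t * H_fun \<delta> (2 * a)))"
      unfolding B_def using p_range[of l] q_range[of l] t H0
      by (subst nn_integral_cmult) (auto simp: nn_integral_path_factor[OF a \<delta> t(1)] ennreal_mult[symmetric])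
    also have "(\<integral>\<^sup>+\<sigma>. C \<sigma> \<partial>lborel) = ennreal (p l * q l * (t * G_fun \<delta> (2 * a)))"
      unfolding C_def using p_range[of l] q_range[of l] t G0
      by (subst nn_integral_cmult) (auto simp: nn_integral_path_factor_beyond[OF a \<delta> t(1)] ennreal_mult[symmetric])
    also have "(\<integral>\<^sup>+\<sigma>. D \<sigma> \<partial>lborel) = ennreal (if l = k then p k * \<Lambda> else 0)"
      unfolding D_def using p_range[of k] \<Lambda>
      by (cases "l = k") (simp_all add: nn_integral_cmult ennreal_mult)
    also have "ennreal (p l * t) + ennreal ((1 - p l) * q l * (t * H_fun \<delta> (2 * a))) +
        ennreal (p l * q l * (t * G_fun \<delta> (2 * a))) + ennreal (if l = k then p k * \<Lambda> else 0) = ennreal (I l)"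
    proof -
      have nn: "0 \<le> p l * t" "0 \<le> (1 - p l) * q l * (t * H_fun \<delta> (2 * a))" "0 \<le> p l * q l * (t * G_fun \<delta> (2 * a))"
        "0 \<le> (if l = k then p k * \<Lambda> else 0)"
        using p_range[of l] p_range[of k] q_range[of l] t H0 G0 \<Lambda>(2) by auto
      have "I l = p l * t + (1 - p l) * q l * (t * H_fun \<delta> (2 * a)) + p l * q l * (t * G_fun \<delta> (2 * a)) +
          (if l = k then p k * \<Lambda> else 0)"
        by (simp add: I_def algebra_simps)
      then show ?thesis
        using nn by (simp only: ennreal_plus[symmetric] add_nonneg_nonneg)
    qed
    finally show ?thesis .
  qed
  have I0: "0 \<le> I l" for l
    using p_range[of l] p_range[of k] q_range[of l] t H0 G0 \<Lambda>(2)
    unfolding I_def by (intro add_nonneg_nonneg mult_nonneg_nonneg) auto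
  have "(\<integral>\<^sup>+x. clear \<delta> v t x \<partial>M) = ennreal (exp (- (\<Sum>l\<in>UNIV. w l * I l)))"
  proof -
    have [measurable]: "g1 l \<in> borel_measurable borel" for l
      unfolding g1_def[abs_def] by measurable
    have "(\<integral>\<^sup>+x. tier_prod (\<lambda>l i. ennreal (if cand l i x then g1 l (\<tau> l i x) else psi \<delta> l t (\<tau> l i x))) \<partial>M) =
        ennreal (exp (- (\<Sum>l\<in>UNIV. w l * I l)))"
      using psi by (intro environment_functional int I0) (auto simp: g1_def)
    then show ?thesis by (simp only: clear_def g1_def)
  qed
  also have "(\<Sum>l\<in>UNIV. w l * I l) = rate_const \<delta> * t + w k * (p k * \<Lambda>)"
    by (cases k) (simp_all add: I_def rate_const_def UNIV_tier algebra_simps)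
  finally show ?thesis by (simp only: v_def)
qed

section \<open>Shells \<open>t \<le> T < r t\<close> and their integral against
  \<open>dt / t\<close>\<close>

text \<open>By scaling the mass is linear in \<open>t\<close>. As \<open>psi \<delta> k 1\<close>
  increases on \<open>[1, r)\<close>, the slope lies between its end values times
  \<open>r - 1\<close>, which is precise enough as \<open>r\<close> tends to 1.\<close>

lemma shell_mass:
  assumes \<delta>: "0 < \<delta>" and r: "1 \<le> r"
  obtains L where "(r - 1) * psi \<delta> k 1 1 \<le> L" "L \<le> (r - 1) * psi \<delta> k 1 r"
    "\<And>t. 0 < t \<Longrightarrow> (\<integral>\<^sup>+\<sigma>. ennreal (psi \<delta> k t \<sigma>) * indicator {t..<r * t} \<sigma> \<partial>lborel) = ennreal (t * L)"
proof -
  define N where "N = (\<integral>\<^sup>+\<sigma>. ennreal (psi \<delta> k 1 \<sigma>) * indicator {1..<r} \<sigma> \<partial>lborel)"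
  have psi_pos: "0 \<le> psi \<delta> k 1 \<sigma>" for \<sigma> using psi_range[of \<delta> k 1 \<sigma>] \<delta> by (simp add: less_imp_le)
  have up: "N \<le> ennreal ((r - 1) * psi \<delta> k 1 r)"
  proof -
    have "N \<le> (\<integral>\<^sup>+\<sigma>. ennreal (psi \<delta> k 1 r) * indicator {1..<r} \<sigma> \<partial>lborel)"
      unfolding N_def using \<delta> by (intro nn_integral_mono) (auto simp: indicator_def intro!: ennreal_leI psi_mono)
    also have "\<dots> = ennreal ((r - 1) * psi \<delta> k 1 r)"
      using r psi_pos by (simp add: nn_integral_cmult_indicator ennreal_mult) (simp add: mult.commute)
    finally show ?thesis .
  qed
  have low: "ennreal ((r - 1) * psi \<delta> k 1 1) \<le> N"
  proof -
    have "ennreal ((r - 1) * psi \<delta> k 1 1) = (\<integral>\<^sup>+\<sigma>. ennreal (psi \<delta> k 1 1) * indicator {1..<r} \<sigma> \<partial>lborel)"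
      using r psi_pos by (simp add: nn_integral_cmult_indicator ennreal_mult) (simp add: mult.commute)
    also have "\<dots> \<le> N"
      unfolding N_def using \<delta> by (intro nn_integral_mono) (auto simp: indicator_def intro!: ennreal_leI psi_mono)
    finally show ?thesis .
  qed
  obtain L where L: "0 \<le> L" "N = ennreal L"
    using up by (cases N) (auto simp: top_unique)
  have "(\<integral>\<^sup>+\<sigma>. ennreal (psi \<delta> k t \<sigma>) * indicator {t..<r * t} \<sigma> \<partial>lborel) = ennreal (t * L)" if t: "0 < t" for t
  proof -
    have "(\<integral>\<^sup>+\<sigma>. ennreal (psi \<delta> k t \<sigma>) * indicator {t..<r * t} \<sigma> \<partial>lborel) =
        ennreal t * (\<integral>\<^sup>+\<sigma>. ennreal (psi \<delta> k t (t * \<sigma>)) * indicator {t..<r * t} (t * \<sigma>) \<partial>lborel)"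
      by (rule nn_integral_scale[OF _ t]) measurable
    also have "(\<integral>\<^sup>+\<sigma>. ennreal (psi \<delta> k t (t * \<sigma>)) * indicator {t..<r * t} (t * \<sigma>) \<partial>lborel) = N"
      unfolding N_def using t by (intro nn_integral_cong) (auto simp: psi_scale indicator_def mult.commute[of r t])
    finally show ?thesis using t L by (simp add: ennreal_mult)
  qed
  moreover have "L \<le> (r - 1) * psi \<delta> k 1 r"
    using up L r psi_pos by (simp add: ennreal_le_iff)
  moreover have "(r - 1) * psi \<delta> k 1 1 \<le> L"
    using low L by (simp add: ennreal_le_iff)
  ultimately show ?thesis using that by blast
qed

text \<open>\<open>others_clear\<close> is taken at \<open>t\<close>, not at the point: the two
  means to be subtracted have the same \<open>t\<close>, which makes the difference exact.\<close>

definition shell_sum :: "real \<Rightarrow> tier \<Rightarrow> real \<Rightarrow> real \<Rightarrow> 'a \<Rightarrow> ennreal" where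
  "shell_sum \<delta> k r t x =
    (\<Sum>j. if first k j x then (if t \<le> \<tau> k j x \<and> \<tau> k j x < r * t then others_clear \<delta> k t x else 0) else 0)"

lemma nn_integral_shell_sum:
  assumes \<delta>: "0 < \<delta>" and t: "0 < t" and r: "1 \<le> r" and L: "0 \<le> L"
    "(\<integral>\<^sup>+\<sigma>. ennreal (psi \<delta> k t \<sigma>) * indicator {t..<r * t} \<sigma> \<partial>lborel) = ennreal (t * L)"
  shows "(\<integral>\<^sup>+x. shell_sum \<delta> k r t x \<partial>M) =
    ennreal (exp (- (rate_const \<delta> * t)) - exp (- ((rate_const \<delta> + w k * p k * L) * t)))"
proof -
  have tr: "t \<le> r * t" using t r by simp
  let ?v = "\<lambda>s. (\<lambda>_. t)(k := s)"
  have [measurable]: "shell_sum \<delta> k r t \<in> borel_measurable M"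
    unfolding shell_sum_def[abs_def] others_clear_def by measurable
  have "AE x in M. clear \<delta> (?v t) t x = clear \<delta> (?v (r * t)) t x + shell_sum \<delta> k r t x"
    using unique_first
  proof eventually_elim
    case (elim x)
    show ?case
    proof (cases "\<exists>j. cand k j x")
      case False
      then have "shell_sum \<delta> k r t x = 0"
        unfolding shell_sum_def by (rule suminf_no_first)
      then show ?thesis using False \<delta> by (simp add: clear_restrict)
    next
      case True
      then obtain j where j: "first k j x" "\<forall>i. first k i x \<longrightarrow> i = j" using elim by blast
      have "(\<forall>i. cand k i x \<longrightarrow> s \<le> \<tau> k i x) \<longleftrightarrow> s \<le> \<tau> k j x" for s
        using j(1) order_trans unfolding first_def by blast
      moreover have "shell_sum \<delta> k r t x = (if t \<le> \<tau> k j x \<and> \<tau> k j x < r * t then others_clear \<delta> k t x else 0)"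
        unfolding shell_sum_def by (rule suminf_first[OF j])
      ultimately show ?thesis
        using \<delta> tr by (auto simp: clear_restrict)
    qed
  qed
  then have "(\<integral>\<^sup>+x. clear \<delta> (?v t) t x \<partial>M) = (\<integral>\<^sup>+x. clear \<delta> (?v (r * t)) t x + shell_sum \<delta> k r t x \<partial>M)"
    by (rule nn_integral_cong_AE)
  also have "\<dots> = (\<integral>\<^sup>+x. clear \<delta> (?v (r * t)) t x \<partial>M) + (\<integral>\<^sup>+x. shell_sum \<delta> k r t x \<partial>M)"
    by (rule nn_integral_add) measurable
  also have "(\<integral>\<^sup>+x. clear \<delta> (?v (r * t)) t x \<partial>M) = ennreal (exp (- ((rate_const \<delta> + w k * p k * L) * t)))"
    using nn_integral_clear[OF \<delta> t tr L(2)] L(1) t by (simp add: algebra_simps)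
  also have "(\<integral>\<^sup>+x. clear \<delta> (?v t) t x \<partial>M) = ennreal (exp (- (rate_const \<delta> * t)))"
    using nn_integral_clear[OF \<delta> t order_refl, of k 0] by simp
  finally have eq: "ennreal (exp (- (rate_const \<delta> * t))) =
      ennreal (exp (- ((rate_const \<delta> + w k * p k * L) * t))) + (\<integral>\<^sup>+x. shell_sum \<delta> k r t x \<partial>M)" .
  then have "(\<integral>\<^sup>+x. shell_sum \<delta> k r t x \<partial>M) =
      ennreal (exp (- (rate_const \<delta> * t))) - ennreal (exp (- ((rate_const \<delta> + w k * p k * L) * t)))"
    by simp
  then show ?thesis by (simp add: ennreal_minus)
qed

lemma shell_sum_measurable_pair [measurable]:
  "(\<lambda>z. shell_sum \<delta> k r (fst z) (snd z)) \<in> borel_measurable (lborel \<Otimes>\<^sub>M M)"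
  unfolding shell_sum_def by measurable

text \<open>Almost surely at most one term is nonzero, so the sum picks out the value at the nearest
  candidate without choosing its random index. For \<open>r = 1\<close> it is the quantity sought;
  \<open>r > 1\<close> arises from the upper bound on a shell.\<close>

definition first_value :: "real \<Rightarrow> tier \<Rightarrow> real \<Rightarrow> 'a \<Rightarrow> ennreal" where
  "first_value \<delta> k r x = (\<Sum>j. if first k j x then others_clear \<delta> k (\<tau> k j x / r) x else 0)"

lemma first_value_measurable [measurable]: "first_value \<delta> k r \<in> borel_measurable M"
  unfolding first_value_def[abs_def] by measurable

text \<open>Seen from \<open>T\<close>, the shell is the set of \<open>t\<close> in
  \<open>(T / r, T]\<close>. There \<open>1 / t\<close> lies between \<open>1 / T\<close> and
  \<open>r / T\<close>, and \<open>others_clear\<close> decreases; the coefficients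
  \<open>1 - 1 / r\<close> and \<open>r - 1\<close> enclose \<open>ln r\<close>.\<close>

lemma nn_integral_shell:
  assumes \<delta>: "0 \<le> \<delta>" and r: "1 < r" and T: "0 < T"
  shows "ennreal (1 - 1 / r) * others_clear \<delta> k T x \<le>
      (\<integral>\<^sup>+t. ennreal (1 / t) * indicator {0<..} t * (if t \<le> T \<and> T < r * t then others_clear \<delta> k t x else 0) \<partial>lborel)"
    and "(\<integral>\<^sup>+t. ennreal (1 / t) * indicator {0<..} t * (if t \<le> T \<and> T < r * t then others_clear \<delta> k t x else 0) \<partial>lborel)
      \<le> ennreal (r - 1) * others_clear \<delta> k (T / r) x"
proof -
  let ?f = "\<lambda>t. ennreal (1 / t) * indicator {0<..} t * (if t \<le> T \<and> T < r * t then others_clear \<delta> k t x else 0)"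
  have mem: "0 < t \<and> t \<le> T \<and> T < r * t \<longleftrightarrow> t \<in> {T / r<..T}" for t
  proof -
    have "T < r * t \<longleftrightarrow> T / r < t" using r by (simp add: divide_less_eq mult.commute)
    moreover have "0 < T / r" using r T by simp
    ultimately show ?thesis by auto
  qed
  have len: "emeasure lborel {T / r<..T} = ennreal (T - T / r)"
    using r T by (subst emeasure_lborel_Ioc) (auto simp: field_simps)
  have Tr: "0 \<le> T - T / r" using r T by (simp add: field_simps)
  have "ennreal (1 - 1 / r) * others_clear \<delta> k T x =
      (\<integral>\<^sup>+t. ennreal (1 / T) * others_clear \<delta> k T x * indicator {T / r<..T} t \<partial>lborel)"
  proof -
    have "1 - 1 / r = 1 / T * (T - T / r)" using r T by (simp add: field_simps)
    then have "ennreal (1 - 1 / r) = ennreal (1 / T * (T - T / r))" by (rule arg_cong)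
    also have "\<dots> = ennreal (1 / T) * ennreal (T - T / r)"
      by (rule ennreal_mult) (use T Tr in auto)
    finally show ?thesis
      by (subst nn_integral_cmult_indicator) (simp_all add: len mult_ac)
  qed
  also have "\<dots> \<le> (\<integral>\<^sup>+t. ?f t \<partial>lborel)"
  proof (rule nn_integral_mono)
    fix t
    show "ennreal (1 / T) * others_clear \<delta> k T x * indicator {T / r<..T} t \<le> ?f t"
    proof (cases "t \<in> {T / r<..T}")
      case True
      then have t: "0 < t" "t \<le> T" "T < r * t" using mem by blast+
      have "ennreal (1 / T) * others_clear \<delta> k T x \<le> ennreal (1 / t) * others_clear \<delta> k t x"
        using t \<delta> by (intro mult_mono ennreal_leI others_clear_antimono) (auto simp: frac_le)
      then show ?thesis using True t by simp
    qed simp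
  qed
  finally show "ennreal (1 - 1 / r) * others_clear \<delta> k T x \<le> (\<integral>\<^sup>+t. ?f t \<partial>lborel)" .
  have "(\<integral>\<^sup>+t. ?f t \<partial>lborel) \<le>
      (\<integral>\<^sup>+t. ennreal (r / T) * others_clear \<delta> k (T / r) x * indicator {T / r<..T} t \<partial>lborel)"
  proof (rule nn_integral_mono)
    fix t
    show "?f t \<le> ennreal (r / T) * others_clear \<delta> k (T / r) x * indicator {T / r<..T} t"
    proof (cases "t \<in> {T / r<..T}")
      case True
      then have t: "0 < t" "t \<le> T" "T < r * t" using mem by blast+
      have "1 / t \<le> r / T" using t T by (simp add: field_simps)
      moreover have "T / r \<le> t" "0 \<le> T / r" using t r T by (auto simp: field_simps)
      ultimately have "ennreal (1 / t) * others_clear \<delta> k t x \<le> ennreal (r / T) * others_clear \<delta> k (T / r) x"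
        using \<delta> by (intro mult_mono ennreal_leI others_clear_antimono) auto
      then show ?thesis using True t by simp
    next
      case False
      then have "\<not> (0 < t \<and> t \<le> T \<and> T < r * t)" using mem by blast
      then show ?thesis by auto
    qed
  qed
  also have "\<dots> = ennreal (r - 1) * others_clear \<delta> k (T / r) x"
  proof -
    have "r - 1 = r / T * (T - T / r)" using r T by (simp add: field_simps)
    then have "ennreal (r - 1) = ennreal (r / T * (T - T / r))" by (rule arg_cong)
    also have "\<dots> = ennreal (r / T) * ennreal (T - T / r)"
      by (rule ennreal_mult) (use T Tr r in auto)
    finally show ?thesis
      by (subst nn_integral_cmult_indicator) (simp_all add: len mult_ac)
  qed
  finally show "(\<integral>\<^sup>+t. ?f t \<partial>lborel) \<le> ennreal (r - 1) * others_clear \<delta> k (T / r) x" .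
qed

text \<open>Weighting with \<open>dt / t\<close> makes the contribution of a nearest candidate at \<open>T\<close> essentially
  \<open>others_clear \<delta> k T * ln r\<close>, whatever \<open>T\<close> is.\<close>

lemma shell_integral_bounds:
  fixes \<delta> r :: real and k :: tier
  assumes \<delta>: "0 \<le> \<delta>" and r: "1 < r"
  defines "Q \<equiv> \<integral>\<^sup>+t. ennreal (1 / t) * indicator {0<..} t * (\<integral>\<^sup>+x. shell_sum \<delta> k r t x \<partial>M) \<partial>lborel"
  shows "ennreal (1 - 1 / r) * (\<integral>\<^sup>+x. first_value \<delta> k 1 x \<partial>M) \<le> Q"
    and "Q \<le> ennreal (r - 1) * (\<integral>\<^sup>+x. first_value \<delta> k r x \<partial>M)"
proof -
  interpret LM: pair_sigma_finite lborel M ..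
  let ?g = "\<lambda>t x. ennreal (1 / t) * indicator {0<..} t * shell_sum \<delta> k r t x"
  have "Q = (\<integral>\<^sup>+t. \<integral>\<^sup>+x. ?g t x \<partial>M \<partial>lborel)"
    unfolding Q_def
  proof (intro nn_integral_cong nn_integral_cmult[symmetric])
    show "shell_sum \<delta> k r t \<in> borel_measurable M" for t
      unfolding shell_sum_def[abs_def] others_clear_def by measurable
  qed
  also have "\<dots> = (\<integral>\<^sup>+x. \<integral>\<^sup>+t. ?g t x \<partial>lborel \<partial>M)"
    by (rule LM.Fubini'[symmetric]) (simp add: split_beta)
  finally have Q: "Q = (\<integral>\<^sup>+x. \<integral>\<^sup>+t. ?g t x \<partial>lborel \<partial>M)" .
  have "AE x in M. ennreal (1 - 1 / r) * first_value \<delta> k 1 x \<le> (\<integral>\<^sup>+t. ?g t x \<partial>lborel) \<and>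
      (\<integral>\<^sup>+t. ?g t x \<partial>lborel) \<le> ennreal (r - 1) * first_value \<delta> k r x"
    using unique_first
  proof eventually_elim
    case (elim x)
    show ?case
    proof (cases "\<exists>j. cand k j x")
      case False
      then show ?thesis
        by (simp add: first_value_def shell_sum_def suminf_no_first)
    next
      case True
      then obtain j where j: "0 < \<tau> k j x" "first k j x" "\<forall>i. first k i x \<longrightarrow> i = j" using elim by blast
      show ?thesis
        using nn_integral_shell[OF \<delta> r j(1), of k x]
        by (simp add: first_value_def shell_sum_def suminf_first[OF j(2,3)])
    qed
  qed
  then have low: "AE x in M. ennreal (1 - 1 / r) * first_value \<delta> k 1 x \<le> (\<integral>\<^sup>+t. ?g t x \<partial>lborel)"
    and up: "AE x in M. (\<integral>\<^sup>+t. ?g t x \<partial>lborel) \<le> ennreal (r - 1) * first_value \<delta> k r x"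
    by auto
  show "ennreal (1 - 1 / r) * (\<integral>\<^sup>+x. first_value \<delta> k 1 x \<partial>M) \<le> Q"
    unfolding Q using nn_integral_mono_AE[OF low] by (simp add: nn_integral_cmult)
  show "Q \<le> ennreal (r - 1) * (\<integral>\<^sup>+x. first_value \<delta> k r x \<partial>M)"
    unfolding Q using nn_integral_mono_AE[OF up] by (simp add: nn_integral_cmult)
qed

text \<open>Exactly, \<open>Q\<close> is \<open>ln (1 + \<beta> L / \<kappa>)\<close> with
  \<open>\<kappa> = rate_const \<delta>\<close> and \<open>L\<close> the slope from
  \<open>shell_mass\<close>. The elementary bounds for it, and those for \<open>L\<close>, isolate
  the factor \<open>r - 1\<close> that is cancelled afterwards.\<close>

lemma shell_integral_value_bounds:
  fixes \<delta> r :: real and k :: tier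
  assumes \<delta>: "0 < \<delta>" and r: "1 < r"
  defines "Q \<equiv> \<integral>\<^sup>+t. ennreal (1 / t) * indicator {0<..} t * (\<integral>\<^sup>+x. shell_sum \<delta> k r t x \<partial>M) \<partial>lborel"
  defines "\<beta> \<equiv> w k * p k"
  shows "Q \<le> ennreal ((r - 1) * (\<beta> * psi \<delta> k 1 r / rate_const \<delta>))"
    and "ennreal ((r - 1) * (\<beta> * psi \<delta> k 1 1 / (rate_const \<delta> + \<beta> * (r - 1)))) \<le> Q"
proof -
  define \<kappa> where "\<kappa> = rate_const \<delta>"
  have \<kappa>: "0 < \<kappa>" unfolding \<kappa>_def by (rule rate_const_pos) fact
  have \<beta>: "0 \<le> \<beta>" using w_pos[of k] p_range[of k] by (simp add: \<beta>_def)
  obtain L where L: "(r - 1) * psi \<delta> k 1 1 \<le> L" "L \<le> (r - 1) * psi \<delta> k 1 r"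
    "\<And>t. 0 < t \<Longrightarrow> (\<integral>\<^sup>+\<sigma>. ennreal (psi \<delta> k t \<sigma>) * indicator {t..<r * t} \<sigma> \<partial>lborel) = ennreal (t * L)"
    using shell_mass[OF \<delta> less_imp_le[OF r], of k] by blast
  have psi: "0 < psi \<delta> k 1 s" "psi \<delta> k 1 s \<le> 1" for s using psi_range \<delta> by (auto simp: less_imp_le)
  have L0: "0 \<le> L" using L(1) psi(1)[of 1] r by (simp add: order_trans[OF _ L(1)])
  have "(r - 1) * psi \<delta> k 1 r \<le> (r - 1) * 1"
    using psi(2) r by (intro mult_left_mono) auto
  then have L1: "L \<le> r - 1" using L(2) by simp
  define b where "b = \<beta> * L"
  have b: "0 \<le> b" using \<beta> L0 by (simp add: b_def)
  have Q: "Q = (\<integral>\<^sup>+t. ennreal ((exp (- (\<kappa> * t)) - exp (- ((\<kappa> + b) * t))) / t) * indicator {0<..} t \<partial>lborel)"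
    unfolding Q_def
  proof (rule nn_integral_cong)
    fix t :: real
    show "ennreal (1 / t) * indicator {0<..} t * (\<integral>\<^sup>+x. shell_sum \<delta> k r t x \<partial>M) =
        ennreal ((exp (- (\<kappa> * t)) - exp (- ((\<kappa> + b) * t))) / t) * indicator {0<..} t"
    proof (cases "0 < t")
      case True
      have "(\<integral>\<^sup>+x. shell_sum \<delta> k r t x \<partial>M) = ennreal (exp (- (\<kappa> * t)) - exp (- ((\<kappa> + b) * t)))"
        using nn_integral_shell_sum[OF \<delta> True less_imp_le[OF r] L0 L(3)[OF True]]
        by (simp add: \<kappa>_def b_def \<beta>_def)
      moreover have "exp (- ((\<kappa> + b) * t)) \<le> exp (- (\<kappa> * t))"
        using b True by (simp add: mult_right_mono)
      ultimately show ?thesis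
        using True by (simp add: ennreal_mult[symmetric])
    qed simp
  qed
  have "Q \<le> (\<integral>\<^sup>+t. ennreal b * (ennreal (exp (- (\<kappa> * t))) * indicator {0<..} t) \<partial>lborel)"
    unfolding Q using exp_difference_bounds(1)[OF _ b, of _ \<kappa>] b
    by (intro nn_integral_mono) (auto simp: indicator_def ennreal_mult[symmetric] intro!: ennreal_leI)
  also have "\<dots> = ennreal (b / \<kappa>)"
    using b \<kappa> by (subst nn_integral_cmult) (auto simp: nn_integral_exp_minus_greaterThan ennreal_mult[symmetric])
  also have "\<dots> \<le> ennreal ((r - 1) * (\<beta> * psi \<delta> k 1 r / \<kappa>))"
  proof (rule ennreal_leI)
    have "\<beta> * L \<le> \<beta> * ((r - 1) * psi \<delta> k 1 r)" using L(2) \<beta> by (rule mult_left_mono)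
    then have "b / \<kappa> \<le> (\<beta> * ((r - 1) * psi \<delta> k 1 r)) / \<kappa>"
      unfolding b_def using \<kappa> by (intro divide_right_mono) auto
    then show "b / \<kappa> \<le> (r - 1) * (\<beta> * psi \<delta> k 1 r / \<kappa>)" by (simp add: mult_ac)
  qed
  finally show "Q \<le> ennreal ((r - 1) * (\<beta> * psi \<delta> k 1 r / rate_const \<delta>))" by (simp only: \<kappa>_def)
  have "ennreal ((r - 1) * (\<beta> * psi \<delta> k 1 1 / (\<kappa> + \<beta> * (r - 1)))) \<le> ennreal (b / (\<kappa> + b))"
  proof (rule ennreal_leI)
    have "(r - 1) * (\<beta> * psi \<delta> k 1 1 / (\<kappa> + \<beta> * (r - 1))) = (\<beta> * ((r - 1) * psi \<delta> k 1 1)) / (\<kappa> + \<beta> * (r - 1))"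
      by (simp add: mult_ac)
    also have "\<dots> \<le> b / (\<kappa> + b)"
    proof (rule frac_le)
      show "\<beta> * ((r - 1) * psi \<delta> k 1 1) \<le> b" unfolding b_def using L(1) \<beta> by (rule mult_left_mono)
      show "\<kappa> + b \<le> \<kappa> + \<beta> * (r - 1)" unfolding b_def using L1 \<beta> by (simp add: mult_left_mono)
    qed (use \<kappa> b in auto)
    finally show "(r - 1) * (\<beta> * psi \<delta> k 1 1 / (\<kappa> + \<beta> * (r - 1))) \<le> b / (\<kappa> + b)" .
  qed
  also have "\<dots> = (\<integral>\<^sup>+t. ennreal b * (ennreal (exp (- ((\<kappa> + b) * t))) * indicator {0<..} t) \<partial>lborel)"
    using b \<kappa> by (subst nn_integral_cmult) (auto simp: nn_integral_exp_minus_greaterThan ennreal_mult[symmetric])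
  also have "\<dots> \<le> Q"
    unfolding Q using exp_difference_bounds(2)[OF _ b, of _ \<kappa>] b
    by (intro nn_integral_mono) (auto simp: indicator_def ennreal_mult[symmetric] intro!: ennreal_leI)
  finally show "ennreal ((r - 1) * (\<beta> * psi \<delta> k 1 1 / (rate_const \<delta> + \<beta> * (r - 1)))) \<le> Q" by (simp only: \<kappa>_def)
qed

lemma first_value_le_1: "AE x in M. \<forall>r. first_value \<delta> k r x \<le> 1"
  using unique_first
proof eventually_elim
  case (elim x)
  show ?case
  proof (cases "\<exists>j. cand k j x")
    case False
    then show ?thesis by (simp add: first_value_def suminf_no_first)
  next
    case True
    then obtain j where j: "first k j x" "\<forall>i. first k i x \<longrightarrow> i = j" using elim by blast
    show ?thesis by (simp add: first_value_def suminf_first[OF j] others_clear_le_1)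
  qed
qed

lemma first_value_limit:
  assumes \<delta>: "0 \<le> \<delta>"
  shows "(\<lambda>n. \<integral>\<^sup>+x. first_value \<delta> k (1 + 1 / Suc n) x \<partial>M) \<longlonglongrightarrow> (\<integral>\<^sup>+x. first_value \<delta> k 1 x \<partial>M)"
proof (rule nn_integral_dominated_convergence[where w = "\<lambda>_. 1"])
  show "AE x in M. first_value \<delta> k (1 + 1 / Suc n) x \<le> 1" for n
    using first_value_le_1 by eventually_elim blast
  show "AE x in M. (\<lambda>n. first_value \<delta> k (1 + 1 / Suc n) x) \<longlonglongrightarrow> first_value \<delta> k 1 x"
    using unique_first
  proof eventually_elim
    case (elim x)
    show ?case
    proof (cases "\<exists>j. cand k j x")
      case False
      then show ?thesis by (simp add: first_value_def suminf_no_first)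
    next
      case True
      then obtain j where j: "0 < \<tau> k j x" "first k j x" "\<forall>i. first k i x \<longrightarrow> i = j" using elim by blast
      have "(\<lambda>n. others_clear \<delta> k (\<tau> k j x / (1 + 1 / Suc n)) x) \<longlonglongrightarrow> others_clear \<delta> k (\<tau> k j x) x"
      \<comment> \<open>Dividing the coordinate by a ratio that decreases to 1 approaches it from
        below.\<close>
      proof (rule others_clear_left_continuous[OF \<delta>])
        show "incseq (\<lambda>n. \<tau> k j x / (1 + 1 / real (Suc n)))"
        proof (rule incseq_SucI)
          fix n
          have "1 + 1 / real (Suc (Suc n)) \<le> 1 + 1 / real (Suc n)"
            by (intro add_left_mono divide_left_mono) auto
          moreover have "0 < 1 + 1 / real (Suc (Suc n))"
            by (intro add_pos_nonneg) auto
          ultimately show "\<tau> k j x / (1 + 1 / real (Suc n)) \<le> \<tau> k j x / (1 + 1 / real (Suc (Suc n)))"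
            using j(1) by (intro frac_le) auto
        qed
        have "(\<lambda>n. \<tau> k j x / (1 + 1 / real (Suc n))) \<longlonglongrightarrow> \<tau> k j x / (1 + 0)"
          by (intro tendsto_intros LIMSEQ_Suc[OF lim_1_over_n]) auto
        then show "(\<lambda>n. \<tau> k j x / (1 + 1 / real (Suc n))) \<longlonglongrightarrow> \<tau> k j x" by simp
        show "0 < \<tau> k j x / (1 + 1 / real (Suc n))" for n
          using j(1) by (intro divide_pos_pos add_pos_nonneg) auto
      qed
      then show ?thesis by (simp add: first_value_def suminf_first[OF j(2,3)])
    qed
  qed
qed (auto simp: emeasure_space_1)

lemma psi_tendsto: "0 \<le> \<delta> \<Longrightarrow> (\<lambda>n. psi \<delta> k 1 (1 + 1 / Suc n)) \<longlonglongrightarrow> psi \<delta> k 1 1"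
proof -
  assume \<delta>: "0 \<le> \<delta>"
  have "(\<lambda>n. psi \<delta> k 1 (1 + 1 / real (Suc n))) \<longlonglongrightarrow> psi \<delta> k 1 (1 + 0)"
    unfolding psi_def path_factor_def using \<delta>
    by (intro tendsto_intros LIMSEQ_Suc[OF lim_1_over_n]) auto
  then show ?thesis by simp
qed

text \<open>The upper and lower bounds on the same shell integral both carry the factor
  \<open>r - 1\<close>. Cancelling it bounds \<open>v 1\<close> from above and \<open>v r\<close>
  from below, and along \<open>r = 1 + 1 / (n + 1)\<close> left continuity turns the second into a
  bound for \<open>v 1\<close> as well.\<close>

lemma nn_integral_first_value:
  assumes \<delta>: "0 < \<delta>"
  shows "(\<integral>\<^sup>+x. first_value \<delta> k 1 x \<partial>M) = ennreal (w k * p k * psi \<delta> k 1 1 / rate_const \<delta>)"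
proof -
  define \<beta> where "\<beta> = w k * p k"
  define \<kappa> where "\<kappa> = rate_const \<delta>"
  define v where "v r = enn2real (\<integral>\<^sup>+x. first_value \<delta> k r x \<partial>M)" for r
  let ?up = "\<lambda>r. \<beta> * psi \<delta> k 1 r / \<kappa>" and ?low = "\<lambda>r. \<beta> * psi \<delta> k 1 1 / (\<kappa> + \<beta> * (r - 1))"
  have \<kappa>: "0 < \<kappa>" unfolding \<kappa>_def by (rule rate_const_pos) fact
  have \<beta>: "0 \<le> \<beta>" using w_pos[of k] p_range[of k] by (simp add: \<beta>_def)
  have v_le: "(\<integral>\<^sup>+x. first_value \<delta> k r x \<partial>M) \<le> 1" for r
  proof -
    have "AE x in M. first_value \<delta> k r x \<le> 1"
      using first_value_le_1 by eventually_elim blast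
    from nn_integral_mono_AE[OF this] show ?thesis by (simp add: emeasure_space_1)
  qed
  then have v: "(\<integral>\<^sup>+x. first_value \<delta> k r x \<partial>M) = ennreal (v r)" for r
    unfolding v_def using le_less_trans[OF v_le[of r]] by (subst ennreal_enn2real) auto
  have v0: "0 \<le> v r" for r by (simp add: v_def)
  have up: "v 1 \<le> r * (?up r)" and low: "?low r \<le> v r"
    if r: "1 < r" for r
  proof -
    have pos: "0 \<le> ?up r" "0 \<le> ?low r"
      using \<beta> \<kappa> r psi_range(1)[of \<delta> k 1] \<delta>
      by (auto intro!: divide_nonneg_nonneg mult_nonneg_nonneg add_nonneg_nonneg simp: less_imp_le)
    have "ennreal (1 - 1 / r) * ennreal (v 1) \<le> ennreal ((r - 1) * (?up r))"
      using order_trans[OF shell_integral_bounds(1)[OF less_imp_le[OF \<delta>] r, of k]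
          shell_integral_value_bounds(1)[OF \<delta> r, of k]]
      by (simp add: v \<beta>_def \<kappa>_def)
    then have "ennreal ((1 - 1 / r) * v 1) \<le> ennreal ((r - 1) * (?up r))"
      using r v0 by (simp add: ennreal_mult)
    moreover have "0 \<le> (r - 1) * (?up r)"
      using r pos(1) by (intro mult_nonneg_nonneg) auto
    ultimately have "(1 - 1 / r) * v 1 \<le> (r - 1) * (?up r)"
      by (simp only: ennreal_le_iff)
    then have "r * ((1 - 1 / r) * v 1) \<le> r * ((r - 1) * (?up r))"
      using r by (intro mult_left_mono) auto
    moreover have "r * ((1 - 1 / r) * v 1) = (r - 1) * v 1" using r by (simp add: field_simps)
    moreover have "r * ((r - 1) * (?up r)) = (r - 1) * (r * (?up r))"
      by (simp only: mult_ac)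
    ultimately have "(r - 1) * v 1 \<le> (r - 1) * (r * (?up r))" by (simp only:)
    then show "v 1 \<le> r * (?up r)"
      using r by (subst (asm) mult_le_cancel_left_pos) auto
    have "ennreal ((r - 1) * (?low r)) \<le> ennreal (r - 1) * ennreal (v r)"
      using order_trans[OF shell_integral_value_bounds(2)[OF \<delta> r, of k]
          shell_integral_bounds(2)[OF less_imp_le[OF \<delta>] r, of k]]
      by (simp add: v \<beta>_def \<kappa>_def)
    then have "ennreal ((r - 1) * (?low r)) \<le> ennreal ((r - 1) * v r)"
      using r v0 by (simp add: ennreal_mult)
    then have "(r - 1) * (?low r) \<le> (r - 1) * v r"
      using r v0 by (subst (asm) ennreal_le_iff) auto
    then show "?low r \<le> v r"
      using r by (subst (asm) mult_le_cancel_left_pos) auto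
  qed
  define R where "R n = 1 + 1 / real (Suc n)" for n
  have R: "1 < R n" for n by (simp add: R_def)
  have Rlim: "R \<longlonglongrightarrow> 1 + 0"
    unfolding R_def by (intro tendsto_intros LIMSEQ_Suc[OF lim_1_over_n])
  have psi_lim: "(\<lambda>n. psi \<delta> k 1 (R n)) \<longlonglongrightarrow> psi \<delta> k 1 1"
    unfolding R_def using \<delta> by (intro psi_tendsto) simp
  have vlim: "(\<lambda>n. v (R n)) \<longlonglongrightarrow> v 1"
  proof (rule tendsto_ennrealD)
    show "(\<lambda>n. ennreal (v (R n))) \<longlonglongrightarrow> ennreal (v 1)"
      unfolding v[symmetric] R_def using \<delta> by (intro first_value_limit) simp
  qed (use v0 in auto)
  have "(\<lambda>n. R n * (?up (R n))) \<longlonglongrightarrow> (1 + 0) * (\<beta> * psi \<delta> k 1 1 / \<kappa>)"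
    using \<kappa> by (intro tendsto_intros Rlim psi_lim) auto
  then have "v 1 \<le> (1 + 0) * (\<beta> * psi \<delta> k 1 1 / \<kappa>)"
    using up[OF R] by (intro LIMSEQ_le_const) auto
  moreover have "(\<lambda>n. ?low (R n)) \<longlonglongrightarrow> \<beta> * psi \<delta> k 1 1 / (\<kappa> + \<beta> * ((1 + 0) - 1))"
    using \<kappa> by (intro tendsto_intros Rlim) auto
  then have "\<beta> * psi \<delta> k 1 1 / (\<kappa> + \<beta> * ((1 + 0) - 1)) \<le> v 1"
    using low[OF R] by (intro LIMSEQ_le[OF _ vlim]) auto
  ultimately have "v 1 = \<beta> * psi \<delta> k 1 1 / \<kappa>" by simp
  then show ?thesis by (simp add: v \<beta>_def \<kappa>_def)
qed

section \<open>Coverage with noise and its limit\<close>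

definition covered_by :: "real \<Rightarrow> real \<Rightarrow> tier \<Rightarrow> 'a set" where
  "covered_by \<delta> \<nu> k = (\<Union>j. covered \<delta> \<nu> k j)"

lemma covered_by_gen: "covered_by \<delta> \<nu> k \<in> sets (gen (UNIV - {Load}))"
  unfolding covered_by_def by (intro sets.countable_UN image_subsetI covered_gen)

lemma covered_by_events [measurable]: "covered_by \<delta> \<nu> k \<in> events"
  by (rule subsetD[OF sets_gen_events covered_by_gen])

definition noisy_value :: "real \<Rightarrow> real \<Rightarrow> tier \<Rightarrow> 'a \<Rightarrow> ennreal" where
  "noisy_value \<delta> \<nu> k x = (\<Sum>j. if first k j x then
    ennreal (exp (- (\<delta> * \<tau> k j x powr a * \<nu>))) * others_clear \<delta> k (\<tau> k j x) x else 0)"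

text \<open>The product in \<open>emeasure_covered\<close> omits the serving base station. Its
  factor \<open>psi \<delta> k T T\<close> equals \<open>psi \<delta> k 1 1\<close> for every
  \<open>T > 0\<close>; multiplying by this constant completes the product and yields
  \<open>others_clear\<close>.\<close>

lemma emeasure_covered_by:
  assumes \<delta>: "0 < \<delta>" and \<nu>: "0 \<le> \<nu>"
  shows "emeasure M (covered_by \<delta> \<nu> k) * ennreal (psi \<delta> k 1 1) = (\<integral>\<^sup>+x. noisy_value \<delta> \<nu> k x \<partial>M)"
proof -
  let ?e = "\<lambda>j x. ennreal (exp (- (\<delta> * \<tau> k j x powr a * \<nu>)))"
  have term_eq: "emeasure M (covered \<delta> \<nu> k j) * ennreal (psi \<delta> k 1 1) =
      (\<integral>\<^sup>+x. (if first k j x then ?e j x * others_clear \<delta> k (\<tau> k j x) x else 0) \<partial>M)" for j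
  proof -
    let ?P = "\<lambda>x. tier_prod (\<lambda>l i. if (l, i) = (k, j) then 1 else ennreal (psi \<delta> l (\<tau> k j x) (\<tau> l i x)))"
    have [measurable]: "?P \<in> borel_measurable M"
      unfolding psi_def path_factor_def by measurable
    have "emeasure M (covered \<delta> \<nu> k j) * ennreal (psi \<delta> k 1 1) =
        (\<integral>\<^sup>+x. (if serving k j x then ?e j x else 0) * ?P x * ennreal (psi \<delta> k 1 1) \<partial>M)"
    proof -
      have "(\<lambda>x. (if serving k j x then ?e j x else 0) * ?P x) \<in> borel_measurable M" by measurable
      from nn_integral_multc[OF this, of "ennreal (psi \<delta> k 1 1)"] show ?thesis
        using \<delta> \<nu> by (simp only: emeasure_covered less_imp_le)
    qed
    also have "\<dots> = (\<integral>\<^sup>+x. (if first k j x then ?e j x * others_clear \<delta> k (\<tau> k j x) x else 0) \<partial>M)"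
    proof (rule nn_integral_cong_AE, use P.points_positive[of k] in eventually_elim)
      case (elim x)
      then have "psi \<delta> k (\<tau> k j x) (\<tau> k j x) = psi \<delta> k 1 1" by (intro psi_diag) blast
      then have "?P x * ennreal (psi \<delta> k 1 1) = tier_prod (\<lambda>l i. ennreal (psi \<delta> l (\<tau> k j x) (\<tau> l i x)))"
        using tier_prod_remove[of "\<lambda>l i. ennreal (psi \<delta> l (\<tau> k j x) (\<tau> l i x))" k j] psi_range(2) \<delta>
        by (simp add: less_imp_le)
      then show ?case
        using serving_others_clear[OF less_imp_le[OF \<delta>], of k j x "?e j x"] by (simp only: mult.assoc)
    qed
    finally show ?thesis .
  qed
  \<comment> \<open>The union over \<open>j\<close> is almost surely disjoint, because only the
    nearest candidate of tier \<open>k\<close> can be covered.\<close>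
  have "AE x in M. indicator (covered_by \<delta> \<nu> k) x = (\<Sum>j. indicator (covered \<delta> \<nu> k j) x :: ennreal)"
    using unique_first
  proof eventually_elim
    case (elim x)
    have "covered \<delta> \<nu> k i \<subseteq> {y. first k i y}" for i
      by (auto simp: covered_def serving_iff_first)
    then have sub: "indicator (covered \<delta> \<nu> k i) x = (if first k i x then indicator (covered \<delta> \<nu> k i) x else (0::ennreal))" for i
      by (auto simp: indicator_def)
    show ?case
    proof (cases "\<exists>j. cand k j x")
      case False
      then have "x \<notin> covered \<delta> \<nu> k i" for i by (auto simp: covered_def serving_def)
      then show ?thesis by (simp add: covered_by_def)
    next
      case True
      then obtain j where j: "first k j x" "\<forall>i. first k i x \<longrightarrow> i = j" using elim by blast
      have "x \<in> covered_by \<delta> \<nu> k \<longleftrightarrow> x \<in> covered \<delta> \<nu> k j"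
        using j(2) by (auto simp: covered_by_def covered_def serving_iff_first)
      moreover have "(\<Sum>i. indicator (covered \<delta> \<nu> k i) x :: ennreal) = indicator (covered \<delta> \<nu> k j) x"
        by (subst sub) (rule suminf_first[OF j])
      ultimately show ?thesis by (simp add: indicator_def)
    qed
  qed
  then have "(\<integral>\<^sup>+x. indicator (covered_by \<delta> \<nu> k) x \<partial>M) = (\<integral>\<^sup>+x. (\<Sum>j. indicator (covered \<delta> \<nu> k j) x) \<partial>M)"
    by (rule nn_integral_cong_AE)
  then have "emeasure M (covered_by \<delta> \<nu> k) = (\<Sum>j. emeasure M (covered \<delta> \<nu> k j))"
    by (simp add: nn_integral_suminf)
  then have "emeasure M (covered_by \<delta> \<nu> k) * ennreal (psi \<delta> k 1 1) =
      (\<Sum>j. \<integral>\<^sup>+x. (if first k j x then ?e j x * others_clear \<delta> k (\<tau> k j x) x else 0) \<partial>M)"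
    by (simp add: ennreal_suminf_multc[symmetric] term_eq)
  also have "\<dots> = (\<integral>\<^sup>+x. noisy_value \<delta> \<nu> k x \<partial>M)"
    unfolding noisy_value_def by (rule nn_integral_suminf[symmetric]) measurable
  finally show ?thesis .
qed

text \<open>The noise factor is at most 1 and tends to 1, so \<open>noisy_value\<close> tends to
  \<open>first_value\<close> under the bound 1; the constant \<open>psi \<delta> k 1 1\<close> then
  cancels.\<close>

lemma prob_covered_by:
  assumes \<delta>: "0 < \<delta>"
  shows "((\<lambda>\<nu>. prob (covered_by \<delta> \<nu> k)) \<longlongrightarrow> w k * p k / rate_const \<delta>) (at_right 0)"
\<comment> \<open>Dominated convergence works along sequences, here of positive noise
  powers.\<close>
proof (subst tendsto_at_iff_sequentially, intro allI impI)
  fix X :: "nat \<Rightarrow> real"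
  assume "\<forall>i. X i \<in> {0<..} - {0}" and X_lim: "X \<longlonglongrightarrow> 0"
  then have X: "0 \<le> X n" for n by (simp add: less_imp_le)
  define \<psi> where "\<psi> = psi \<delta> k 1 1"
  have \<psi>: "0 < \<psi>" unfolding \<psi>_def using psi_range(1) \<delta> by simp
  have [measurable]: "noisy_value \<delta> \<nu> k \<in> borel_measurable M" for \<nu>
    unfolding noisy_value_def[abs_def] by measurable
  have "(\<lambda>n. \<integral>\<^sup>+x. noisy_value \<delta> (X n) k x \<partial>M) \<longlonglongrightarrow> (\<integral>\<^sup>+x. first_value \<delta> k 1 x \<partial>M)"
  proof (rule nn_integral_dominated_convergence[where w = "\<lambda>_. 1"])
    have "AE x in M. (\<forall>n. noisy_value \<delta> (X n) k x \<le> 1) \<and>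
        (\<lambda>n. noisy_value \<delta> (X n) k x) \<longlonglongrightarrow> first_value \<delta> k 1 x"
      using unique_first
    proof eventually_elim
      case (elim x)
      show ?case
      proof (cases "\<exists>j. cand k j x")
        case False
        then show ?thesis by (simp add: first_value_def noisy_value_def suminf_no_first)
      next
        case True
        then obtain j where j: "first k j x" "\<forall>i. first k i x \<longrightarrow> i = j" using elim by blast
        have nv: "noisy_value \<delta> \<nu> k x = ennreal (exp (- (\<delta> * \<tau> k j x powr a * \<nu>))) * others_clear \<delta> k (\<tau> k j x) x" for \<nu>
          unfolding noisy_value_def by (rule suminf_first[OF j])
        have "noisy_value \<delta> (X n) k x \<le> 1 * 1" for n
          unfolding nv using \<delta> X by (intro mult_mono others_clear_le_1) auto
        moreover have "(\<lambda>n. noisy_value \<delta> (X n) k x) \<longlonglongrightarrow>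
            ennreal (exp (- (\<delta> * \<tau> k j x powr a * 0))) * others_clear \<delta> k (\<tau> k j x) x"
          unfolding nv using others_clear_le_1[of \<delta> k "\<tau> k j x" x]
          by (intro tendsto_mult_ennreal tendsto_ennrealI tendsto_intros X_lim) (auto simp: top_unique)
        ultimately show ?thesis by (simp add: first_value_def suminf_first[OF j])
      qed
    qed
    note both = this
    show "AE x in M. noisy_value \<delta> (X n) k x \<le> 1" for n
      using both by eventually_elim blast
    show "AE x in M. (\<lambda>n. noisy_value \<delta> (X n) k x) \<longlonglongrightarrow> first_value \<delta> k 1 x"
      using both by eventually_elim blast
  qed (auto simp: emeasure_space_1)
  then have "(\<lambda>n. ennreal (prob (covered_by \<delta> (X n) k) * \<psi>)) \<longlonglongrightarrow> ennreal (w k * p k * \<psi> / rate_const \<delta>)"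
    using \<delta> X \<psi>
    by (simp add: emeasure_covered_by[symmetric] nn_integral_first_value emeasure_eq_measure \<psi>_def[symmetric] ennreal_mult)
  then have "(\<lambda>n. prob (covered_by \<delta> (X n) k) * \<psi>) \<longlonglongrightarrow> w k * p k * \<psi> / rate_const \<delta>"
    using \<psi> w_pos[of k] p_range[of k] rate_const_pos[OF \<delta>] by (intro tendsto_ennrealD) auto
  then have "(\<lambda>n. prob (covered_by \<delta> (X n) k) * \<psi> / \<psi>) \<longlonglongrightarrow> w k * p k * \<psi> / rate_const \<delta> / \<psi>"
    using \<psi> by (intro tendsto_divide tendsto_const) auto
  then show "((\<lambda>\<nu>. prob (covered_by \<delta> \<nu> k)) \<circ> X) \<longlonglongrightarrow> w k * p k / rate_const \<delta>"
    using \<psi> by (simp add: o_def)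
qed

end

section \<open>From the plane to the half-line\<close>

text \<open>A disc of radius \<open>sqrt (c * r)\<close> has area \<open>pi * c * r\<close>, linear
  in \<open>r\<close>; half-lines generate the Borel sets.\<close>

lemma distr_norm_square:
  fixes c :: real
  assumes c: "0 < c"
  shows "distr lborel borel (\<lambda>x::real^2. (norm x)\<^sup>2 / c) = density lborel (\<lambda>r. ennreal (pi * c) * indicator {0..} r)"
proof (rule measure_eqI_generator_eq[where E = "range atMost" and \<Omega> = UNIV and A = "\<lambda>i. {..real i}"])
  fix X :: "real set" assume "X \<in> range atMost"
  then obtain r where X: "X = {..r}" by blast
  have pre: "(\<lambda>x::real^2. (norm x)\<^sup>2 / c) -` {..r} = (if 0 \<le> r then cball 0 (sqrt (c * r)) else {})"
  proof -
    have "(norm x)\<^sup>2 / c \<le> r \<longleftrightarrow> 0 \<le> r \<and> norm x \<le> sqrt (c * r)" for x :: "real^2"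
    proof
      assume le: "(norm x)\<^sup>2 / c \<le> r"
      then have "0 \<le> r" using c by (smt (verit) divide_nonneg_nonneg zero_le_power2)
      moreover have "(norm x)\<^sup>2 \<le> c * r" using le c by (simp add: divide_le_eq mult.commute)
      ultimately show "0 \<le> r \<and> norm x \<le> sqrt (c * r)" by (simp add: real_le_rsqrt)
    next
      assume "0 \<le> r \<and> norm x \<le> sqrt (c * r)"
      then have "(norm x)\<^sup>2 \<le> (sqrt (c * r))\<^sup>2" by (intro power_mono) auto
      then have "(norm x)\<^sup>2 \<le> c * r" using c \<open>0 \<le> r \<and> norm x \<le> sqrt (c * r)\<close> by simp
      then show "(norm x)\<^sup>2 / c \<le> r" using c by (simp add: divide_le_eq mult.commute)
    qed
    then show ?thesis by (auto simp: dist_norm)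
  qed
  have "emeasure (distr lborel borel (\<lambda>x::real^2. (norm x)\<^sup>2 / c)) {..r} =
      (if 0 \<le> r then ennreal (pi * (c * r)) else 0)"
    using c by (subst emeasure_distr) (auto simp: pre emeasure_cball unit_ball_vol_2)
  also have "\<dots> = emeasure (density lborel (\<lambda>r. ennreal (pi * c) * indicator {0..} r)) {..r}"
  proof -
    have "emeasure (density lborel (\<lambda>r. ennreal (pi * c) * indicator {0..} r)) {..r} =
        (\<integral>\<^sup>+x. ennreal (pi * c) * indicator {0..r} x \<partial>lborel)"
      by (subst emeasure_density) (auto intro!: nn_integral_cong simp: indicator_def)
    also have "\<dots> = ennreal (pi * c) * emeasure lborel {0..r}"
      by (rule nn_integral_cmult_indicator) auto
    finally show ?thesis using c by (auto simp: ennreal_mult[symmetric] mult.assoc)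
  qed
  finally show "emeasure (distr lborel borel (\<lambda>x::real^2. (norm x)\<^sup>2 / c)) X =
      emeasure (density lborel (\<lambda>r. ennreal (pi * c) * indicator {0..} r)) X"
    unfolding X .
next
  show "Int_stable (range (atMost :: real \<Rightarrow> real set))"
    by (auto simp: Int_stable_def)
  show "(\<Union>i. {..real i}) = UNIV" using real_arch_simple by auto
  show "emeasure (distr lborel borel (\<lambda>x::real^2. (norm x)\<^sup>2 / c)) {..real i} \<noteq> \<infinity>" for i
  proof -
    have "(\<lambda>x::real^2. (norm x)\<^sup>2 / c) -` {..real i} \<subseteq> cball 0 (sqrt (c * i))"
      using c by (auto simp: dist_norm divide_le_eq mult.commute real_le_rsqrt)
    then have "emeasure lborel ((\<lambda>x::real^2. (norm x)\<^sup>2 / c) -` {..real i}) \<le> emeasure lborel (cball (0::real^2) (sqrt (c * i)))"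
      by (intro emeasure_mono) auto
    then show ?thesis
      using c by (subst emeasure_distr) (auto simp: emeasure_cball top_unique)
  qed
qed (auto simp: borel_eq_atMost)

lemma measure_norm_square:
  fixes B :: "real set"
  assumes c: "0 < c" and B: "B \<in> sets borel"
  shows "measure lborel {x::real^2. (norm x)\<^sup>2 / c \<in> B} = pi * c * measure lborel (B \<inter> {0..})"
proof -
  have "emeasure lborel {x::real^2. (norm x)\<^sup>2 / c \<in> B} = emeasure (distr lborel borel (\<lambda>x::real^2. (norm x)\<^sup>2 / c)) B"
    using B by (subst emeasure_distr) (auto simp: vimage_def)
  also have "\<dots> = (\<integral>\<^sup>+x. ennreal (pi * c) * indicator (B \<inter> {0..}) x \<partial>lborel)"
    unfolding distr_norm_square[OF c]
    using B by (subst emeasure_density) (auto intro!: nn_integral_cong simp: indicator_def)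
  also have "\<dots> = ennreal (pi * c) * emeasure lborel (B \<inter> {0..})"
    using B by (intro nn_integral_cmult_indicator) auto
  finally show ?thesis using c by (simp add: measure_def enn2real_mult)
qed

lemma norm_square_vimage_borel:
  fixes c :: real
  assumes "B \<in> sets borel"
  shows "{x::real^2. (norm x)\<^sup>2 / c \<in> B} \<in> sets borel"
proof -
  have "(\<lambda>x::real^2. (norm x)\<^sup>2 / c) -` B \<inter> space borel \<in> sets borel"
    by (rule measurable_sets[OF _ assms]) measurable
  then show ?thesis by (simp add: vimage_def)
qed

lemma norm_square_vimage_bounded:
  fixes c :: real
  assumes c: "0 < c" and "bounded B"
  shows "bounded {x::real^2. (norm x)\<^sup>2 / c \<in> B}"
proof -
  obtain b where b: "\<And>y. y \<in> B \<Longrightarrow> \<bar>y\<bar> \<le> b"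
    using \<open>bounded B\<close> by (auto simp: bounded_iff)
  have "norm x \<le> sqrt (b * c)" if "(norm x)\<^sup>2 / c \<in> B" for x :: "real^2"
  proof -
    have "(norm x)\<^sup>2 / c \<le> b" using b[OF that] by (rule order_trans[OF abs_ge_self])
    then have "(norm x)\<^sup>2 \<le> b * c" using c by (simp add: divide_le_eq)
    then show ?thesis by (rule real_le_rsqrt)
  qed
  then show ?thesis unfolding bounded_iff by blast
qed

text \<open>Counts pull back along the map, and preimages of bounded disjoint Borel sets are again
  bounded, disjoint and Borel.\<close>

lemma (in prob_space) half_line_poissonI:
  fixes X :: "nat \<Rightarrow> 'a \<Rightarrow> real^2"
  assumes X: "poisson_point_process M lam X" and lam: "0 \<le> lam" and c: "0 < c"
  shows "half_line_poisson M (pi * c * lam) (\<lambda>i x. (norm (X i x))\<^sup>2 / c)"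
proof
  have [measurable]: "X i \<in> borel_measurable M" for i
    using X by (simp add: poisson_point_process_def)
  show "(\<lambda>x. (norm (X i x))\<^sup>2 / c) \<in> borel_measurable M" for i by measurable
  show "0 \<le> pi * c * lam" using c lam by simp
  show "0 \<le> (norm (X i x))\<^sup>2 / c" for i x using c by simp
  fix B :: "real set" assume B: "B \<in> sets borel" "bounded B"
  let ?C = "{x::real^2. (norm x)\<^sup>2 / c \<in> B}"
  have C: "?C \<in> sets borel" "bounded ?C"
    using B c by (auto intro: norm_square_vimage_borel norm_square_vimage_bounded)
  have spec: "(AE x in M. finite {i. X i x \<in> ?C}) \<and>
      (\<forall>m. prob {x \<in> space M. point_count X ?C x = m} =
        (lam * measure lborel ?C) ^ m / fact m * exp (- (lam * measure lborel ?C)))"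
    using X C unfolding poisson_point_process_def by blast
  then show "AE x in M. finite {i. (norm (X i x))\<^sup>2 / c \<in> B}"
    by simp
  fix m
  have "prob {x \<in> space M. point_count X ?C x = m} =
      (lam * measure lborel ?C) ^ m / fact m * exp (- (lam * measure lborel ?C))"
    using spec by blast
  moreover have "lam * measure lborel ?C = pi * c * lam * measure lborel (B \<inter> {0..})"
    using measure_norm_square[OF c B(1)] by simp
  moreover have "point_count X ?C x = card {i. (norm (X i x))\<^sup>2 / c \<in> B}" for x
    by (simp add: point_count_def)
  ultimately show "prob {x \<in> space M. card {i. (norm (X i x))\<^sup>2 / c \<in> B} = m} =
      (pi * c * lam * measure lborel (B \<inter> {0..})) ^ m / fact m * exp (- (pi * c * lam * measure lborel (B \<inter> {0..})))"
    by (simp only:)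
next
  fix B :: "nat \<Rightarrow> real set"
  assume B: "disjoint_family B" "\<And>m. B m \<in> sets borel" "\<And>m. bounded (B m)"
  define C where "C m = {x::real^2. (norm x)\<^sup>2 / c \<in> B m}" for m
  have "disjoint_family C" using B(1) by (auto simp: disjoint_family_on_def C_def)
  moreover have "C m \<in> sets borel" "bounded (C m)" for m
    unfolding C_def using B c by (auto intro: norm_square_vimage_borel norm_square_vimage_bounded)
  ultimately have "indep_vars (\<lambda>_. count_space UNIV) (\<lambda>m. point_count X (C m)) UNIV"
    using X by (simp add: poisson_point_process_def)
  then show "indep_vars (\<lambda>_. count_space UNIV) (\<lambda>m x. card {i. (norm (X i x))\<^sup>2 / c \<in> B m}) UNIV"
    by (simp add: point_count_def[abs_def] C_def)
qed

text \<open>The law has no atom, so the strict tail may be replaced by the weak one that occurs in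
  \<open>covered\<close>.\<close>

lemma (in prob_space) exponential_tail:
  assumes D: "distributed M lborel X (exponential_density 1)" and c: "0 \<le> c"
  shows "prob {x \<in> space M. c \<le> X x} = exp (- c)"
proof -
  have [measurable]: "X \<in> borel_measurable M" using D by (auto dest: distributed_measurable)
  have "emeasure M (X -` {c} \<inter> space M) = (\<integral>\<^sup>+x. ennreal (exponential_density 1 x) * indicator {c} x \<partial>lborel)"
    by (rule distributed_emeasure[OF D]) simp
  also have "\<dots> = 0"
    using AE_lborel_singleton[of c] by (subst nn_integral_0_iff_AE) (auto elim: eventually_mono simp: indicator_def)
  finally have "prob {x \<in> space M. X x = c} = 0"
    by (simp add: vimage_def Int_def emeasure_eq_measure conj_commute)
  moreover have "prob {x \<in> space M. c < X x} = exp (- c)"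
    using exponential_distributedD_gt[OF D c] by simp
  moreover have "prob ({x \<in> space M. c < X x} \<union> {x \<in> space M. X x = c}) =
      prob {x \<in> space M. c < X x} + prob {x \<in> space M. X x = c}"
    by (rule finite_measure_Union) auto
  moreover have "{x \<in> space M. c < X x} \<union> {x \<in> space M. X x = c} = {x \<in> space M. c \<le> X x}" by auto
  ultimately show ?thesis by simp
qed

lemma (in prob_space) exponential_laplace:
  assumes D: "distributed M lborel X (exponential_density 1)" and s: "0 \<le> s"
  shows "(\<integral>\<^sup>+x. ennreal (exp (- (s * X x))) \<partial>M) = ennreal (1 / (1 + s))"
proof -
  have "(\<integral>\<^sup>+x. ennreal (exp (- (s * X x))) \<partial>M) = (\<integral>\<^sup>+x. ennreal (exponential_density 1 x) * ennreal (exp (- (s * x))) \<partial>lborel)"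
    by (rule distributed_nn_integral[OF D, symmetric]) measurable
  also have "\<dots> = (\<integral>\<^sup>+x. ennreal (exp (- ((1 + s) * x))) * indicator {0..} x \<partial>lborel)"
    by (intro nn_integral_cong)
       (auto simp: exponential_density_def indicator_def ennreal_mult[symmetric] exp_add[symmetric] algebra_simps)
  also have "\<dots> = ennreal (1 / (1 + s))"
    using s by (intro nn_integral_exp_minus_atLeast) simp
  finally show ?thesis .
qed

section \<open>The cache-enabled network\<close>

text \<open>\<open>sel\<close> is the set of helpers that may serve the request: those that store the requested
  content of the second group, or none for a content of the first group.\<close>

locale cached_network =
  fixes M :: "'w measure" and par :: parameters and net :: "'w network" and n :: nat and k0 :: tier
    and sel :: "nat \<Rightarrow> 'w \<Rightarrow> bool" and p_sel :: real
  assumes valid: "valid_parameters par"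
    and model: "network_model M par net"
    and content: "n \<in> second_group par"
    and sel: "sel = stores net n \<and> p_sel = p_Lp par \<or> sel = (\<lambda>_ _. False) \<and> p_sel = 0"
begin

sublocale prob_space M
  using model by (simp add: network_model_def)

abbreviation a :: real where "a \<equiv> pathloss par / 2"

definition coord :: "tier \<Rightarrow> nat \<Rightarrow> 'w \<Rightarrow> real" where
  "coord k j x = (norm (location net k j x))\<^sup>2 / power par k powr (1 / a)"

text \<open>An exponential variable is nonnegative only almost surely, while the abstract network
  asks for it everywhere; the truncation changes a null set.\<close>

definition gain :: "tier \<Rightarrow> nat \<Rightarrow> 'w \<Rightarrow> real" where
  "gain k j x = max 0 (fading net k j x)"

fun eligible :: "tier \<Rightarrow> nat \<Rightarrow> 'w \<Rightarrow> bool" where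
  "eligible MBS j x = True"
| "eligible Helper j x = sel j x"

fun transmitting :: "tier \<Rightarrow> nat \<Rightarrow> 'w \<Rightarrow> bool" where
  "transmitting MBS j x = True"
| "transmitting Helper j x = active net j x"

fun p_elig :: "tier \<Rightarrow> real" where
  "p_elig MBS = 1"
| "p_elig Helper = p_sel"

fun p_trans :: "tier \<Rightarrow> real" where
  "p_trans MBS = 1"
| "p_trans Helper = p_active par"

text \<open>The scale of \<open>coord\<close> times the area constant \<open>pi\<close>. The latter
  is common to both tiers and cancels in every coverage probability.\<close>

definition rate_1d :: "tier \<Rightarrow> real" where
  "rate_1d k = pi * power par k powr (1 / a) * intensity par k"

lemma power_pos: "0 < power par k" and intensity_pos: "0 < intensity par k"
  and a_gt_1: "1 < a"
  using valid by (auto simp: valid_parameters_def)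

sublocale independent_sources M "source_algebra M net n k0"
proof
  show "indep_sets (source_algebra M net n k0) UNIV"
    using model content by (simp add: network_model_def)
  show "Int_stable (source_algebra M net n k0 i)" for i
    by (cases i) (simp_all add: sets.Int_stable)
qed

text \<open>Every source is already a sigma-algebra, so generating adds nothing.\<close>

lemma sets_gen_single: "sets (gen {s}) = source_algebra M net n k0 s"
proof -
  have "\<exists>N. space N = space M \<and> source_algebra M net n k0 s = sets N"
    by (cases s) (auto intro!: exI[of _ "vimage_algebra (space M) _ _"])
  then obtain N where "space N = space M" "source_algebra M net n k0 s = sets N" by blast
  then show ?thesis
    using sets.sigma_sets_eq[of N] by (simp add: sets_gen)
qed

lemma location_gen: "location net k j \<in> borel_measurable (gen {Locations k})"
proof -
  have "(\<lambda>x j. location net k j x) \<in> measurable (vimage_algebra (space M) (\<lambda>x j. location net k j x) (\<Pi>\<^sub>M j\<in>UNIV. borel))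
      (\<Pi>\<^sub>M j\<in>UNIV. borel)"
    by (rule measurable_vimage_algebra1) (auto simp: space_PiM)
  from measurable_compose[OF this measurable_component_singleton[of j]]
  have "location net k j \<in> borel_measurable (vimage_algebra (space M) (\<lambda>x j. location net k j x) (\<Pi>\<^sub>M j\<in>UNIV. borel))"
    by simp
  then show ?thesis
    by (subst measurable_cong_sets[where M' = "vimage_algebra (space M) (\<lambda>x j. location net k j x) (\<Pi>\<^sub>M j\<in>UNIV. borel)"])
       (simp_all add: sets_gen_single)
qed

lemma measurable_gen_singleI:
  assumes "source_algebra M net n k0 s = sets (vimage_algebra (space M) f N)" "space N = UNIV"
  shows "f \<in> measurable (gen {s}) N"
proof -
  have "f \<in> measurable (vimage_algebra (space M) f N) N"
    by (rule measurable_vimage_algebra1) (use assms(2) in auto)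
  then show ?thesis
    by (subst measurable_cong_sets[where M' = "vimage_algebra (space M) f N"])
       (simp_all add: sets_gen_single assms(1))
qed

lemma fading_gen: "fading net k j \<in> borel_measurable (gen {Fading k j})"
  by (rule measurable_gen_singleI) auto

lemma stores_gen: "Measurable.pred (gen {Storage j}) (stores net n j)"
  by (rule measurable_gen_singleI) auto

lemma active_gen: "Measurable.pred (gen {Activity j}) (active net j)"
  by (rule measurable_gen_singleI) auto

lemma load_gen: "load net k0 \<in> measurable (gen {Load}) (count_space UNIV)"
  by (rule measurable_gen_singleI) auto

lemma fading_distributed: "distributed M lborel (fading net k j) (exponential_density 1)"
  using model by (simp add: network_model_def)

lemma fading_measurable [measurable]: "fading net k j \<in> borel_measurable M"
  by (rule measurable_gen[OF fading_gen])

lemma AE_fading: "AE x in M. \<forall>k j. fading net k j x = gain k j x"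
proof -
  have "prob {x \<in> space M. 0 \<le> fading net k j x} = 1" for k j
    using exponential_tail[OF fading_distributed[of k j] order_refl] by simp
  then have "AE x in M. 0 \<le> fading net k j x" for k j
    by (subst (asm) prob_Collect_eq_1) auto
  then have "AE x in M. \<forall>k j. 0 \<le> fading net k j x" by (simp add: AE_all_countable)
  then show ?thesis by eventually_elim (simp add: gain_def)
qed

sublocale two_tier_network M "source_algebra M net n k0" a rate_1d p_elig p_trans coord gain eligible transmitting
proof (intro two_tier_network.intro two_tier_network_axioms.intro)
  show "independent_sources M (source_algebra M net n k0)" by (rule independent_sources_axioms)
  show "1 < a" by (rule a_gt_1)
  show "0 < rate_1d k" for k
    using power_pos[of k] intensity_pos[of k] by (simp add: rate_1d_def)
  show "half_line_poisson M (rate_1d k) (coord k)" for k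
    unfolding rate_1d_def coord_def[abs_def]
    by (rule half_line_poissonI) (use model power_pos[of k] intensity_pos[of k] in \<open>auto simp: network_model_def less_imp_le\<close>)
  show "coord k j \<in> borel_measurable (gen {Locations k})" for k j
    using location_gen[of k j] unfolding coord_def[abs_def] by measurable
  show "gain k j \<in> borel_measurable (gen {Fading k j})" for k j
    using fading_gen[of k j] unfolding gain_def[abs_def] by measurable
  show "Measurable.pred (gen (cand_src k j)) (eligible k j)" for k j
    using sel stores_gen[of j] by (cases k) (auto simp: eligible.simps[abs_def])
  show "Measurable.pred (gen (act_src k j)) (transmitting k j)" for k j
    using active_gen[of j] by (cases k) (auto simp: transmitting.simps[abs_def])
  show "0 \<le> gain k j x" for k j x by (simp add: gain_def)
  show "prob {x \<in> space M. c \<le> gain k j x} = exp (- c)" if "0 \<le> c" for k j c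
  proof (cases "c = 0")
    case True
    then show ?thesis by (simp add: gain_def prob_space)
  next
    case False
    then have "{x \<in> space M. c \<le> gain k j x} = {x \<in> space M. c \<le> fading net k j x}"
      using that by (auto simp: gain_def)
    then show ?thesis using exponential_tail[OF fading_distributed that] by simp
  qed
  show "(\<integral>\<^sup>+x. ennreal (exp (- (s * gain k j x))) \<partial>M) = ennreal (1 / (1 + s))" if "0 \<le> s" for k j s
  proof -
    have "(\<integral>\<^sup>+x. ennreal (exp (- (s * gain k j x))) \<partial>M) = (\<integral>\<^sup>+x. ennreal (exp (- (s * fading net k j x))) \<partial>M)"
      by (rule nn_integral_cong_AE, use AE_fading in eventually_elim) simp
    then show ?thesis using exponential_laplace[OF fading_distributed that] by simp
  qed
  show "prob {x \<in> space M. eligible k j x} = p_elig k" for k j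
    using sel model content by (cases k) (auto simp: network_model_def prob_space)
  show "prob {x \<in> space M. transmitting k j x} = p_trans k" for k j
    using model by (cases k) (auto simp: network_model_def prob_space)
  show "p_elig MBS = 1" by simp
qed

section \<open>Physical quantities in the rescaled coordinates\<close>

lemma coord_pathloss: "coord k j x powr (- a) = power par k * distance net k j x powr (- pathloss par)"
proof (cases "norm (location net k j x) = 0")
  \<comment> \<open>At the origin both sides are 0, since \<open>0 powr\<close> anything is
    0.\<close>
  case True
  then show ?thesis by (simp add: coord_def distance_def)
next
  case False
  then have z: "0 < norm (location net k j x)" by simp
  define z where "z = norm (location net k j x)"
  have "coord k j x powr (- a) = (z\<^sup>2) powr (- a) / (power par k powr (1 / a)) powr (- a)"
    using power_pos[of k] by (simp add: coord_def z_def powr_divide)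
  also have "(z\<^sup>2) powr (- a) = z powr (- pathloss par)"
    using z powr_powr[of z 2 "- a"] by (simp add: z_def powr_numeral)
  also have "(power par k powr (1 / a)) powr (- a) = power par k powr (- 1)"
    using a_gt_1 by (simp add: powr_powr)
  also have "z powr (- pathloss par) / power par k powr (- 1) = power par k * z powr (- pathloss par)"
    using power_pos[of k] by (simp add: powr_minus_divide)
  finally show ?thesis by (simp add: z_def distance_def)
qed

lemma received_power_coord: "received_power par net k j x = fading net k j x * coord k j x powr (- a)"
  by (simp only: received_power_def coord_pathloss mult_ac)

text \<open>Positivity cannot be dropped: a point at the origin has the least coordinate but,
  because \<open>0 powr (- a)\<close> is 0, also the least mean power.\<close>

lemma mean_power_le_iff:
  assumes "0 < coord k j x" "0 < coord l i x"
  shows "mean_power par net l i x \<le> mean_power par net k j x \<longleftrightarrow> coord k j x \<le> coord l i x"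
proof -
  have "coord l i x powr (- a) \<le> coord k j x powr (- a) \<longleftrightarrow> coord k j x \<le> coord l i x"
  proof
    assume "coord k j x \<le> coord l i x"
    then show "coord l i x powr (- a) \<le> coord k j x powr (- a)"
      using assms a_gt_1 by (intro powr_mono2') auto
  next
    assume le: "coord l i x powr (- a) \<le> coord k j x powr (- a)"
    show "coord k j x \<le> coord l i x"
    proof (rule ccontr)
      assume "\<not> coord k j x \<le> coord l i x"
      then have "coord k j x powr (- a) < coord l i x powr (- a)"
        using assms a_gt_1 by (intro powr_less_mono2_neg) auto
      then show False using le by simp
    qed
  qed
  then show ?thesis by (simp add: mean_power_def coord_pathloss)
qed

lemma interference_interf:
  assumes "\<forall>k j. fading net k j x = gain k j x"
  shows "interference par net k j x = interf k j x"
proof -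
  have received: "received_power par net l i x = gain l i x * coord l i x powr (- a)" for l i
    using assms by (simp only: received_power_coord)
  show ?thesis
    unfolding interference_def interf_def interferer_def UNIV_tier received by simp
qed

lemma threshold_pos: "0 < threshold par l"
proof -
  have "0 < real (l + 1) * target_rate par / bandwidth par"
    using valid by (simp add: valid_parameters_def)
  then show ?thesis
    using powr_less_mono[of 0 "real (l + 1) * target_rate par / bandwidth par" 2] by (simp add: threshold_def)
qed

lemma target_rate_le_rate_iff:
  assumes "0 \<le> SINR par net noise k j x"
  shows "target_rate par \<le> rate par net noise k j x \<longleftrightarrow>
    (\<exists>l. load net k x = l + 1 \<and> threshold par l \<le> SINR par net noise k j x)"
proof (cases "load net k x")
  case 0
  \<comment> \<open>A load of 0 makes the rate 0 by division by zero, which misses the positive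
    target; it therefore drops out of the sum over \<open>l + 1\<close>.\<close>
  then show ?thesis using valid by (simp add: rate_def valid_parameters_def)
next
  case (Suc l)
  have W: "0 < bandwidth par" using valid by (simp add: valid_parameters_def)
  let ?S = "SINR par net noise k j x"
  have "target_rate par \<le> rate par net noise k j x \<longleftrightarrow>
      real (l + 1) * target_rate par / bandwidth par \<le> log 2 (1 + ?S)"
    using W Suc by (simp add: rate_def field_simps)
  also have "\<dots> \<longleftrightarrow> 2 powr (real (l + 1) * target_rate par / bandwidth par) \<le> 1 + ?S"
    using assms by (intro le_log_iff) auto
  also have "\<dots> \<longleftrightarrow> threshold par l \<le> ?S" by (auto simp: threshold_def)
  finally show ?thesis using Suc by simp
qed

lemma threshold_le_SINR_iff:
  assumes fad: "\<forall>k j. fading net k j x = gain k j x"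
    and sum: "\<forall>l. summable (\<lambda>i. gain l i x * coord l i x powr (- a))"
    and pos: "0 < coord k j x" and noise: "0 < noise"
  shows "0 \<le> SINR par net noise k j x"
    and "\<delta> \<le> SINR par net noise k j x \<longleftrightarrow> \<delta> * coord k j x powr a * (interf k j x + noise) \<le> gain k j x"
proof -
  define I where "I = interf k j x + noise"
  define c where "c = coord k j x powr a"
  have I: "0 < I" using interf_nonneg[OF sum, of k j] noise by (simp add: I_def)
  have c: "0 < c" using pos by (simp add: c_def)
  have S: "SINR par net noise k j x = gain k j x / (c * I)"
    using fad interference_interf[OF fad, of k j]
    by (simp add: SINR_def received_power_coord I_def c_def powr_minus_divide)
  show "0 \<le> SINR par net noise k j x"
    using I c by (simp add: S gain_def)
  show "\<delta> \<le> SINR par net noise k j x \<longleftrightarrow> \<delta> * coord k j x powr a * (interf k j x + noise) \<le> gain k j x"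
    unfolding S I_def[symmetric] c_def[symmetric] using I c by (simp add: le_divide_eq mult.assoc)
qed

section \<open>Averaging over the load\<close>

lemma load_measurable [measurable]: "load net k0 \<in> measurable M (count_space UNIV)"
  by (rule measurable_gen[OF load_gen])

lemma active_measurable [measurable]: "Measurable.pred M (active net j)"
  by (rule measurable_gen[OF active_gen])

lemma location_measurable [measurable]: "location net k j \<in> borel_measurable M"
  by (rule measurable_gen[OF location_gen])

lemma stores_measurable [measurable]: "Measurable.pred M (stores net n j)"
  by (rule measurable_gen[OF stores_gen])

lemma rate_measurable [measurable]: "rate par net noise k0 j \<in> borel_measurable M"
  unfolding rate_def[abs_def] SINR_def interference_def received_power_def distance_def by measurable

lemma prob_load: "prob {x \<in> space M. load net k0 x = l + 1} = load_law par k0 l"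
  using model by (simp add: network_model_def)

lemma load_law_nonneg: "0 \<le> load_law par k0 l"
  unfolding prob_load[symmetric] by simp

text \<open>The terms are probabilities of disjoint events, so no estimate of the Gamma quotient is
  required.\<close>

lemma summable_load_law: "summable (load_law par k0)"
proof -
  have "(\<lambda>l. prob {x \<in> space M. load net k0 x = l + 1}) sums prob (\<Union>l. {x \<in> space M. load net k0 x = l + 1})"
    by (rule finite_measure_UNION) (auto simp: disjoint_family_on_def)
  then show ?thesis unfolding prob_load by (rule sums_summable)
qed

text \<open>The event splits according to the load, whose value fixes the SINR threshold. Coverage
  depends on all sources except \<open>Load\<close>, so each piece is a product of
  probabilities.\<close>

lemma prob_served:
  assumes [measurable]: "\<And>j. Measurable.pred M (S j)"
    and S: "AE x in M. \<forall>j. S j x \<longleftrightarrow> serving k0 j x" and noise: "0 < noise"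
  shows "prob {x \<in> space M. \<exists>j. S j x \<and> target_rate par \<le> rate par net noise k0 j x} =
    (\<Sum>l. prob (covered_by (threshold par l) noise k0) * load_law par k0 l)"
proof -
  define A where "A l = covered_by (threshold par l) noise k0 \<inter> {x \<in> space M. load net k0 x = l + 1}" for l
  have [measurable]: "A l \<in> events" for l unfolding A_def by measurable
  have "prob {x \<in> space M. \<exists>j. S j x \<and> target_rate par \<le> rate par net noise k0 j x} = prob (\<Union>l. A l)"
  proof (rule finite_measure_eq_AE)
    have "AE x in M. \<forall>k i. 0 < coord k i x"
      using P.points_positive by (subst AE_all_countable) blast
    with S AE_fading received_power_summable
    show "AE x in M. x \<in> {x \<in> space M. \<exists>j. S j x \<and> target_rate par \<le> rate par net noise k0 j x} \<longleftrightarrow> x \<in> (\<Union>l. A l)"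
      using AE_space
    proof eventually_elim
      case (elim x)
      have "target_rate par \<le> rate par net noise k0 j x \<longleftrightarrow> (\<exists>l. load net k0 x = l + 1 \<and>
          threshold par l * coord k0 j x powr a * (interf k0 j x + noise) \<le> gain k0 j x)" for j
      proof -
        have pos: "0 < coord k0 j x" using elim(4) by blast
        show ?thesis
          by (simp only: target_rate_le_rate_iff[OF threshold_le_SINR_iff(1)[OF elim(2,3) pos noise]]
              threshold_le_SINR_iff(2)[OF elim(2,3) pos noise])
      qed
      then show ?case
        using elim by (auto simp: A_def covered_by_def covered_def)
    qed
  qed measurable
  also have "\<dots> = (\<Sum>l. prob (A l))"
    by (rule sums_unique[OF finite_measure_UNION]) (auto simp: A_def disjoint_family_on_def)
  also have "(\<lambda>l. prob (A l)) = (\<lambda>l. prob (covered_by (threshold par l) noise k0) * load_law par k0 l)"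
  proof
    fix l
    have "{x \<in> space (gen {Load}). load net k0 x = l + 1} \<in> sets (gen {Load})"
      using load_gen by measurable
    then have "{x \<in> space M. load net k0 x = l + 1} \<in> sets (gen {Load})" by simp
    then show "prob (A l) = prob (covered_by (threshold par l) noise k0) * load_law par k0 l"
      unfolding A_def prob_load[symmetric] by (intro prob_decouple[OF _ covered_by_gen]) auto
  qed
  finally show ?thesis .
qed

text \<open>Each coverage probability is at most 1, so the load law dominates the series uniformly
  in the noise and Tannery's theorem exchanges limit and sum.\<close>

lemma prob_served_limit:
  assumes "\<And>j. Measurable.pred M (S j)" and "AE x in M. \<forall>j. S j x \<longleftrightarrow> serving k0 j x"
  shows "((\<lambda>noise. prob {x \<in> space M. \<exists>j. S j x \<and> target_rate par \<le> rate par net noise k0 j x}) \<longlongrightarrow>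
    (\<Sum>l. rate_1d k0 * p_elig k0 / rate_const (threshold par l) * load_law par k0 l)) (at_right 0)"
proof (rule Lim_transform_eventually)
  have lim: "((\<lambda>noise. prob (covered_by (threshold par l) noise k0) * load_law par k0 l) \<longlongrightarrow>
      rate_1d k0 * p_elig k0 / rate_const (threshold par l) * load_law par k0 l) (at_right 0)" for l
    by (intro tendsto_mult_right prob_covered_by threshold_pos)
  have bound: "norm (prob (covered_by (threshold par l) noise k0) * load_law par k0 l) \<le> load_law par k0 l" for l noise
    using load_law_nonneg[of l] by (simp add: abs_mult mult_left_le_one_le)
  show "((\<lambda>noise. \<Sum>l. prob (covered_by (threshold par l) noise k0) * load_law par k0 l) \<longlongrightarrow>
      (\<Sum>l. rate_1d k0 * p_elig k0 / rate_const (threshold par l) * load_law par k0 l)) (at_right 0)"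
    by (rule tannerys_theorem[OF lim _ summable_load_law, THEN conjunct2, THEN conjunct2])
       (auto intro!: always_eventually bound simp del: real_norm_def)
  show "eventually (\<lambda>noise. (\<Sum>l. prob (covered_by (threshold par l) noise k0) * load_law par k0 l) =
      prob {x \<in> space M. \<exists>j. S j x \<and> target_rate par \<le> rate par net noise k0 j x}) (at_right 0)"
    using prob_served[OF assms] by (auto simp: eventually_at_filter)
qed

end

section \<open>Identification of the closed forms\<close>

lemma C_Mp_limit:
  assumes valid: "valid_parameters par" and model: "network_model M par net" and content: "n \<in> second_group par"
  shows "((\<lambda>noise. C_Mp M par net noise) \<longlongrightarrow> C_Mp_lim par) (at_right 0)"
proof -
  \<comment> \<open>Without eligible helpers the serving base station is the nearest MBS. All
    helpers count as non-candidates and enter through \<open>H\<close> only. The content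
    \<open>n\<close> selects the family of sources for which independence is available.\<close>
  interpret cached_network M par net n MBS "\<lambda>_ _. False" 0
    by standard (use assms in auto)
  have meas: "Measurable.pred M (nearest_MBS net j)" for j
    unfolding nearest_MBS_def[abs_def] distance_def by measurable
  have ae: "AE x in M. \<forall>j. nearest_MBS net j x \<longleftrightarrow> serving MBS j x"
  proof (rule AE_I2, intro allI)
    fix x j
    have "coord MBS j x \<le> coord MBS i x \<longleftrightarrow> distance net MBS j x \<le> distance net MBS i x" for i
      using power_pos[of MBS] by (simp add: coord_def distance_def divide_le_cancel)
    moreover have "serving MBS j x \<longleftrightarrow> (\<forall>i. coord MBS j x \<le> coord MBS i x)"
      unfolding serving_def by (metis eligible.simps tier.exhaust)
    ultimately show "nearest_MBS net j x \<longleftrightarrow> serving MBS j x"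
      by (simp add: nearest_MBS_def)
  qed
  have "rate_1d MBS * p_elig MBS / rate_const \<delta> = inverse (G_fun \<delta> (pathloss par)
      + p_active par * (intensity par Helper / intensity par MBS)
          * (power par Helper / power par MBS) powr (2 / pathloss par) * H_fun \<delta> (pathloss par) + 1)"
    if \<delta>: "0 < \<delta>" for \<delta>
  proof -
    define v where "v k = intensity par k * power par k powr (2 / pathloss par)" for k
    have v: "0 < v k" "rate_1d k = pi * v k" for k
      using power_pos[of k] intensity_pos[of k] by (simp_all add: v_def rate_1d_def)
    have "(intensity par Helper / intensity par MBS) * (power par Helper / power par MBS) powr (2 / pathloss par) = v Helper / v MBS"
      using power_pos[of Helper] power_pos[of MBS] by (simp add: v_def powr_divide)
    then have "G_fun \<delta> (pathloss par) + p_active par * (intensity par Helper / intensity par MBS)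
          * (power par Helper / power par MBS) powr (2 / pathloss par) * H_fun \<delta> (pathloss par) + 1 =
        G_fun \<delta> (pathloss par) + p_active par * (v Helper / v MBS) * H_fun \<delta> (pathloss par) + 1"
      by (simp only: mult.assoc)
    also have "\<dots> = rate_const \<delta> / rate_1d MBS"
      using v(1)[of MBS] by (simp add: rate_const_def UNIV_tier v(2)) (simp add: field_simps)
    finally show ?thesis by simp
  qed
  then show ?thesis
    using prob_served_limit[OF meas ae] threshold_pos
    by (simp add: C_Mp_def C_Mp_lim_def)
qed

lemma C_Lp_limit:
  assumes valid: "valid_parameters par" and model: "network_model M par net" and content: "n \<in> second_group par"
  shows "((\<lambda>noise. C_Lp M par net noise n k) \<longlongrightarrow> C_Lp_lim par k) (at_right 0)"
proof -
  interpret cached_network M par net n k "stores net n" "p_Lp par"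
    by standard (use assms in auto)
  have candidate: "candidate net n l i x \<longleftrightarrow> eligible l i x" for l i x
    by (cases l) auto
  have "Measurable.pred M (candidate net n l i)" for l i
    unfolding candidate[abs_def] by measurable
  note [measurable] = this
  have meas: "Measurable.pred M (strongest_candidate par net n k j)" for j
    unfolding strongest_candidate_def[abs_def] mean_power_def distance_def by measurable
  have "AE x in M. \<forall>l i. 0 < coord l i x"
    using P.points_positive by (subst AE_all_countable) blast
  then have ae: "AE x in M. \<forall>j. strongest_candidate par net n k j x \<longleftrightarrow> serving k j x"
    by eventually_elim (simp add: strongest_candidate_def serving_def candidate mean_power_le_iff)
  have "rate_1d k * p_elig k / rate_const \<delta> = inverse (xi par k * G_fun \<delta> (pathloss par)
      + varsig par k * H_fun \<delta> (pathloss par) + zet par k)" if \<delta>: "0 < \<delta>" for \<delta>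
  proof -
    have v: "0 < weight par l" "rate_1d l = pi * weight par l" for l
      using power_pos[of l] intensity_pos[of l] by (simp_all add: weight_def rate_1d_def)
    have p: "0 < p_Lp par"
      using valid by (simp add: p_Lp_def valid_parameters_def)
    have sw: "0 < serving_weight par k" "rate_1d k * p_elig k = pi * serving_weight par k"
      using v p by (cases k; simp)+
    \<comment> \<open>An MBS is always a candidate and active, so it has no \<open>H\<close> term.
      The coefficients of \<open>G\<close> and \<open>H\<close> collect the active candidates and
      the active non-candidates; the last bracket collects all candidates. Divided by the serving
      weight they are \<open>xi\<close>, \<open>varsig\<close> and \<open>zet\<close>.\<close>
    have "rate_const \<delta> = pi * ((weight par MBS + p_active par * p_Lp par * weight par Helper) * G_fun \<delta> (pathloss par) +
        p_active par * (1 - p_Lp par) * weight par Helper * H_fun \<delta> (pathloss par) +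
        (weight par MBS + p_Lp par * weight par Helper))"
      by (simp add: rate_const_def UNIV_tier v(2) algebra_simps)
    also have "\<dots> = pi * serving_weight par k * (xi par k * G_fun \<delta> (pathloss par)
        + varsig par k * H_fun \<delta> (pathloss par) + zet par k)"
      using sw(1) by (simp add: xi_def varsig_def zet_def add_divide_distrib[symmetric])
    finally have rc: "rate_const \<delta> = (pi * serving_weight par k) * (xi par k * G_fun \<delta> (pathloss par)
        + varsig par k * H_fun \<delta> (pathloss par) + zet par k)" .
    have nz: "pi * serving_weight par k \<noteq> 0" using sw(1) by simp
    show ?thesis
      unfolding sw(2) rc by (simp only: nonzero_divide_mult_cancel_left[OF nz] inverse_eq_divide)
  qed
  then show ?thesis
    using prob_served_limit[OF meas ae] threshold_pos
    by (simp add: C_Lp_def C_Lp_lim_def)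
qed

theorem corollary1:
  fixes M :: "'w measure" and par :: parameters and net :: "'w network" and n :: nat
  assumes "valid_parameters par"
    and "network_model M par net"
    and "n \<in> second_group par"
  shows "((\<lambda>noise. C_delivery M par net noise n) \<longlongrightarrow>
            Q_Mp par * C_Mp_lim par + Q_Lp par * C_Lp_lim par Helper
            + Q_Lp par * C_Lp_lim par MBS * C_backhaul par) (at_right 0) \<and>
         ((\<lambda>noise. C_Mp M par net noise) \<longlongrightarrow> C_Mp_lim par) (at_right 0) \<and>
         ((\<lambda>noise. C_Lp M par net noise n Helper) \<longlongrightarrow> C_Lp_lim par Helper) (at_right 0) \<and>
         ((\<lambda>noise. C_Lp M par net noise n MBS) \<longlongrightarrow> C_Lp_lim par MBS) (at_right 0)"
  unfolding C_delivery_def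
  by (intro conjI tendsto_add tendsto_mult_left tendsto_mult_right C_Mp_limit[OF assms] C_Lp_limit[OF assms])

end
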